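(* Let $f:N^2\to M$ be a conformal immersion of a Riemannian surface $(N,J^N)$ into an oriented Lorentzian 4-manifold $(M,g)$. Then the following hold. 1. $f$ is $\mathcal{O}_+^-$-holomorphic $\Leftrightarrow H_-=0\Leftrightarrow f$ is positive semi-stationary; and $f$ is $\mathcal{O}_-^-$-holomorphic $\Leftrightarrow H_+=0\Leftrightarrow f$ is negative semi-stationary. 2. $f$ is $\mathcal{O}_+^+$-holomorphic $\Leftrightarrow L_-=0$; and $f$ is $\mathcal{O}_-^+$-holomorphic $\Leftrightarrow L_+=0$. 3. $f$ is $\mathcal{O}_G^+$-holomorphic $\Leftrightarrow f$ is totally umbilic; and $f$ is $\mathcal{O}_G^-$-holomorphic $\Leftrightarrow f$ is stationary $\Leftrightarrow f$ is harmonic. 4. $f$ is $+$horizontal $\Leftrightarrow H_-=L_-=0\Leftrightarrow f$ is $+$isotropic; and $f$ is $-$horizontal $\Leftrightarrow H_+=L_+=0\Leftrightarrow f$ is $-$isotropic.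
   Context: Conventions: Lorentzian metrics have signature $(3,1)$; $SO(M)$ denotes positively oriented frames $s=(s_1,\dots,s_4)$, pseudo-orthonormal with $g(s_1,s_1)=-1$, $g(s_i,s_i)=1$ for $i\ge 2$. A Riemannian surface $(N,J^N)$ is an oriented surface with conformal structure and associated complex structure $J^N$ (rotation by $\pi/2$ in positive direction). A conformal immersion $f:N\to M$ is one for which $f^*g$ is positive definite and in the conformal class. Second fundamental form. A Darboux frame is a local frame $e=(e_1,\dots,e_4)$ in $SO(M)$ along $f$ with $(e_3,e_4)$ a positively oriented orthonormal frame of $TN$. The normal bundle splits as $TN^\perp=TN^\perp_+\oplus TN^\perp_-$ with $TN^\perp_\pm=\mathbb{R}(e_1\pm e_2)$. With $h=f^*g$ and $II$ the normal part of the Levi-Civita connection, $H=\frac12\mathrm{tr}\,II=H_++H_-$ with $H_\pm\in TN^\perp_\pm$, and $II=h\otimes H_++h\otimes H_-+L_++L_-$, where $L_\pm$ is the $TN_\pm^\perp$-component of the trace-free part $II-h\otimes H$. The immersion is positive (negative) semi-stationary if $H_-=0$ ($H_+=0$); $+$isotropic if $H_-=L_-=0$; $-$isotropic if $H_+=L_+=0$; stationary if $H=0$; totally umbilic if $II=h\otimes H$. Harmonicity is that of $f:(N,f^*g)\to(M,g)$. Twistor spaces. $\pi:\mathcal{Z}_\pm(M)\to M$ are both the bundle of null lines in $TM$; the Levi-Civita connection splits the tangent bundle into $T^V\oplus T^H$. At $\ell\in\mathcal{Z}_\pm(M)$ choose $s\in SO(M)$ with $\ell=\mathbb{R}(s_1\pm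 s_2)$; put $K^\ell=\ell$, $L^\ell=\ell^\perp$, $J^\ell:L^\ell/K^\ell\to L^\ell/K^\ell$, $s_3\mapsto s_4$, $s_4\mapsto -s_3$ (mod $\ell$). For $v\in\mathrm{Span}\{s_3,s_4\}$ let $V_v=\frac{d}{dt}|_{0}\mathbb{R}(s_1\pm s_2+tv)\in T_\ell^V$. The almost optical structures $\mathcal{O}_\pm^{\varepsilon}=(\mathcal{K}_\pm,\mathcal{L}_\pm,J_\pm^\varepsilon)$, $\varepsilon\in\{+,-\}$, are: $\mathcal{K}_\pm$ is the horizontal lift of $K^\ell$, $\mathcal{L}_\pm$ is $T^V_\ell$ plus the horizontal lift of $L^\ell$, and $J_\pm^\varepsilon$ on $\mathcal{L}_\pm/\mathcal{K}_\pm$ is the horizontal lift of $J^\ell$ on the horizontal part and, on $T^V_\ell$, $V_{s_3}\mapsto \varepsilon V_{s_4}$, $V_{s_4}\mapsto-\varepsilon V_{s_3}$. Grassmannian bundle. $\pi:\mathcal{G}(M)\to M$ is the bundle of oriented spacelike 2-planes in $TM$, with splitting $T^V\oplus T^H$ from the Levi-Civita connection. At $p\in\mathcal{G}(M)$ choose $s\in SO(M)$ such that $p=\mathrm{Span}\{s_3,s_4\}$ with $(s_3,s_4)$ positively oriented; put $K^p=\mathbb{R}(s_1+s_2)$, $L^p=(s_1+s_2)^\perp$, $J^p: s_3\mapsto s_4,\ s_4\mapsto -s_3$ on $L^p/K^p$. Under $T_p^V\cong \mathrm{Hom}(p,p^\perp)$ let $J_1B=-B\circ j_p$, where $j_p$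 is the rotation $s_3\mapsto s_4$, $s_4\mapsto -s_3$ of $p$. Then $\mathcal{O}_G^\pm=(\mathcal{K}_G,\mathcal{L}_G,J_G^\pm)$ with $\mathcal{K}_G$ the horizontal lift of $K^p$, $\mathcal{L}_G$ equal to $T^V_p$ plus the horizontal lift of $L^p$, and $J_G^\pm$ the horizontal lift of $J^p$ on the horizontal part and $\pm J_1$ on $T^V_p$. Gauss lifts. $v_f:N\to\mathcal{G}(M)$, $n\mapsto df(T_nN)$; $\gamma_{f\pm}:N\to\mathcal{Z}_\pm(M)$ sends $n$ to the null line $(TN^\perp_\pm)_n$. A smooth map $\gamma$ from $(N,J^N)$ to a manifold with almost optical structure $(\mathcal{K},\mathcal{L},J)$ is holomorphic if $d\gamma(TN)\subset\mathcal{L}$, $d\gamma(TN)\cap\mathcal{K}=\{0\}$ and $\hat\pi\circ d\gamma\circ J^N=J\circ\hat\pi\circ d\gamma$, where $\hat\pi:\mathcal{L}\to\mathcal{L}/\mathcal{K}$ is the projection. $f$ is $\mathcal{O}_G^\pm$-holomorphic if $v_f$ is holomorphic with respect to $\mathcal{O}_G^\pm$; $f$ is $\mathcal{O}_+^{\varepsilon}$- (resp. $\mathcal{O}_-^{\varepsilon}$-) holomorphic if $\gamma_{f+}$ (resp. $\gamma_{f-}$) is holomorphic with respect to $\mathcal{O}_+^\varepsilon$ (resp. $\mathcal{O}_-^\varepsilon$). $f$ is $\pm$horizontal if $d\gamma_{f\pm}(T_nN)\subset T^H_{\gamma_{f\pm}(n)}\mathcal{Z}_\pm(M)$ for all $n\in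 N$. *)

theory Defs
  imports "HOL-Analysis.Analysis"
begin

section \<open>Smooth maps between Euclidean spaces\<close>

(* Only used on open sets and with finite-dimensional domain, where boundedness of the degree of
   differentiability in every fixed direction is the usual C^k condition. *)
primrec Ck_on :: "nat \<Rightarrow> 'a::euclidean_space set \<Rightarrow> ('a \<Rightarrow> 'b::real_normed_vector) \<Rightarrow> bool" where
  "Ck_on 0 S f \<longleftrightarrow> continuous_on S f"
| "Ck_on (Suc k) S f \<longleftrightarrow> (\<forall>x\<in>S. f differentiable (at x)) \<and>
     (\<forall>v. Ck_on k S (\<lambda>x. frechet_derivative f (at x) v))"

definition smooth_on :: "'a::euclidean_space set \<Rightarrow> ('a \<Rightarrow> 'b::real_normed_vector) \<Rightarrow> bool" where
  "smooth_on S f \<longleftrightarrow> (\<forall>k. Ck_on k S f)"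

abbreviation differential :: "('a::euclidean_space \<Rightarrow> 'b::real_normed_vector) \<Rightarrow> 'a \<Rightarrow> 'a \<Rightarrow> 'b" where
  "differential f x \<equiv> frechet_derivative f (at x)"

abbreviation jacobian :: "(real^'n::finite \<Rightarrow> real^'m::finite) \<Rightarrow> real^'n \<Rightarrow> real^'n^'m" where
  "jacobian f x \<equiv> matrix (differential f x)"


section \<open>Oriented manifolds and metrics\<close>

(* A chart is a pair of an open domain and a coordinate map. The manifold is the whole type. *)
type_synonym ('a, 'n) chart = "'a set \<times> ('a \<Rightarrow> real^'n)"

definition chart_inv :: "('a, 'n) chart \<Rightarrow> real^'n \<Rightarrow> 'a" where
  "chart_inv c = inv_into (fst c) (snd c)"

definition chart_ran :: "('a, 'n) chart \<Rightarrow> (real^'n) set" where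
  "chart_ran c = snd c ` fst c"

definition is_chart :: "('a::topological_space, 'n::finite) chart \<Rightarrow> bool" where
  "is_chart c \<longleftrightarrow> open (fst c) \<and> open (chart_ran c) \<and>
     homeomorphism (fst c) (chart_ran c) (snd c) (chart_inv c)"

definition transition :: "('a, 'n) chart \<Rightarrow> ('a, 'n) chart \<Rightarrow> real^'n \<Rightarrow> real^'n" where
  "transition c c' = snd c' \<circ> chart_inv c"

(* The orientation is the one for which the charts of the given atlas are positively oriented. *)
definition oriented_atlas ::
    "('a::{t2_space,second_countable_topology}, 'n::finite) chart set \<Rightarrow> bool" where
  "oriented_atlas A \<longleftrightarrow> (\<forall>c\<in>A. is_chart c) \<and> (\<Union>c\<in>A. fst c) = UNIV \<and>
     (\<forall>c\<in>A. \<forall>c'\<in>A. smooth_on (snd c ` (fst c \<inter> fst c')) (transition c c') \<and>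
        (\<forall>x\<in>snd c ` (fst c \<inter> fst c'). det (jacobian (transition c c') x) > 0))"

(* Tensor fields are given by their components: in a chart c, a tangent vector is its coordinate
   vector, a metric g is the matrix g c x at the point with coordinates x, and an endomorphism
   field likewise. Components in different charts are related by the usual transformation laws;
   values outside chart_ran c carry no meaning. *)
type_synonym ('a, 'n) tensor2 = "('a, 'n) chart \<Rightarrow> real^'n \<Rightarrow> real^'n^'n"

definition metric_tensor :: "('a, 'n::finite) chart set \<Rightarrow> ('a, 'n) tensor2 \<Rightarrow> bool" where
  "metric_tensor A g \<longleftrightarrow>
     (\<forall>c\<in>A. smooth_on (chart_ran c) (g c) \<and> (\<forall>x\<in>chart_ran c. transpose (g c x) = g c x)) \<and>
     (\<forall>c\<in>A. \<forall>c'\<in>A. \<forall>x\<in>snd c ` (fst c \<inter> fst c').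
        g c x = transpose (jacobian (transition c c') x) ** g c' (transition c c' x)
                  ** jacobian (transition c c') x)"

definition ip :: "real^'n::finite^'n \<Rightarrow> real^'n \<Rightarrow> real^'n \<Rightarrow> real" where
  "ip g u v = u \<bullet> (g *v v)"

definition riemannian_metric :: "('a, 'n::finite) chart set \<Rightarrow> ('a, 'n) tensor2 \<Rightarrow> bool" where
  "riemannian_metric A h \<longleftrightarrow> metric_tensor A h \<and>
     (\<forall>c\<in>A. \<forall>x\<in>chart_ran c. \<forall>v. v \<noteq> 0 \<longrightarrow> ip (h c x) v v > 0)"

(* A frame (s_1,...,s_4) is stored as the matrix with rows s $ 1, ..., s $ 4. *)
definition pseudo_orthonormal :: "real^4^4 \<Rightarrow> real^4^4 \<Rightarrow> bool" where
  "pseudo_orthonormal g s \<longleftrightarrow>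
     (\<forall>i j. ip g (s $ i) (s $ j) = (if i = j then (if i = 1 then - 1 else 1) else 0))"

definition SO_frame :: "real^4^4 \<Rightarrow> real^4^4 \<Rightarrow> bool" where
  "SO_frame g s \<longleftrightarrow> pseudo_orthonormal g s \<and> det s > 0"

definition lorentzian_metric :: "('a, 4) chart set \<Rightarrow> ('a, 4) tensor2 \<Rightarrow> bool" where
  "lorentzian_metric A g \<longleftrightarrow> metric_tensor A g \<and>
     (\<forall>c\<in>A. \<forall>x\<in>chart_ran c. \<exists>s. pseudo_orthonormal (g c x) s)"


section \<open>Riemannian surfaces and conformal immersions\<close>

definition conformally_equivalent ::
    "('a, 'n::finite) chart set \<Rightarrow> ('a, 'n) tensor2 \<Rightarrow> ('a, 'n) tensor2 \<Rightarrow> bool" where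
  "conformally_equivalent A h h' \<longleftrightarrow>
     (\<exists>\<rho>. (\<forall>p. \<rho> p > 0) \<and> (\<forall>c\<in>A. \<forall>p\<in>fst c. h' c (snd c p) = \<rho> p *\<^sub>R h c (snd c p)))"

(* The conformal factor between two Riemannian metrics is automatically smooth. *)
definition conformal_structure :: "('a, 'n::finite) chart set \<Rightarrow> ('a, 'n) tensor2 set \<Rightarrow> bool" where
  "conformal_structure A C \<longleftrightarrow> (\<exists>h. riemannian_metric A h \<and>
     C = {h'. riemannian_metric A h' \<and> conformally_equivalent A h h'})"

definition pos_basis :: "real^2 \<Rightarrow> real^2 \<Rightarrow> bool" where
  "pos_basis X Y \<longleftrightarrow> det (vector [X, Y] :: real^2^2) > 0"

(* J is the rotation by a positive right angle; this determines J uniquely, and hence implies its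
   transformation law and smoothness. *)
definition riemannian_surface ::
    "('a::{t2_space,second_countable_topology}, 2) chart set \<Rightarrow> ('a, 2) tensor2 set \<Rightarrow>
     ('a, 2) tensor2 \<Rightarrow> bool" where
  "riemannian_surface A C J \<longleftrightarrow> oriented_atlas A \<and> conformal_structure A C \<and>
     (\<forall>h\<in>C. \<forall>c\<in>A. \<forall>y\<in>chart_ran c. \<forall>X. X \<noteq> 0 \<longrightarrow>
        ip (h c y) (J c y *v X) (J c y *v X) = ip (h c y) X X \<and>
        ip (h c y) X (J c y *v X) = 0 \<and> pos_basis X (J c y *v X))"

definition local_rep :: "('a, 'n) chart \<Rightarrow> ('b, 'm) chart \<Rightarrow> ('a \<Rightarrow> 'b) \<Rightarrow> real^'n \<Rightarrow> real^'m" where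
  "local_rep d c f = snd c \<circ> f \<circ> chart_inv d"

definition local_dom :: "('a, 'n) chart \<Rightarrow> ('b, 'm) chart \<Rightarrow> ('a \<Rightarrow> 'b) \<Rightarrow> (real^'n) set" where
  "local_dom d c f = snd d ` (fst d \<inter> f -` fst c)"

definition smooth_map ::
    "('a::topological_space, 'n::finite) chart set \<Rightarrow> ('b::topological_space, 'm::finite) chart set \<Rightarrow>
     ('a \<Rightarrow> 'b) \<Rightarrow> bool" where
  "smooth_map A B f \<longleftrightarrow> continuous_on UNIV f \<and>
     (\<forall>d\<in>A. \<forall>c\<in>B. smooth_on (local_dom d c f) (local_rep d c f))"

(* A condition on local expressions, required at every point of the source and in all charts
   around it and its image. *)
definition in_charts ::
    "('a, 'n) chart set \<Rightarrow> ('b, 'm) chart set \<Rightarrow> ('a \<Rightarrow> 'b) \<Rightarrow>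
     (('a, 'n) chart \<Rightarrow> ('b, 'm) chart \<Rightarrow> real^'n \<Rightarrow> bool) \<Rightarrow> bool" where
  "in_charts A B f P \<longleftrightarrow> (\<forall>d\<in>A. \<forall>c\<in>B. \<forall>y\<in>local_dom d c f. P d c y)"

(* In the local notions below, G is the matrix of the ambient metric as a function of the
   coordinates, and F is the coordinate expression of the map f. *)
definition pullback ::
    "(real^'m::finite \<Rightarrow> real^'m^'m) \<Rightarrow> (real^'n::finite \<Rightarrow> real^'m) \<Rightarrow> real^'n \<Rightarrow> real^'n^'n" where
  "pullback G F y = transpose (jacobian F y) ** G (F y) ** jacobian F y"

definition conformal_immersion ::
    "('a::topological_space, 2) chart set \<Rightarrow> ('a, 2) tensor2 set \<Rightarrow>
     ('b::topological_space, 4) chart set \<Rightarrow> ('b, 4) tensor2 \<Rightarrow> ('a \<Rightarrow> 'b) \<Rightarrow> bool" where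
  "conformal_immersion A C B g f \<longleftrightarrow> smooth_map A B f \<and>
     in_charts A B f (\<lambda>d c y. inj (differential (local_rep d c f) y)) \<and>
     (\<exists>h\<in>C. in_charts A B f (\<lambda>d c y. h d y = pullback (g c) (local_rep d c f) y))"


section \<open>Levi-Civita connection and second fundamental form\<close>

(* Christoffel symbols of the Levi-Civita connection, contracted with u and v. *)
definition christoffel ::
    "(real^'n::finite \<Rightarrow> real^'n^'n) \<Rightarrow> real^'n \<Rightarrow> real^'n \<Rightarrow> real^'n \<Rightarrow> real^'n" where
  "christoffel G x u v = (\<chi> k. \<Sum>i\<in>UNIV. \<Sum>j\<in>UNIV. \<Sum>l\<in>UNIV.
     1/2 * matrix_inv (G x) $ k $ l *
       (differential G x (axis i 1) $ j $ l + differential G x (axis j 1) $ i $ l - differential G x (axis l 1) $ i $ j)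
     * u $ i * v $ j)"

(* Covariant derivative in direction X of a vector field W along F. *)
definition cov_deriv ::
    "(real^'m::finite \<Rightarrow> real^'m^'m) \<Rightarrow> (real^'n::finite \<Rightarrow> real^'m) \<Rightarrow> (real^'n \<Rightarrow> real^'m) \<Rightarrow>
     real^'n \<Rightarrow> real^'n \<Rightarrow> real^'m" where
  "cov_deriv G F W y X = differential W y X + christoffel G (F y) (differential F y X) (W y)"

definition normal_space ::
    "(real^'m::finite \<Rightarrow> real^'m^'m) \<Rightarrow> (real^'n::finite \<Rightarrow> real^'m) \<Rightarrow> real^'n \<Rightarrow> (real^'m) set" where
  "normal_space G F y = {v. \<forall>X. ip (G (F y)) v (differential F y X) = 0}"

definition normal_part ::
    "(real^'m::finite \<Rightarrow> real^'m^'m) \<Rightarrow> (real^'n::finite \<Rightarrow> real^'m) \<Rightarrow> real^'n \<Rightarrow> real^'m \<Rightarrow> real^'m" where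
  "normal_part G F y v = (THE w. w \<in> normal_space G F y \<and> v - w \<in> range (differential F y))"

(* Y is extended to the vector field with constant components; II is tensorial. *)
definition II ::
    "(real^4 \<Rightarrow> real^4^4) \<Rightarrow> (real^2 \<Rightarrow> real^4) \<Rightarrow> real^2 \<Rightarrow> real^2 \<Rightarrow> real^2 \<Rightarrow> real^4" where
  "II G F y X Y = normal_part G F y (cov_deriv G F (\<lambda>y'. differential F y' Y) y X)"

definition mean_curv :: "(real^4 \<Rightarrow> real^4^4) \<Rightarrow> (real^2 \<Rightarrow> real^4) \<Rightarrow> real^2 \<Rightarrow> real^4" where
  "mean_curv G F y = (1/2) *\<^sub>R (\<Sum>i\<in>UNIV. \<Sum>j\<in>UNIV.
     matrix_inv (pullback G F y) $ i $ j *\<^sub>R II G F y (axis i 1) (axis j 1))"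

definition trace_free_part ::
    "(real^4 \<Rightarrow> real^4^4) \<Rightarrow> (real^2 \<Rightarrow> real^4) \<Rightarrow> real^2 \<Rightarrow> real^2 \<Rightarrow> real^2 \<Rightarrow> real^4" where
  "trace_free_part G F y X Y = II G F y X Y - ip (pullback G F y) X Y *\<^sub>R mean_curv G F y"

definition darboux_frame ::
    "(real^4 \<Rightarrow> real^4^4) \<Rightarrow> (real^2 \<Rightarrow> real^4) \<Rightarrow> real^2 \<Rightarrow> real^4^4 \<Rightarrow> bool" where
  "darboux_frame G F y e \<longleftrightarrow> SO_frame (G (F y)) e \<and>
     (\<exists>X Y. pos_basis X Y \<and> e $ 3 = differential F y X \<and> e $ 4 = differential F y Y)"

(* From here on \<sigma> and \<epsilon> are signs, 1 or -1. The null normal line with sign \<sigma>; it does not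
   depend on the Darboux frame. *)
definition null_normal ::
    "(real^4 \<Rightarrow> real^4^4) \<Rightarrow> (real^2 \<Rightarrow> real^4) \<Rightarrow> real \<Rightarrow> real^2 \<Rightarrow> (real^4) set" where
  "null_normal G F \<sigma> y = {r *\<^sub>R (e $ 1 + \<sigma> *\<^sub>R e $ 2) | r e. darboux_frame G F y e}"

definition null_comp ::
    "(real^4 \<Rightarrow> real^4^4) \<Rightarrow> (real^2 \<Rightarrow> real^4) \<Rightarrow> real \<Rightarrow> real^2 \<Rightarrow> real^4 \<Rightarrow> real^4" where
  "null_comp G F \<sigma> y v = (THE a. a \<in> null_normal G F \<sigma> y \<and> v - a \<in> null_normal G F (- \<sigma>) y)"

definition H_pm :: "(real^4 \<Rightarrow> real^4^4) \<Rightarrow> (real^2 \<Rightarrow> real^4) \<Rightarrow> real \<Rightarrow> real^2 \<Rightarrow> real^4" where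
  "H_pm G F \<sigma> y = null_comp G F \<sigma> y (mean_curv G F y)"

definition L_pm ::
    "(real^4 \<Rightarrow> real^4^4) \<Rightarrow> (real^2 \<Rightarrow> real^4) \<Rightarrow> real \<Rightarrow> real^2 \<Rightarrow> real^2 \<Rightarrow> real^2 \<Rightarrow> real^4" where
  "L_pm G F \<sigma> y X Y = null_comp G F \<sigma> y (trace_free_part G F y X Y)"

(* Trace of the covariant derivative of df, with respect to the pulled-back metric on the source
   and its own Levi-Civita connection. *)
definition tension :: "(real^4 \<Rightarrow> real^4^4) \<Rightarrow> (real^2 \<Rightarrow> real^4) \<Rightarrow> real^2 \<Rightarrow> real^4" where
  "tension G F y = (\<Sum>i\<in>UNIV. \<Sum>j\<in>UNIV. matrix_inv (pullback G F y) $ i $ j *\<^sub>R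
     (cov_deriv G F (\<lambda>y'. differential F y' (axis j 1)) y (axis i 1)
       - differential F y (christoffel (pullback G F) y (axis i 1) (axis j 1))))"

definition H_vanishes where
  "H_vanishes A B g f \<sigma> \<longleftrightarrow>
     in_charts A B f (\<lambda>d c y. H_pm (g c) (local_rep d c f) \<sigma> y = 0)"

definition L_vanishes where
  "L_vanishes A B g f \<sigma> \<longleftrightarrow>
     in_charts A B f (\<lambda>d c y. \<forall>X Y. L_pm (g c) (local_rep d c f) \<sigma> y X Y = 0)"

definition positive_semi_stationary where
  "positive_semi_stationary A B g f \<longleftrightarrow> H_vanishes A B g f (- 1)"

definition negative_semi_stationary where
  "negative_semi_stationary A B g f \<longleftrightarrow> H_vanishes A B g f 1"

definition plus_isotropic where
  "plus_isotropic A B g f \<longleftrightarrow> H_vanishes A B g f (- 1) \<and> L_vanishes A B g f (- 1)"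

definition minus_isotropic where
  "minus_isotropic A B g f \<longleftrightarrow> H_vanishes A B g f 1 \<and> L_vanishes A B g f 1"

definition stationary where
  "stationary A B g f \<longleftrightarrow> in_charts A B f (\<lambda>d c y. mean_curv (g c) (local_rep d c f) y = 0)"

definition totally_umbilic where
  "totally_umbilic A B g f \<longleftrightarrow> in_charts A B f (\<lambda>d c y. \<forall>X Y.
     II (g c) (local_rep d c f) y X Y =
       ip (pullback (g c) (local_rep d c f) y) X Y *\<^sub>R mean_curv (g c) (local_rep d c f) y)"

definition harmonic where
  "harmonic A B g f \<longleftrightarrow> in_charts A B f (\<lambda>d c y. tension (g c) (local_rep d c f) y = 0)"


section \<open>Almost optical structures and holomorphic maps\<close>

(* Over a chart of M with coordinate range U, the bundles of null lines and of oriented spacelike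
   planes are presented as submanifolds of Euclidean space: a point is a pair of the coordinates x
   of the base point and the matrix representing the line (orthogonal projection of the coordinate
   space onto it) or the oriented plane (Pluecker coordinates). The bundle projection is fst.
   Tangent vectors are velocities of curves in the submanifold. *)
definition tangent_vectors :: "'v::real_normed_vector set \<Rightarrow> 'v \<Rightarrow> 'v set" where
  "tangent_vectors S z =
     {\<xi>. \<exists>c::real \<Rightarrow> 'v. (\<forall>t. c t \<in> S) \<and> c 0 = z \<and> (c has_vector_derivative \<xi>) (at 0)}"

definition vertical_vectors :: "((real^4) \<times> (real^4^4)) set \<Rightarrow> (real^4) \<times> (real^4^4) \<Rightarrow>
    ((real^4) \<times> (real^4^4)) set" where
  "vertical_vectors S z = {\<xi> \<in> tangent_vectors S z. fst \<xi> = 0}"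

(* The quotient by a subspace K consists of the cosets of K. *)
definition coset :: "'v::real_vector set \<Rightarrow> 'v \<Rightarrow> 'v set" where
  "coset K \<xi> = {\<xi> + k | k. k \<in> K}"

(* An almost optical structure at a point is a triple of K, L and the map J on cosets of K in L;
   d is the differential of the map in question and j is the complex structure of the surface. *)
definition holomorphic_at ::
    "'v::real_vector set \<Rightarrow> 'v set \<Rightarrow> ('v set \<Rightarrow> 'v set) \<Rightarrow> (real^2 \<Rightarrow> real^2) \<Rightarrow>
     (real^2 \<Rightarrow> 'v) \<Rightarrow> bool" where
  "holomorphic_at K L J j d \<longleftrightarrow> range d \<subseteq> L \<and> range d \<inter> K = {0} \<and>
     (\<forall>X. coset K (d (j X)) = J (coset K (d X)))"

(* s $ 3 is sent to s $ 4 and s $ 4 to - s $ 3, for a pseudo-orthonormal frame s. *)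
definition rot :: "real^4^4 \<Rightarrow> real^4^4 \<Rightarrow> real^4 \<Rightarrow> real^4" where
  "rot g s u = ip g u (s $ 3) *\<^sub>R s $ 4 - ip g u (s $ 4) *\<^sub>R s $ 3"


subsection \<open>Twistor spaces\<close>

(* The line spanned by a nonzero vector n. *)
definition line_pt :: "real^4 \<Rightarrow> real^4^4" where
  "line_pt n = (\<chi> i j. n $ i * n $ j / (n \<bullet> n))"

definition twistor_space :: "(real^4) set \<Rightarrow> (real^4 \<Rightarrow> real^4^4) \<Rightarrow> ((real^4) \<times> (real^4^4)) set" where
  "twistor_space U G = {(x, line_pt n) | x n. x \<in> U \<and> n \<noteq> 0 \<and> ip (G x) n n = 0}"

(* Horizontal lift of v to the line spanned by n: the velocity of a line whose generator has
   vanishing covariant derivative; it depends on the line only. *)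
definition line_hlift :: "(real^4 \<Rightarrow> real^4^4) \<Rightarrow> real^4 \<Rightarrow> real^4 \<Rightarrow> real^4 \<Rightarrow> (real^4) \<times> (real^4^4)" where
  "line_hlift G x n v =
     (v, vector_derivative (\<lambda>t. line_pt (n - t *\<^sub>R christoffel G x v n)) (at 0))"

definition line_vert :: "real^4 \<Rightarrow> real^4 \<Rightarrow> (real^4) \<times> (real^4^4)" where
  "line_vert n v = (0, vector_derivative (\<lambda>t. line_pt (n + t *\<^sub>R v)) (at 0))"

definition twistor_frame ::
    "real \<Rightarrow> (real^4 \<Rightarrow> real^4^4) \<Rightarrow> (real^4) \<times> (real^4^4) \<Rightarrow> real^4^4 \<Rightarrow> bool" where
  "twistor_frame \<sigma> G z s \<longleftrightarrow> SO_frame (G (fst z)) s \<and> snd z = line_pt (s $ 1 + \<sigma> *\<^sub>R s $ 2)"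

definition twistor_horizontal ::
    "(real^4 \<Rightarrow> real^4^4) \<Rightarrow> (real^4) \<times> (real^4^4) \<Rightarrow> ((real^4) \<times> (real^4^4)) set" where
  "twistor_horizontal G z = {line_hlift G (fst z) n v | n v. n \<noteq> 0 \<and> snd z = line_pt n}"

definition twistor_K ::
    "(real^4 \<Rightarrow> real^4^4) \<Rightarrow> (real^4) \<times> (real^4^4) \<Rightarrow> ((real^4) \<times> (real^4^4)) set" where
  "twistor_K G z =
     {line_hlift G (fst z) n v | n v. n \<noteq> 0 \<and> snd z = line_pt n \<and> v \<in> span {n}}"

definition twistor_L ::
    "(real^4) set \<Rightarrow> (real^4 \<Rightarrow> real^4^4) \<Rightarrow> (real^4) \<times> (real^4^4) \<Rightarrow> ((real^4) \<times> (real^4^4)) set" where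
  "twistor_L U G z =
     {\<xi> + line_hlift G (fst z) n v | \<xi> n v. \<xi> \<in> vertical_vectors (twistor_space U G) z \<and>
        n \<noteq> 0 \<and> snd z = line_pt n \<and> ip (G (fst z)) n v = 0}"

(* Every coset of K in L has a representative line_vert n v + line_hlift G x n w with v and w in
   the span of s $ 3 and s $ 4; the image coset does not depend on the choices. *)
definition twistor_J ::
    "real \<Rightarrow> real \<Rightarrow> (real^4 \<Rightarrow> real^4^4) \<Rightarrow> (real^4) \<times> (real^4^4) \<Rightarrow>
     ((real^4) \<times> (real^4^4)) set \<Rightarrow> ((real^4) \<times> (real^4^4)) set" where
  "twistor_J \<sigma> \<epsilon> G z C = \<Union> {
     coset (twistor_K G z)
       (\<epsilon> *\<^sub>R line_vert n (rot (G (fst z)) s v) + line_hlift G (fst z) n (rot (G (fst z)) s w))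
     | s n v w. twistor_frame \<sigma> G z s \<and> n = s $ 1 + \<sigma> *\<^sub>R s $ 2 \<and>
         v \<in> span {s $ 3, s $ 4} \<and> w \<in> span {s $ 3, s $ 4} \<and>
         line_vert n v + line_hlift G (fst z) n w \<in> C}"

definition twistor_lift ::
    "real \<Rightarrow> (real^4 \<Rightarrow> real^4^4) \<Rightarrow> (real^2 \<Rightarrow> real^4) \<Rightarrow> real^2 \<Rightarrow> (real^4) \<times> (real^4^4)" where
  "twistor_lift \<sigma> G F y =
     (F y, THE P. \<exists>n. n \<noteq> 0 \<and> null_normal G F \<sigma> y = span {n} \<and> P = line_pt n)"

(* Holomorphicity with respect to the structure with sign \<epsilon> on the twistor space with sign \<sigma>. *)
definition O_holomorphic where
  "O_holomorphic A J B g f \<sigma> \<epsilon> \<longleftrightarrow>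
     (\<forall>d\<in>A. \<forall>c\<in>B. smooth_on (local_dom d c f) (twistor_lift \<sigma> (g c) (local_rep d c f))) \<and>
     in_charts A B f (\<lambda>d c y.
       let \<gamma> = twistor_lift \<sigma> (g c) (local_rep d c f) in
       holomorphic_at (twistor_K (g c) (\<gamma> y)) (twistor_L (chart_ran c) (g c) (\<gamma> y))
         (twistor_J \<sigma> \<epsilon> (g c) (\<gamma> y)) ((*v) (J d y)) (differential \<gamma> y))"

definition horizontal where
  "horizontal A B g f \<sigma> \<longleftrightarrow> in_charts A B f (\<lambda>d c y.
     let \<gamma> = twistor_lift \<sigma> (g c) (local_rep d c f) in
     range (differential \<gamma> y) \<subseteq> twistor_horizontal (g c) (\<gamma> y))"


subsection \<open>The Grassmannian bundle\<close>

(* The plane with positive basis (u, v), as the unit bivector proportional to u \<and> v. *)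
definition plane_pt :: "real^4 \<Rightarrow> real^4 \<Rightarrow> real^4^4" where
  "plane_pt u v = (let \<omega> = (\<chi> i j. u $ i * v $ j - v $ i * u $ j) in \<omega> /\<^sub>R norm \<omega>)"

definition grassmannian :: "(real^4) set \<Rightarrow> (real^4 \<Rightarrow> real^4^4) \<Rightarrow> ((real^4) \<times> (real^4^4)) set" where
  "grassmannian U G = {(x, plane_pt u v) | x u v. x \<in> U \<and>
     (\<forall>a b. (a, b) \<noteq> (0, 0) \<longrightarrow>
        ip (G x) (a *\<^sub>R u + b *\<^sub>R v) (a *\<^sub>R u + b *\<^sub>R v) > 0)}"

definition plane_hlift ::
    "(real^4 \<Rightarrow> real^4^4) \<Rightarrow> real^4 \<Rightarrow> real^4^4 \<Rightarrow> real^4 \<Rightarrow> (real^4) \<times> (real^4^4)" where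
  "plane_hlift G x s v = (v, vector_derivative
     (\<lambda>t. plane_pt (s $ 3 - t *\<^sub>R christoffel G x v (s $ 3)) (s $ 4 - t *\<^sub>R christoffel G x v (s $ 4)))
     (at 0))"

definition grass_frame ::
    "(real^4 \<Rightarrow> real^4^4) \<Rightarrow> (real^4) \<times> (real^4^4) \<Rightarrow> real^4^4 \<Rightarrow> bool" where
  "grass_frame G z s \<longleftrightarrow> SO_frame (G (fst z)) s \<and> snd z = plane_pt (s $ 3) (s $ 4)"

(* The vertical vector corresponding to a homomorphism b from a plane to its orthogonal complement:
   the velocity of the planes (id + t b) p. *)
definition plane_vert :: "real^4^4 \<Rightarrow> (real^4 \<Rightarrow> real^4) \<Rightarrow> (real^4) \<times> (real^4^4)" where
  "plane_vert s b = (0, vector_derivative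
     (\<lambda>t. plane_pt (s $ 3 + t *\<^sub>R b (s $ 3)) (s $ 4 + t *\<^sub>R b (s $ 4))) (at 0))"

definition grass_K ::
    "(real^4 \<Rightarrow> real^4^4) \<Rightarrow> (real^4) \<times> (real^4^4) \<Rightarrow> ((real^4) \<times> (real^4^4)) set" where
  "grass_K G z =
     {plane_hlift G (fst z) s v | s v. grass_frame G z s \<and> v \<in> span {s $ 1 + s $ 2}}"

definition grass_L ::
    "(real^4) set \<Rightarrow> (real^4 \<Rightarrow> real^4^4) \<Rightarrow> (real^4) \<times> (real^4^4) \<Rightarrow> ((real^4) \<times> (real^4^4)) set" where
  "grass_L U G z =
     {\<xi> + plane_hlift G (fst z) s v | \<xi> s v. \<xi> \<in> vertical_vectors (grassmannian U G) z \<and>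
        grass_frame G z s \<and> ip (G (fst z)) (s $ 1 + s $ 2) v = 0}"

definition J1 :: "real^4^4 \<Rightarrow> real^4^4 \<Rightarrow> (real^4 \<Rightarrow> real^4) \<Rightarrow> real^4 \<Rightarrow> real^4" where
  "J1 g s b = (\<lambda>u. - b (rot g s u))"

(* As for twistor_J; only the restriction of the linear map b to the plane matters. *)
definition grass_J ::
    "real \<Rightarrow> (real^4 \<Rightarrow> real^4^4) \<Rightarrow> (real^4) \<times> (real^4^4) \<Rightarrow>
     ((real^4) \<times> (real^4^4)) set \<Rightarrow> ((real^4) \<times> (real^4^4)) set" where
  "grass_J \<epsilon> G z C = \<Union> {
     coset (grass_K G z)
       (\<epsilon> *\<^sub>R plane_vert s (J1 (G (fst z)) s b) + plane_hlift G (fst z) s (rot (G (fst z)) s w))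
     | s b w. grass_frame G z s \<and> linear b \<and>
         (\<forall>u\<in>span {s $ 3, s $ 4}. \<forall>v\<in>span {s $ 3, s $ 4}. ip (G (fst z)) (b u) v = 0) \<and>
         w \<in> span {s $ 3, s $ 4} \<and> plane_vert s b + plane_hlift G (fst z) s w \<in> C}"

definition grass_lift :: "(real^2 \<Rightarrow> real^4) \<Rightarrow> real^2 \<Rightarrow> (real^4) \<times> (real^4^4)" where
  "grass_lift F y = (F y, plane_pt (differential F y (axis 1 1)) (differential F y (axis 2 1)))"

definition O_G_holomorphic where
  "O_G_holomorphic A J B g f \<epsilon> \<longleftrightarrow>
     (\<forall>d\<in>A. \<forall>c\<in>B. smooth_on (local_dom d c f) (grass_lift (local_rep d c f))) \<and>
     in_charts A B f (\<lambda>d c y.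
       let \<gamma> = grass_lift (local_rep d c f) in
       holomorphic_at (grass_K (g c) (\<gamma> y)) (grass_L (chart_ran c) (g c) (\<gamma> y))
         (grass_J \<epsilon> (g c) (\<gamma> y)) ((*v) (J d y)) (differential \<gamma> y))"

end

theory Submission
  imports Defs
begin

text \<open>
  Let \<open>e\<close> be a Darboux frame along \<open>f\<close> and \<open>n = e\<^sub>1 + \<sigma> e\<^sub>2\<close> with \<open>\<sigma> = \<plusminus>1\<close>, so that \<open>n\<close> generates
  the null normal line that the twistor lift assigns to a point. The velocity of this lift in direction
  \<open>X\<close> is the horizontal lift of \<open>df(X)\<close> plus the vertical vector given by \<open>\<nabla>\<^sub>X n\<close> modulo \<open>n\<close>. As \<open>n\<close>
  is null and normal along the surface, \<open>\<nabla>\<^sub>X n\<close> is orthogonal to \<open>n\<close>, and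
  \<open>g(\<nabla>\<^sub>X n, df(Y)) = - g(n, \<nabla>\<^sub>X df(Y)) = - g(n, II(X,Y))\<close>. Modulo \<open>n\<close> it is therefore the tangent vector
  \<open>shape X = - a(X,E\<^sub>3) e\<^sub>3 - a(X,E\<^sub>4) e\<^sub>4\<close>, where \<open>df(E\<^sub>i) = e\<^sub>i\<close> and \<open>a(X,Y) = g(n, II(X,Y))\<close>
  (\<open>twistor_lift_derivative\<close>). Because \<open>n\<close> is null, \<open>a\<close> detects precisely the component of \<open>II\<close> in the
  opposite null line (\<open>null_comp_eq\<close>), which explains the exchange of signs in the theorem.

  The lift is horizontal if \<open>a = 0\<close>. It always is tangent to \<open>L\<close> and transversal to \<open>K\<close>, and its
  horizontal part intertwines the complex structures because \<open>f\<close> is conformal. Holomorphicity thus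
  reduces to \<open>shape (J X) = \<epsilon> rot (shape X)\<close> (\<open>holomorphic_at_twistor_iff\<close>). For the symmetric
  2-by-2 matrix of \<open>a\<close> this means that the matrix commutes (\<open>\<epsilon> = 1\<close>) or anticommutes (\<open>\<epsilon> = -1\<close>) with
  the rotation by a right angle: it is a multiple of the identity, or it has trace \<open>0\<close>. The former is
  the vanishing of \<open>L\<close>, the latter that of \<open>H\<close>.

  On the Grassmannian the vertical part of the velocity of the Gauss lift is \<open>II(X, _)\<close> itself, a
  homomorphism from the tangent plane to the normal plane (\<open>grass_lift_derivative\<close>), and holomorphicity
  becomes \<open>II(J X, Y) = - \<epsilon> II(X, J Y)\<close>. By the same algebra this says that \<open>II\<close> is a multiple of the
  metric, or that its trace vanishes. The tension field is the trace of the Hessian minus its tangential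
  part, hence twice the mean curvature vector (\<open>tension_eq\<close>).

  Three points need care in coordinates. The optical structures are defined by means of frames, and
  two frames for the same null line or plane have to be compared; orientation decides the
  result (\<open>same_null_line_rotation\<close>, \<open>same_plane_null_line\<close>, and with their help \<open>twistor_J_eq\<close> and
  \<open>grass_J_eq\<close>). Lines and planes are points of spaces of matrices, and a vertical vector
  determines its vector modulo \<open>n\<close>, or its homomorphism, through the kernels of the derivatives
  of these embeddings (\<open>line_deriv_eq_0_iff\<close>, \<open>plane_deriv_normal_eq_0\<close>). Finally, the twistor lift
  is smooth because the Lorentzian Gram--Schmidt process provides smooth local Darboux frames
  (\<open>local_darboux_field\<close>).
\<close>

section \<open>Calculus of smooth maps\<close>

lemma Ck_on_cong:
  assumes "open S" "\<And>x. x \<in> S \<Longrightarrow> f x = g x" "Ck_on k S f"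
  shows "Ck_on k S g"
  using assms(2,3)
proof (induction k arbitrary: f g)
  case 0
  then show ?case by (simp cong: continuous_on_cong)
next
  case (Suc k)
  have D: "(g has_derivative frechet_derivative f (at x)) (at x)" if "x \<in> S" for x
  proof (rule has_derivative_transform_within_open[OF _ \<open>open S\<close> that])
    show "(f has_derivative frechet_derivative f (at x)) (at x)"
      using Suc.prems(2) that by (simp flip: frechet_derivative_works)
  qed (use Suc.prems(1) in auto)
  then have eq: "frechet_derivative f (at x) = frechet_derivative g (at x)" if "x \<in> S" for x
    using frechet_derivative_at that by blast
  have "Ck_on k S (\<lambda>x. frechet_derivative g (at x) v)" for v
    by (rule Suc.IH[of "\<lambda>x. frechet_derivative f (at x) v"]) (use eq Suc.prems in auto)
  with D show ?case by (auto simp: differentiable_def)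
qed

text \<open>The recursive clause refers to a choice of derivative; this form accepts any family of derivatives
  that has been computed by the usual rules.\<close>

lemma Ck_on_SucI:
  assumes "open S" "\<And>x. x \<in> S \<Longrightarrow> (f has_derivative D x) (at x)" "\<And>v. Ck_on k S (\<lambda>x. D x v)"
  shows "Ck_on (Suc k) S f"
proof -
  have "D x = frechet_derivative f (at x)" if "x \<in> S" for x
    using assms(2)[OF that] frechet_derivative_at by blast
  then have "Ck_on k S (\<lambda>x. frechet_derivative f (at x) v)" for v
    using Ck_on_cong[OF assms(1) _ assms(3)[of v]] by auto
  then show ?thesis using assms(2) by (auto simp: differentiable_def)
qed

lemma Ck_on_Suc_derivative:
  "Ck_on (Suc k) S f \<Longrightarrow> x \<in> S \<Longrightarrow> (f has_derivative frechet_derivative f (at x)) (at x)"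
  by (simp flip: frechet_derivative_works)

lemma Ck_on_SucD: "Ck_on (Suc k) S f \<Longrightarrow> Ck_on k S f"
proof (induction k arbitrary: f)
  case 0
  then show ?case
    by (auto intro!: continuous_at_imp_continuous_on differentiable_imp_continuous_within)
next
  case (Suc k)
  from Suc.prems have "Ck_on (Suc k) S (\<lambda>x. frechet_derivative f (at x) v)" for v
    using Ck_on.simps(2) by blast
  then have "Ck_on k S (\<lambda>x. frechet_derivative f (at x) v)" for v
    using Suc.IH by blast
  with Suc.prems show ?case by simp
qed

lemma Ck_on_subset: "Ck_on k S f \<Longrightarrow> T \<subseteq> S \<Longrightarrow> Ck_on k T f"
  by (induction k arbitrary: f) (auto intro: continuous_on_subset)

text \<open>Needed because the lifts are shown to be smooth by means of frames that exist only locally.\<close>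

lemma Ck_on_local:
  assumes "\<And>x. x \<in> S \<Longrightarrow> \<exists>T. open T \<and> x \<in> T \<and> Ck_on k T f"
  shows "Ck_on k S f"
  using assms
proof (induction k arbitrary: f)
  case 0
  then show ?case
    by (metis Ck_on.simps(1) continuous_at_imp_continuous_on continuous_on_eq_continuous_at)
next
  case (Suc k)
  have "f differentiable (at x)" if "x \<in> S" for x
    using Suc.prems[OF that] by auto
  moreover have "Ck_on k S (\<lambda>x. frechet_derivative f (at x) v)" for v
    by (rule Suc.IH) (use Suc.prems in fastforce)
  ultimately show ?case by simp
qed

lemma Ck_on_const: "open S \<Longrightarrow> Ck_on k S (\<lambda>x. c)"
proof (induction k arbitrary: c)
  case (Suc k)
  show ?case
    by (rule Ck_on_SucI[OF Suc.prems has_derivative_const]) (use Suc in auto)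
qed simp

lemma Ck_on_linear:
  assumes "bounded_linear L" "open S" "Ck_on k S f"
  shows "Ck_on k S (\<lambda>x. L (f x))"
  using assms(3)
proof (induction k arbitrary: f)
  case 0
  then show ?case
    using bounded_linear.continuous_on[OF assms(1)] by auto
next
  case (Suc k)
  show ?case
    by (rule Ck_on_SucI[OF assms(2)
          bounded_linear.has_derivative[OF assms(1) Ck_on_Suc_derivative[OF Suc.prems]]])
      (use Suc in auto)
qed

lemma Ck_on_add:
  assumes "open S" "Ck_on k S f" "Ck_on k S g"
  shows "Ck_on k S (\<lambda>x. f x + g x)"
  using assms(2,3)
proof (induction k arbitrary: f g)
  case 0
  then show ?case by (auto intro: continuous_intros)
next
  case (Suc k)
  show ?case
    by (rule Ck_on_SucI[OF assms(1) has_derivative_add[OF Ck_on_Suc_derivative[OF Suc.prems(1)]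
          Ck_on_Suc_derivative[OF Suc.prems(2)]]]) (use Suc in auto)
qed

lemma Ck_on_sum:
  assumes "open S" "\<And>i. i \<in> I \<Longrightarrow> Ck_on k S (f i)"
  shows "Ck_on k S (\<lambda>x. \<Sum>i\<in>I. f i x)"
  using assms(2)
  by (induction I rule: infinite_finite_induct) (auto intro: Ck_on_const Ck_on_add assms(1))

lemma Ck_on_bilinear:
  assumes "bounded_bilinear B" "open S" "Ck_on k S f" "Ck_on k S g"
  shows "Ck_on k S (\<lambda>x. B (f x) (g x))"
  using assms(3,4)
proof (induction k arbitrary: f g)
  case 0
  then show ?case
    using bounded_bilinear.continuous_on[OF assms(1)] by auto
next
  case (Suc k)
  show ?case
  proof (rule Ck_on_SucI[OF assms(2) bounded_bilinear.FDERIV[OF assms(1)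
        Ck_on_Suc_derivative[OF Suc.prems(1)] Ck_on_Suc_derivative[OF Suc.prems(2)]]])
    show "Ck_on k S (\<lambda>x. B (f x) (frechet_derivative g (at x) v) + B (frechet_derivative f (at x) v) (g x))" for v
      using Suc.prems Ck_on_SucD[OF Suc.prems(1)] Ck_on_SucD[OF Suc.prems(2)]
      by (intro Ck_on_add assms(2) Suc.IH) auto
  qed auto
qed

text \<open>The chain rule expresses the derivative of the composition through a composition of the same kind
  only after the inner derivative has been expanded in a basis: the coefficients depend on the point,
  while the derivatives of the outer map are taken in the finitely many basis directions.\<close>

lemma Ck_on_compose:
  fixes f :: "'a::euclidean_space \<Rightarrow> 'b::euclidean_space"
  assumes "open S" "open T" "f ` S \<subseteq> T" "Ck_on k T g" "Ck_on k S f"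
  shows "Ck_on k S (\<lambda>x. g (f x))"
  using assms(4,5)
proof (induction k arbitrary: g)
  case 0
  then show ?case
    using continuous_on_compose2[OF _ _ assms(3)] by auto
next
  case (Suc k)
  have Dg: "(g has_derivative frechet_derivative g (at (f x))) (at (f x))" if "x \<in> S" for x
    using Ck_on_Suc_derivative[OF Suc.prems(1)] that assms(3) by blast
  have D: "((\<lambda>x. g (f x)) has_derivative
      (\<lambda>v. frechet_derivative g (at (f x)) (frechet_derivative f (at x) v))) (at x)" if "x \<in> S" for x
    using has_derivative_compose[OF Ck_on_Suc_derivative[OF Suc.prems(2) that] Dg[OF that]] .
  show ?case
  proof (rule Ck_on_SucI[OF assms(1) D])
    fix v
    have *: "frechet_derivative g (at (f x)) w =
        (\<Sum>b\<in>Basis. (w \<bullet> b) *\<^sub>R frechet_derivative g (at (f x)) b)" if "x \<in> S" for x w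
    proof -
      have "linear (frechet_derivative g (at (f x)))"
        using Dg[OF that] by (simp add: has_derivative_linear)
      then show ?thesis
        by (subst (1) euclidean_representation[of w, symmetric])
          (simp add: linear_sum linear_cmul)
    qed
    have "Ck_on k S (\<lambda>x. \<Sum>b\<in>Basis. (frechet_derivative f (at x) v \<bullet> b) *\<^sub>R
        frechet_derivative g (at (f x)) b)"
    proof (rule Ck_on_sum[OF assms(1)], rule Ck_on_bilinear[OF bounded_bilinear_scaleR assms(1)])
      fix b :: 'b
      show "Ck_on k S (\<lambda>x. frechet_derivative f (at x) v \<bullet> b)"
        using Suc.prems(2) by (intro Ck_on_linear[OF bounded_linear_inner_left assms(1)]) simp
      show "Ck_on k S (\<lambda>x. frechet_derivative g (at (f x)) b)"
        using Suc.prems Ck_on_SucD[OF Suc.prems(2)]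
        by (intro Suc.IH) auto
    qed
    then show "Ck_on k S (\<lambda>x. frechet_derivative g (at (f x)) (frechet_derivative f (at x) v))"
      by (rule Ck_on_cong[OF assms(1), rotated]) (use * in simp)
  qed
qed

text \<open>Inverses and inverse square roots of positive functions are powers with a real exponent, and
  this family is closed under differentiation.\<close>

lemma Ck_on_powr: "Ck_on k {0<..} (\<lambda>t::real. t powr a)"
proof (induction k arbitrary: a)
  case 0
  then show ?case by (auto intro!: continuous_intros)
next
  case (Suc k)
  have D: "((\<lambda>t. t powr a) has_derivative (\<lambda>v. v * (a * t powr (a - 1)))) (at t)"
    if "t \<in> {0<..}" for t :: real
  proof -
    have "((\<lambda>t. t powr a) has_real_derivative a * t powr (a - 1)) (at t)"
      using that has_real_derivative_powr by auto
    then show ?thesis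
      by (simp add: has_field_derivative_def mult.commute[of _ "a * t powr (a - 1)"])
  qed
  show ?case
    by (rule Ck_on_SucI[OF open_greaterThan D])
      (auto intro!: Ck_on_linear[OF bounded_linear_mult_right] Suc.IH)
qed

lemma smooth_on_Ck: "smooth_on S f \<Longrightarrow> Ck_on k S f"
  by (simp add: smooth_on_def)

lemma smooth_on_cong: "open S \<Longrightarrow> (\<And>x. x \<in> S \<Longrightarrow> f x = g x) \<Longrightarrow> smooth_on S f \<Longrightarrow> smooth_on S g"
  unfolding smooth_on_def using Ck_on_cong by blast

lemma smooth_on_subset: "smooth_on S f \<Longrightarrow> T \<subseteq> S \<Longrightarrow> smooth_on T f"
  unfolding smooth_on_def using Ck_on_subset by blast

lemma smooth_on_local:
  "(\<And>x. x \<in> S \<Longrightarrow> \<exists>T. open T \<and> x \<in> T \<and> smooth_on T f) \<Longrightarrow> smooth_on S f"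
  unfolding smooth_on_def by (meson Ck_on_local)

lemma smooth_on_const: "open S \<Longrightarrow> smooth_on S (\<lambda>x. c)"
  by (simp add: smooth_on_def Ck_on_const)

lemma smooth_on_linear:
  "bounded_linear L \<Longrightarrow> open S \<Longrightarrow> smooth_on S f \<Longrightarrow> smooth_on S (\<lambda>x. L (f x))"
  by (simp add: smooth_on_def Ck_on_linear)

lemma smooth_on_add:
  "open S \<Longrightarrow> smooth_on S f \<Longrightarrow> smooth_on S g \<Longrightarrow> smooth_on S (\<lambda>x. f x + g x)"
  by (simp add: smooth_on_def Ck_on_add)

lemma smooth_on_minus:
  "open S \<Longrightarrow> smooth_on S f \<Longrightarrow> smooth_on S (\<lambda>x. - f x)"
  by (rule smooth_on_linear[OF bounded_linear_minus[OF bounded_linear_ident]])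

lemma smooth_on_diff:
  "open S \<Longrightarrow> smooth_on S f \<Longrightarrow> smooth_on S g \<Longrightarrow> smooth_on S (\<lambda>x. f x - g x)"
  using smooth_on_add[OF _ _ smooth_on_minus, of S f g] by simp

lemma smooth_on_bilinear:
  "bounded_bilinear B \<Longrightarrow> open S \<Longrightarrow> smooth_on S f \<Longrightarrow> smooth_on S g \<Longrightarrow>
    smooth_on S (\<lambda>x. B (f x) (g x))"
  by (simp add: smooth_on_def Ck_on_bilinear)

lemmas smooth_on_scaleR = smooth_on_bilinear[OF bounded_bilinear_scaleR]
lemmas smooth_on_mult = smooth_on_bilinear[OF bounded_bilinear_mult]
lemmas smooth_on_inner = smooth_on_bilinear[OF bounded_bilinear_inner]

lemma smooth_on_compose:
  fixes f :: "'a::euclidean_space \<Rightarrow> 'b::euclidean_space"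
  shows "open S \<Longrightarrow> open T \<Longrightarrow> f ` S \<subseteq> T \<Longrightarrow> smooth_on T g \<Longrightarrow> smooth_on S f \<Longrightarrow>
    smooth_on S (\<lambda>x. g (f x))"
  unfolding smooth_on_def using Ck_on_compose by blast

lemma smooth_on_powr:
  fixes f :: "'a::euclidean_space \<Rightarrow> real"
  assumes "open S" "smooth_on S f" "\<And>x. x \<in> S \<Longrightarrow> f x > 0"
  shows "smooth_on S (\<lambda>x. f x powr a)"
  by (rule smooth_on_compose[OF assms(1) open_greaterThan[of 0] _ _ assms(2)])
    (use assms(3) Ck_on_powr in \<open>auto simp: smooth_on_def\<close>)

lemma smooth_on_Pair:
  assumes "open S" "smooth_on S f" "smooth_on S g"
  shows "smooth_on S (\<lambda>x. (f x, g x))"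
proof -
  have "smooth_on S (\<lambda>x. (f x, 0) + (0, g x))"
    using assms by (intro smooth_on_add smooth_on_linear[of "\<lambda>a. (a, 0)"]
        smooth_on_linear[of "\<lambda>b. (0, b)"] bounded_linear_Pair bounded_linear_ident bounded_linear_zero)
  then show ?thesis by simp
qed

lemma smooth_on_has_derivative:
  "smooth_on S f \<Longrightarrow> x \<in> S \<Longrightarrow> (f has_derivative frechet_derivative f (at x)) (at x)"
  using Ck_on_Suc_derivative smooth_on_Ck by blast

lemma smooth_on_linear_derivative: "smooth_on S f \<Longrightarrow> x \<in> S \<Longrightarrow> linear (frechet_derivative f (at x))"
  using smooth_on_has_derivative has_derivative_linear by blast

lemma smooth_on_derivative: "smooth_on S f \<Longrightarrow> smooth_on S (\<lambda>x. frechet_derivative f (at x) v)"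
  unfolding smooth_on_def by (metis Ck_on.simps(2))

lemma smooth_on_continuous: "smooth_on S f \<Longrightarrow> continuous_on S f"
  using smooth_on_Ck[of S f 0] by simp

subsection \<open>Symmetry of second derivatives\<close>

text \<open>Two applications of the mean value theorem to the second difference
  \<open>f (x + t v + t w) - f (x + t v) - f (x + t w) + f x\<close>: first along \<open>v\<close>, then along \<open>w\<close>.\<close>

lemma second_difference_mean_value:
  fixes f :: "'a::euclidean_space \<Rightarrow> real"
  assumes f: "smooth_on S f" and t: "t > 0"
    and S: "\<And>a b. 0 \<le> a \<Longrightarrow> a \<le> t \<Longrightarrow> 0 \<le> b \<Longrightarrow> b \<le> t \<Longrightarrow> x + a *\<^sub>R v + b *\<^sub>R w \<in> S"
  shows "\<exists>a b. 0 \<le> a \<and> a \<le> t \<and> 0 \<le> b \<and> b \<le> t \<and>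
    f (x + t *\<^sub>R v + t *\<^sub>R w) - f (x + t *\<^sub>R v) - f (x + t *\<^sub>R w) + f x =
      t * t * differential (\<lambda>z. differential f z v) (x + a *\<^sub>R v + b *\<^sub>R w) w"
proof -
  define u where "u = (\<lambda>a. f (x + a *\<^sub>R v + t *\<^sub>R w) - f (x + a *\<^sub>R v))"
  have line: "((\<lambda>s. h (p + s *\<^sub>R q)) has_real_derivative differential h (p + s *\<^sub>R q) q) (at s)"
    if "smooth_on S h" "p + s *\<^sub>R q \<in> S" for h :: "'a \<Rightarrow> real" and p q s
  proof -
    note D = smooth_on_has_derivative[OF that]
    have "((\<lambda>s. h (p + s *\<^sub>R q)) has_derivative (\<lambda>r. differential h (p + s *\<^sub>R q) (r *\<^sub>R q))) (at s)"
      by (rule has_derivative_compose[of "\<lambda>s. p + s *\<^sub>R q", OF _ D]) (auto intro!: derivative_eq_intros)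
    then show ?thesis
      by (simp add: has_field_derivative_def linear_cmul[OF has_derivative_linear[OF D]]
          mult_commute_abs)
  qed
  have du: "(u has_real_derivative
      (differential f (x + a *\<^sub>R v + t *\<^sub>R w) v - differential f (x + a *\<^sub>R v) v)) (at a)"
    if "0 \<le> a" "a \<le> t" for a
    unfolding u_def
  proof (intro derivative_intros)
    show "((\<lambda>a. f (x + a *\<^sub>R v + t *\<^sub>R w)) has_real_derivative
        differential f (x + a *\<^sub>R v + t *\<^sub>R w) v) (at a)"
      using line[OF f, of "x + t *\<^sub>R w" a v] S[of a t] that t by (simp add: algebra_simps)
    show "((\<lambda>a. f (x + a *\<^sub>R v)) has_real_derivative differential f (x + a *\<^sub>R v) v) (at a)"
      using line[OF f, of x a v] S[of a 0] that t by simp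
  qed
  obtain a where a: "0 < a" "a < t"
    "u t - u 0 = (t - 0) * (differential f (x + a *\<^sub>R v + t *\<^sub>R w) v - differential f (x + a *\<^sub>R v) v)"
    using MVT2[OF t, of u, OF du] by blast
  define k where "k = (\<lambda>z. differential f z v)"
  have k: "smooth_on S k" unfolding k_def by (rule smooth_on_derivative[OF f])
  have dk: "((\<lambda>b. k (x + a *\<^sub>R v + b *\<^sub>R w)) has_real_derivative
      differential k (x + a *\<^sub>R v + b *\<^sub>R w) w) (at b)" if "0 \<le> b" "b \<le> t" for b
    by (rule line[OF k]) (use S[of a b] a that in auto)
  obtain b where b: "0 < b" "b < t" "k (x + a *\<^sub>R v + t *\<^sub>R w) - k (x + a *\<^sub>R v + 0 *\<^sub>R w) =
      (t - 0) * differential k (x + a *\<^sub>R v + b *\<^sub>R w) w"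
    using MVT2[OF t, of "\<lambda>b. k (x + a *\<^sub>R v + b *\<^sub>R w)", OF dk] by blast
  have "u t - u 0 = t * t * differential k (x + a *\<^sub>R v + b *\<^sub>R w) w"
    using a(3) b(3) by (simp add: k_def)
  then show ?thesis
    using a b unfolding u_def k_def
    by (intro exI[of _ a] exI[of _ b]) (auto simp: algebra_simps)
qed

lemma second_derivative_symmetric_real:
  fixes f :: "'a::euclidean_space \<Rightarrow> real"
  assumes S: "open S" "x \<in> S" and f: "smooth_on S f"
  shows "differential (\<lambda>z. differential f z v) x w = differential (\<lambda>z. differential f z w) x v"
proof -
  define A where "A = (\<lambda>v w z. differential (\<lambda>z. differential f z v) z w)"
  have cont: "isCont (A v w) x" for v w
    using smooth_on_continuous[OF smooth_on_derivative[OF smooth_on_derivative[OF f]]] S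
      continuous_on_eq_continuous_at unfolding A_def by blast
  have "\<bar>A v w x - A w v x\<bar> < e" if "e > 0" for e
  proof -
    have "\<forall>\<^sub>F z in nhds x. z \<in> S \<and> \<bar>A v w z - A v w x\<bar> < e/2 \<and> \<bar>A w v z - A w v x\<bar> < e/2"
    proof (intro eventually_conj)
      show "\<forall>\<^sub>F z in nhds x. z \<in> S" using S by (rule eventually_nhds_in_open)
      have "\<forall>\<^sub>F z in nhds x. \<bar>A v w z - A v w x\<bar> < e/2" for v w
        using tendstoD[OF iffD1[OF continuous_within cont[of v w]], of "e/2"] that
        by (auto simp: eventually_at_filter dist_real_def elim!: eventually_mono)
      then show "\<forall>\<^sub>F z in nhds x. \<bar>A v w z - A v w x\<bar> < e/2"
        "\<forall>\<^sub>F z in nhds x. \<bar>A w v z - A w v x\<bar> < e/2" by blast+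
    qed
    then obtain d where d: "d > 0" "\<And>z. dist z x < d \<Longrightarrow>
        z \<in> S \<and> \<bar>A v w z - A v w x\<bar> < e/2 \<and> \<bar>A w v z - A w v x\<bar> < e/2"
      unfolding eventually_nhds_metric by blast
    \<comment> \<open>small enough for all x + a v + b w with a and b between 0 and t to lie within distance d of x\<close>
    define t where "t = d / (2 * (norm v + norm w + 1))"
    have n: "norm v + norm w + 1 > 0" by (meson add_nonneg_pos add_nonneg_nonneg norm_ge_zero zero_less_one)
    have t: "t > 0" using d n by (simp add: t_def)
    have near: "dist (x + a *\<^sub>R v + b *\<^sub>R w) x < d" if "0 \<le> a" "a \<le> t" "0 \<le> b" "b \<le> t" for a b
    proof -
      have "norm (a *\<^sub>R v + b *\<^sub>R w) \<le> a * norm v + b * norm w"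
        by (rule norm_triangle_le) (use that in auto)
      also have "\<dots> \<le> t * norm v + t * norm w"
        using that by (intro add_mono mult_right_mono) auto
      also have "\<dots> < t * (2 * (norm v + norm w + 1))"
        using t mult_pos_pos[OF t n] by (simp add: algebra_simps)
      also have "\<dots> = d" using n by (simp add: t_def)
      finally show ?thesis by (simp add: dist_norm algebra_simps)
    qed
    obtain a b where 1: "0 \<le> a" "a \<le> t" "0 \<le> b" "b \<le> t"
      "f (x + t *\<^sub>R v + t *\<^sub>R w) - f (x + t *\<^sub>R v) - f (x + t *\<^sub>R w) + f x =
        t * t * A v w (x + a *\<^sub>R v + b *\<^sub>R w)"
      using second_difference_mean_value[OF f t, of x v w] near d(2) unfolding A_def by blast
    have near': "dist (x + a *\<^sub>R w + b *\<^sub>R v) x < d" if "0 \<le> a" "a \<le> t" "0 \<le> b" "b \<le> t" for a b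
      using near[of b a] that by (simp add: algebra_simps)
    obtain a' b' where 2: "0 \<le> a'" "a' \<le> t" "0 \<le> b'" "b' \<le> t"
      "f (x + t *\<^sub>R w + t *\<^sub>R v) - f (x + t *\<^sub>R w) - f (x + t *\<^sub>R v) + f x =
        t * t * A w v (x + a' *\<^sub>R w + b' *\<^sub>R v)"
      using second_difference_mean_value[OF f t, of x w v] near' d(2) unfolding A_def by blast
    have "t * t * A v w (x + a *\<^sub>R v + b *\<^sub>R w) = t * t * A w v (x + a' *\<^sub>R w + b' *\<^sub>R v)"
      using 1(5) 2(5) by (simp add: algebra_simps)
    then have "A v w (x + a *\<^sub>R v + b *\<^sub>R w) = A w v (x + a' *\<^sub>R w + b' *\<^sub>R v)"
      using t by simp
    then show ?thesis
      using d(2)[OF near[OF 1(1-4)]] d(2)[OF near'[OF 2(1-4)]] by linarith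
  qed
  from this[of "\<bar>A v w x - A w v x\<bar>"] have "A v w x = A w v x"
    by auto
  then show ?thesis by (simp add: A_def)
qed

lemma second_derivative_symmetric:
  fixes f :: "'a::euclidean_space \<Rightarrow> 'b::euclidean_space"
  assumes S: "open S" "x \<in> S" and f: "smooth_on S f"
  shows "differential (\<lambda>z. differential f z v) x w = differential (\<lambda>z. differential f z w) x v"
proof (rule euclidean_eqI)
  fix b :: 'b
  have comp: "differential (\<lambda>z. h z \<bullet> b) z v = differential h z v \<bullet> b"
    if "smooth_on S h" "z \<in> S" for h :: "'a \<Rightarrow> 'b" and z v
    using frechet_derivative_at[OF bounded_linear.has_derivative[OF bounded_linear_inner_left
          smooth_on_has_derivative[OF that]]] by metis
  have fb: "smooth_on S (\<lambda>z. f z \<bullet> b)"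
    by (rule smooth_on_linear[OF bounded_linear_inner_left S(1) f])
  have two: "differential (\<lambda>z. differential (\<lambda>z. f z \<bullet> b) z v) x w =
      differential (\<lambda>z. differential f z v) x w \<bullet> b" for v w
  proof -
    have "((\<lambda>z. differential f z v \<bullet> b) has_derivative
        (\<lambda>w. differential (\<lambda>z. differential f z v) x w \<bullet> b)) (at x)"
      by (rule bounded_linear.has_derivative[OF bounded_linear_inner_left
            smooth_on_has_derivative[OF smooth_on_derivative[OF f] S(2)]])
    then have "((\<lambda>z. differential (\<lambda>z. f z \<bullet> b) z v) has_derivative
        (\<lambda>w. differential (\<lambda>z. differential f z v) x w \<bullet> b)) (at x)"
      by (rule has_derivative_transform_within_open[OF _ S]) (simp add: comp[OF f])
    then show ?thesis using frechet_derivative_at by metis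
  qed
  show "differential (\<lambda>z. differential f z v) x w \<bullet> b = differential (\<lambda>z. differential f z w) x v \<bullet> b"
    using second_derivative_symmetric_real[OF S fb, of v w] by (simp add: two)
qed

section \<open>Frames in a Lorentzian vector space\<close>

lemma ip_left [simp]:
  "ip g (u + v) w = ip g u w + ip g v w" "ip g (u - v) w = ip g u w - ip g v w"
  "ip g (c *\<^sub>R u) w = c * ip g u w" "ip g (- u) w = - ip g u w" "ip g 0 w = 0"
  by (simp_all add: ip_def inner_left_distrib inner_diff_left)

lemma ip_right [simp]:
  "ip g w (u + v) = ip g w u + ip g w v" "ip g w (u - v) = ip g w u - ip g w v"
  "ip g w (c *\<^sub>R u) = c * ip g w u" "ip g w (- u) = - ip g w u" "ip g w 0 = 0"
  by (simp_all add: ip_def inner_right_distrib inner_diff_right matrix_vector_right_distrib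
      matrix_vector_mult_diff_distrib matrix_vector_mult_scaleR vec.neg vec.zero)

lemma ip_sym: "transpose g = g \<Longrightarrow> ip g u v = ip g v u"
  unfolding ip_def by (metis dot_lmul_matrix inner_commute transpose_matrix_vector)

lemma vector_4 [simp]:
  "(vector [x, y, z, w] :: ('a::zero)^4) $ 1 = x" "(vector [x, y, z, w] :: ('a::zero)^4) $ 2 = y"
  "(vector [x, y, z, w] :: ('a::zero)^4) $ 3 = z" "(vector [x, y, z, w] :: ('a::zero)^4) $ 4 = w"
  unfolding vector_def by simp_all

lemma det_4:
  fixes A :: "real^4^4"
  shows "det A =
    A$1$1 * (A$2$2 * (A$3$3 * A$4$4 - A$3$4 * A$4$3) - A$2$3 * (A$3$2 * A$4$4 - A$3$4 * A$4$2)
      + A$2$4 * (A$3$2 * A$4$3 - A$3$3 * A$4$2))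
    - A$1$2 * (A$2$1 * (A$3$3 * A$4$4 - A$3$4 * A$4$3) - A$2$3 * (A$3$1 * A$4$4 - A$3$4 * A$4$1)
      + A$2$4 * (A$3$1 * A$4$3 - A$3$3 * A$4$1))
    + A$1$3 * (A$2$1 * (A$3$2 * A$4$4 - A$3$4 * A$4$2) - A$2$2 * (A$3$1 * A$4$4 - A$3$4 * A$4$1)
      + A$2$4 * (A$3$1 * A$4$2 - A$3$2 * A$4$1))
    - A$1$4 * (A$2$1 * (A$3$2 * A$4$3 - A$3$3 * A$4$2) - A$2$2 * (A$3$1 * A$4$3 - A$3$3 * A$4$1)
      + A$2$3 * (A$3$1 * A$4$2 - A$3$2 * A$4$1))"
proof -
  have f1: "finite {2::4, 3, 4}" "1 \<notin> {2::4, 3, 4}" by auto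
  have f2: "finite {3::4, 4}" "2 \<notin> {3::4, 4}" by auto
  have f3: "finite {4::4}" "3 \<notin> {4::4}" by auto
  show ?thesis
    unfolding det_def UNIV_4
    unfolding sum_over_permutations_insert[OF f1]
    unfolding sum_over_permutations_insert[OF f2]
    unfolding sum_over_permutations_insert[OF f3]
    unfolding permutes_sing
    by (simp add: sign_swap_id permutation_swap_id sign_compose sign_id swap_id_eq
        permutation_compose)
      (simp add: right_diff_distrib distrib_left mult_ac)
qed

lemma det_linear_combinations:
  fixes x y z w :: "real^4"
  shows "det (vector [a1 *\<^sub>R x + b1 *\<^sub>R y + c1 *\<^sub>R z + d1 *\<^sub>R w,
      a2 *\<^sub>R x + b2 *\<^sub>R y + c2 *\<^sub>R z + d2 *\<^sub>R w,
      a3 *\<^sub>R x + b3 *\<^sub>R y + c3 *\<^sub>R z + d3 *\<^sub>R w,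
      a4 *\<^sub>R x + b4 *\<^sub>R y + c4 *\<^sub>R z + d4 *\<^sub>R w] :: real^4^4) =
    det (vector [vector [a1, b1, c1, d1], vector [a2, b2, c2, d2], vector [a3, b3, c3, d3],
      vector [a4, b4, c4, d4]] :: real^4^4) * det (vector [x, y, z, w] :: real^4^4)"
  (is "det ?L = det ?C * det ?X")
proof -
  have "?L = ?C ** ?X"
    by (simp add: vec_eq_iff forall_4 matrix_matrix_mult_def sum_4)
  then show ?thesis by (simp add: det_mul)
qed

lemma vector_rows_4: "vector [s $ 1, s $ 2, s $ 3, s $ 4] = (s :: real^4^4)"
  by (simp add: vec_eq_iff[where 'b=4] forall_4)

text \<open>A pseudo-orthonormal frame is a basis with the obvious coefficient functions: in matrix form
  the orthonormality relations say that the frame has a right inverse, which is then also a left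
  inverse.\<close>

lemma pseudo_orthonormal_left_inverse:
  assumes "pseudo_orthonormal g s"
  shows "(\<chi> k j. (if j = 1 then - 1 else 1) * (g *v s $ j) $ k) ** s = mat 1" (is "?T ** s = _")
proof -
  have "(s ** ?T) $ i $ j = (if j = 1 then - 1 else 1) * ip g (s $ i) (s $ j)" for i j
    by (simp add: matrix_matrix_mult_def ip_def inner_vec_def sum_negf)
  then have "s ** ?T = mat 1"
    using assms by (auto simp: vec_eq_iff mat_def pseudo_orthonormal_def)
  then show ?thesis by (simp add: matrix_left_right_inverse)
qed

lemma pseudo_orthonormal_det: "pseudo_orthonormal g s \<Longrightarrow> det s \<noteq> 0"
  using pseudo_orthonormal_left_inverse invertible_det_nz invertible_left_inverse by blast

lemma pseudo_orthonormal_expansion: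
  assumes "pseudo_orthonormal g s"
  shows "v = - ip g v (s $ 1) *\<^sub>R s $ 1 + ip g v (s $ 2) *\<^sub>R s $ 2 + ip g v (s $ 3) *\<^sub>R s $ 3
    + ip g v (s $ 4) *\<^sub>R s $ 4"
proof -
  define \<eta> :: "4 \<Rightarrow> real" where "\<eta> j = (if j = 1 then - 1 else 1)" for j
  define T :: "real^4^4" where "T = (\<chi> k j. \<eta> j * (g *v s $ j) $ k)"
  have T: "T ** s = mat 1"
    using pseudo_orthonormal_left_inverse[OF assms] by (simp add: T_def \<eta>_def)
  have "v $ l = (\<Sum>j\<in>UNIV. \<eta> j * ip g v (s $ j) * s $ j $ l)" for l
  proof -
    have "v $ l = (v v* (T ** s)) $ l" by (simp add: T)
    also have "\<dots> = ((v v* T) v* s) $ l" by (simp add: vector_matrix_mul_assoc)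
    also have "\<dots> = (\<Sum>j\<in>UNIV. s $ j $ l * (\<Sum>k\<in>UNIV. \<eta> j * (g *v s $ j) $ k * v $ k))"
      by (simp add: vector_matrix_mult_def T_def mult_ac)
    also have "\<dots> = (\<Sum>j\<in>UNIV. \<eta> j * ip g v (s $ j) * s $ j $ l)"
      by (simp add: ip_def inner_vec_def sum_distrib_left mult_ac)
    finally show ?thesis .
  qed
  then show ?thesis by (simp add: vec_eq_iff sum_4 \<eta>_def)
qed

lemma pseudo_orthonormal_ip:
  assumes "pseudo_orthonormal g s" "transpose g = g"
  shows "ip g v w = - ip g v (s $ 1) * ip g w (s $ 1) + ip g v (s $ 2) * ip g w (s $ 2)
    + ip g v (s $ 3) * ip g w (s $ 3) + ip g v (s $ 4) * ip g w (s $ 4)"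
  by (subst (1) pseudo_orthonormal_expansion[OF assms(1), of v])
    (simp add: ip_sym[OF assms(2), of "s $ _" w])

text \<open>In coordinates orthogonality reads \<open>u\<^sub>1 w\<^sub>1 = u\<^sub>2 w\<^sub>2 + u\<^sub>3 w\<^sub>3 + u\<^sub>4 w\<^sub>4\<close>. The Cauchy--Schwarz
  inequality for the right-hand side and \<open>u\<^sub>2\<^sup>2 + u\<^sub>3\<^sup>2 + u\<^sub>4\<^sup>2 < u\<^sub>1\<^sup>2\<close> bound \<open>w\<^sub>1\<^sup>2\<close> strictly by the
  spatial part of \<open>w\<close>.\<close>

lemma orthogonal_to_timelike:
  assumes s: "pseudo_orthonormal g s" and g: "transpose g = g"
    and u: "ip g u u < 0" and w: "ip g u w = 0" "w \<noteq> 0"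
  shows "ip g w w > 0"
proof -
  define x y where "x = (\<lambda>i. ip g u (s $ i))" and "y = (\<lambda>i. ip g w (s $ i))"
  have u': "(x 2)\<^sup>2 + (x 3)\<^sup>2 + (x 4)\<^sup>2 < (x 1)\<^sup>2"
    using u pseudo_orthonormal_ip[OF s g, of u u] by (simp add: x_def power2_eq_square)
  have uw: "x 1 * y 1 = x 2 * y 2 + x 3 * y 3 + x 4 * y 4"
    using w(1) pseudo_orthonormal_ip[OF s g, of u w] by (simp add: x_def y_def)
  have nz: "y 1 \<noteq> 0 \<or> y 2 \<noteq> 0 \<or> y 3 \<noteq> 0 \<or> y 4 \<noteq> 0"
    using w(2) pseudo_orthonormal_expansion[OF s, of w] by (auto simp: y_def)
  have x1: "x 1 \<noteq> 0"
  proof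
    assume "x 1 = 0"
    with u' have "(x 2)\<^sup>2 + (x 3)\<^sup>2 + (x 4)\<^sup>2 < 0" by simp
    then show False by (smt (verit) zero_le_power2)
  qed
  define Y where "Y = (y 2)\<^sup>2 + (y 3)\<^sup>2 + (y 4)\<^sup>2"
  have "Y \<noteq> 0"
  proof
    assume "Y = 0"
    then have "y 2 = 0" "y 3 = 0" "y 4 = 0"
      unfolding Y_def by (smt (verit) zero_le_power2 power2_eq_iff zero_power2 power_zero_numeral pos2 power_eq_0_iff)+
    with nz uw x1 show False by simp
  qed
  then have Y: "Y > 0" unfolding Y_def by (smt (verit) zero_le_power2)
  have "(x 1)\<^sup>2 * (y 1)\<^sup>2 = (x 2 * y 2 + x 3 * y 3 + x 4 * y 4)\<^sup>2"
    by (simp add: uw[symmetric] power_mult_distrib)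
  also have "\<dots> \<le> ((x 2)\<^sup>2 + (x 3)\<^sup>2 + (x 4)\<^sup>2) * Y"
  proof -
    have "((x 2)\<^sup>2 + (x 3)\<^sup>2 + (x 4)\<^sup>2) * Y - (x 2 * y 2 + x 3 * y 3 + x 4 * y 4)\<^sup>2 =
        (x 2 * y 3 - x 3 * y 2)\<^sup>2 + (x 2 * y 4 - x 4 * y 2)\<^sup>2 + (x 3 * y 4 - x 4 * y 3)\<^sup>2"
      unfolding Y_def by (simp add: power2_eq_square algebra_simps)
    then show ?thesis by (smt (verit) zero_le_power2)
  qed
  also have "\<dots> < (x 1)\<^sup>2 * Y" using u' Y by simp
  finally have "(y 1)\<^sup>2 < Y" using x1 by simp
  then show ?thesis
    using pseudo_orthonormal_ip[OF s g, of w w] by (simp add: y_def Y_def power2_eq_square)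
qed

text \<open>Projecting a timelike vector orthogonally to a spacelike plane makes its square even more negative,
  so the normal plane contains a timelike direction; whatever is orthogonal to that direction is
  spacelike. The sign of the second vector is then free to adjust the orientation.\<close>

lemma spacelike_plane_frame:
  assumes s: "pseudo_orthonormal g s" and g: "transpose g = g"
    and a: "ip g a a = 1" "ip g a b = 0" "ip g b b = 1"
  shows "\<exists>e. SO_frame g e \<and> e $ 3 = a \<and> e $ 4 = b"
proof -
  note sym = ip_sym[OF g]
  have s11: "ip g (s $ 1) (s $ 1) = - 1" using s by (simp add: pseudo_orthonormal_def)
  define u where "u = s $ 1 - ip g (s $ 1) a *\<^sub>R a - ip g (s $ 1) b *\<^sub>R b"
  have ua: "ip g u a = 0" and ub: "ip g u b = 0"
    using a by (simp_all add: u_def sym[of b a])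
  have "ip g u u = ip g u (s $ 1)"
    using ua ub by (subst (2) u_def) simp
  also have "\<dots> = - 1 - (ip g (s $ 1) a)\<^sup>2 - (ip g (s $ 1) b)\<^sup>2"
    by (simp add: u_def s11 power2_eq_square sym[of a "s $ 1"] sym[of b "s $ 1"])
  finally have uu: "ip g u u < 0" by (smt (verit) zero_le_power2)
  define e1 where "e1 = (1 / sqrt (- ip g u u)) *\<^sub>R u"
  have e1: "ip g e1 e1 = - 1" "ip g e1 a = 0" "ip g e1 b = 0"
    using uu ua ub by (simp_all add: e1_def field_simps)
  have "dim {g *v e1, g *v a, g *v b} < DIM(real^4)"
    by (rule le_less_trans[OF dim_le_card'[of "{g *v e1, g *v a, g *v b}"]])
      (auto simp: card_insert_if)
  then obtain w where w: "w \<noteq> 0" "\<And>y. y \<in> span {g *v e1, g *v a, g *v b} \<Longrightarrow> orthogonal w y"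
    using orthogonal_to_subspace_exists by blast
  then have wo: "ip g w e1 = 0" "ip g w a = 0" "ip g w b = 0"
    by (simp_all add: ip_def orthogonal_def span_base)
  have ww: "ip g w w > 0"
    by (rule orthogonal_to_timelike[OF s g, of e1]) (use e1 wo w(1) in \<open>simp_all add: sym[of e1 w]\<close>)
  define e2 where "e2 = (1 / sqrt (ip g w w)) *\<^sub>R w"
  have e2: "ip g e2 e2 = 1" "ip g e2 e1 = 0" "ip g e2 a = 0" "ip g e2 b = 0"
    using ww wo by (simp_all add: e2_def field_simps)
  define E :: "real \<Rightarrow> real^4^4" where "E = (\<lambda>\<tau>. vector [e1, \<tau> *\<^sub>R e2, a, b])"
  have E: "pseudo_orthonormal g (E \<tau>)" if "\<tau>\<^sup>2 = 1" for \<tau>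
    using e1 e2 a that by (auto simp: pseudo_orthonormal_def forall_4 E_def power2_eq_square
        sym[of e1 e2] sym[of a e1] sym[of b e1] sym[of a e2] sym[of b e2] sym[of b a])
  have "det (E (- 1)) = - det (E 1)"
    by (simp add: det_4 E_def algebra_simps)
  moreover have "det (E 1) \<noteq> 0"
    using pseudo_orthonormal_det[OF E[of 1]] by simp
  ultimately have "det (E 1) > 0 \<or> det (E (- 1)) > 0" by linarith
  then obtain \<tau> where "\<tau>\<^sup>2 = 1" "det (E \<tau>) > 0"
    by (metis power2_minus power_one)
  then have "SO_frame g (E \<tau>) \<and> E \<tau> $ 3 = a \<and> E \<tau> $ 4 = b"
    using E by (simp add: SO_frame_def) (simp add: E_def)
  then show ?thesis by blast
qed


text \<open>A null basis: two null vectors spanning a Lorentzian plane, and an orthonormal basis of the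
  complementary Euclidean plane. The expansion in this basis is made part of the notion, since
  changes of frame are read off from it.\<close>

definition null_frame :: "real^4^4 \<Rightarrow> real^4 \<Rightarrow> real^4 \<Rightarrow> real^4 \<Rightarrow> real^4 \<Rightarrow> bool" where
  "null_frame g n m a b \<longleftrightarrow>
     ip g n n = 0 \<and> ip g m m = 0 \<and> ip g n m = - 2 \<and> ip g m n = - 2 \<and>
     ip g n a = 0 \<and> ip g n b = 0 \<and> ip g m a = 0 \<and> ip g m b = 0 \<and>
     ip g a n = 0 \<and> ip g b n = 0 \<and> ip g a m = 0 \<and> ip g b m = 0 \<and>
     ip g a a = 1 \<and> ip g b b = 1 \<and> ip g a b = 0 \<and> ip g b a = 0 \<and>
     (\<forall>v. v = (- ip g v m / 2) *\<^sub>R n + (- ip g v n / 2) *\<^sub>R m + ip g v a *\<^sub>R a + ip g v b *\<^sub>R b)"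

lemma null_frame_expansion:
  "null_frame g n m a b \<Longrightarrow>
    v = (- ip g v m / 2) *\<^sub>R n + (- ip g v n / 2) *\<^sub>R m + ip g v a *\<^sub>R a + ip g v b *\<^sub>R b"
  unfolding null_frame_def by blast

lemma null_frame_ip:
  assumes "null_frame g n m a b"
  shows "ip g n n = 0" "ip g m m = 0" "ip g n m = - 2" "ip g m n = - 2"
     "ip g n a = 0" "ip g n b = 0" "ip g m a = 0" "ip g m b = 0"
     "ip g a n = 0" "ip g b n = 0" "ip g a m = 0" "ip g b m = 0"
     "ip g a a = 1" "ip g b b = 1" "ip g a b = 0" "ip g b a = 0"
  using assms unfolding null_frame_def by blast+

lemma null_frame_nonzero:
  assumes "null_frame g n m a b" shows "n \<noteq> 0" "m \<noteq> 0"
  using null_frame_ip(3)[OF assms] by auto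

lemma null_frame_of_frame:
  assumes "pseudo_orthonormal g s" "\<sigma>\<^sup>2 = 1"
  shows "null_frame g (s $ 1 + \<sigma> *\<^sub>R s $ 2) (s $ 1 - \<sigma> *\<^sub>R s $ 2) (s $ 3) (s $ 4)"
proof -
  have ips: "ip g (s $ i) (s $ j) = (if i = j then (if i = 1 then - 1 else 1) else 0)" for i j
    using assms(1) by (simp add: pseudo_orthonormal_def)
  have sq: "\<sigma> * \<sigma> = 1" using assms(2) by (simp add: power2_eq_square)
  have "v = (- ip g v (s $ 1 - \<sigma> *\<^sub>R s $ 2) / 2) *\<^sub>R (s $ 1 + \<sigma> *\<^sub>R s $ 2)
      + (- ip g v (s $ 1 + \<sigma> *\<^sub>R s $ 2) / 2) *\<^sub>R (s $ 1 - \<sigma> *\<^sub>R s $ 2)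
      + ip g v (s $ 3) *\<^sub>R s $ 3 + ip g v (s $ 4) *\<^sub>R s $ 4" (is "_ = ?r") for v
  proof -
    have "?r = - ip g v (s $ 1) *\<^sub>R s $ 1 + (\<sigma> * \<sigma> * ip g v (s $ 2)) *\<^sub>R s $ 2
        + ip g v (s $ 3) *\<^sub>R s $ 3 + ip g v (s $ 4) *\<^sub>R s $ 4"
      by (simp add: vec_eq_iff algebra_simps) (simp add: field_simps)
    also have "\<dots> = v"
      using pseudo_orthonormal_expansion[OF assms(1), of v] by (simp add: sq)
    finally show ?thesis by simp
  qed
  then show ?thesis
    unfolding null_frame_def by (auto simp: ips sq)
qed

lemma det_null_frame:
  "det (vector [s $ 1 + \<sigma> *\<^sub>R s $ 2, s $ 1 - \<sigma> *\<^sub>R s $ 2, s $ 3, s $ 4] :: real^4^4) =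
    - 2 * \<sigma> * det (s :: real^4^4)"
proof -
  have "det (vector [vector [1, \<sigma>, 0, 0], vector [1, - \<sigma>, 0, 0], vector [0, 0, 1, 0], vector [0, 0, 0, 1]]
      :: real^4^4) = - 2 * \<sigma>"
    by (simp add: det_4)
  then show ?thesis
    using det_linear_combinations[of 1 "s $ 1" \<sigma> "s $ 2" 0 "s $ 3" 0 "s $ 4" 1 "- \<sigma>" 0 0 0 0 1 0 0 0 0 1]
    by (simp add: vector_rows_4)
qed

text \<open>Two positively oriented frames give null bases, taken with the same sign \<open>\<sigma>\<close>, of the same
  orientation. When the matrix relating them has block form this links the orientations of the null
  plane and of the Euclidean plane.\<close>

lemma null_frame_change_det:
  assumes s: "SO_frame g s" "SO_frame g s'" and \<sigma>: "\<sigma>\<^sup>2 = 1"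
    and eq: "s' $ 1 + \<sigma> *\<^sub>R s' $ 2 = a1 *\<^sub>R n + b1 *\<^sub>R m + c1 *\<^sub>R s $ 3 + d1 *\<^sub>R s $ 4"
      "s' $ 1 - \<sigma> *\<^sub>R s' $ 2 = a2 *\<^sub>R n + b2 *\<^sub>R m + c2 *\<^sub>R s $ 3 + d2 *\<^sub>R s $ 4"
      "s' $ 3 = a3 *\<^sub>R n + b3 *\<^sub>R m + c3 *\<^sub>R s $ 3 + d3 *\<^sub>R s $ 4"
      "s' $ 4 = a4 *\<^sub>R n + b4 *\<^sub>R m + c4 *\<^sub>R s $ 3 + d4 *\<^sub>R s $ 4"
    and nm: "n = s $ 1 + \<sigma> *\<^sub>R s $ 2" "m = s $ 1 - \<sigma> *\<^sub>R s $ 2"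
  shows "det (vector [vector [a1, b1, c1, d1], vector [a2, b2, c2, d2], vector [a3, b3, c3, d3],
      vector [a4, b4, c4, d4]] :: real^4^4) > 0" (is "?D > 0")
proof -
  have "- 2 * \<sigma> * det s' = ?D * (- 2 * \<sigma> * det s)"
    unfolding det_null_frame[symmetric]
    unfolding eq det_linear_combinations unfolding nm ..
  then have "det s' = ?D * det s" using \<sigma> by auto
  then show ?thesis
    using s by (metis SO_frame_def zero_less_mult_pos2)
qed

text \<open>Orthogonal matrices of positive determinant are rotations: the determinant is then 1, and the
  squared distance of the second row from the rotated first row is \<open>2 - 2 det\<close>.\<close>

lemma rotation_of_orthonormal:
  fixes p q r t :: real
  assumes "p * p + q * q = 1" "r * r + t * t = 1" "p * r + q * t = 0" "p * t - q * r > 0"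
  shows "t = p" "r = - q"
proof -
  have "(p * t - q * r)\<^sup>2 = (p * p + q * q) * (r * r + t * t) - (p * r + q * t)\<^sup>2"
    by (simp add: power2_eq_square algebra_simps)
  then have "(p * t - q * r)\<^sup>2 = 1" using assms by simp
  then have *: "p * t - q * r = 1" using assms(4) by (auto simp: power2_eq_1_iff)
  have "(t - p)\<^sup>2 + (r + q)\<^sup>2 = (r * r + t * t) + (p * p + q * q) - 2 * (p * t - q * r)"
    by (simp add: power2_eq_square algebra_simps)
  then have "(t - p)\<^sup>2 + (r + q)\<^sup>2 = 0" using * assms by simp
  then show "t = p" "r = - q" by (simp_all add: sum_power2_eq_zero_iff)
qed

text \<open>The reason why \<open>J\<close> is well defined on the quotient of the orthogonal complement of a null line
  by the line. In null bases the change of frame is block triangular with diagonal entries \<open>l\<close> and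
  \<open>1 / l\<close> on the null vectors, so the determinant of the remaining block is positive.\<close>

lemma same_null_line_rotation:
  assumes s: "SO_frame g s" "SO_frame g s'" and \<sigma>: "\<sigma>\<^sup>2 = 1"
    and line: "s' $ 1 + \<sigma> *\<^sub>R s' $ 2 = l *\<^sub>R (s $ 1 + \<sigma> *\<^sub>R s $ 2)"
  shows "\<exists>p q x y. s' $ 3 = p *\<^sub>R s $ 3 + q *\<^sub>R s $ 4 + x *\<^sub>R (s $ 1 + \<sigma> *\<^sub>R s $ 2) \<and>
    s' $ 4 = - q *\<^sub>R s $ 3 + p *\<^sub>R s $ 4 + y *\<^sub>R (s $ 1 + \<sigma> *\<^sub>R s $ 2) \<and> p * p + q * q = 1"
proof -
  define n m a b where "n = s $ 1 + \<sigma> *\<^sub>R s $ 2" and "m = s $ 1 - \<sigma> *\<^sub>R s $ 2"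
    and "a = s $ 3" and "b = s $ 4"
  define n' m' a' b' where "n' = s' $ 1 + \<sigma> *\<^sub>R s' $ 2" and "m' = s' $ 1 - \<sigma> *\<^sub>R s' $ 2"
    and "a' = s' $ 3" and "b' = s' $ 4"
  have nf: "null_frame g n m a b" and nf': "null_frame g n' m' a' b'"
    unfolding n_def m_def a_def b_def n'_def m'_def a'_def b'_def
    using s \<sigma> by (auto intro: null_frame_of_frame simp: SO_frame_def)
  note ips = null_frame_ip[OF nf] and ips' = null_frame_ip[OF nf']
  have n': "n' = l *\<^sub>R n" using line by (simp add: n'_def n_def)
  have l0: "l \<noteq> 0" using null_frame_nonzero(1)[OF nf'] n' by auto
  have an: "ip g a' n = 0" and bn: "ip g b' n = 0"
    using ips'(9,10) l0 by (simp_all add: n')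
  define p q r t x y where "p = ip g a' a" and "q = ip g a' b" and "r = ip g b' a" and "t = ip g b' b"
    and "x = - ip g a' m / 2" and "y = - ip g b' m / 2"
  have a': "a' = x *\<^sub>R n + 0 *\<^sub>R m + p *\<^sub>R a + q *\<^sub>R b"
    using null_frame_expansion[OF nf, of a'] by (simp add: an p_def q_def x_def)
  have b': "b' = y *\<^sub>R n + 0 *\<^sub>R m + r *\<^sub>R a + t *\<^sub>R b"
    using null_frame_expansion[OF nf, of b'] by (simp add: bn r_def t_def y_def)
  have "p * p + q * q = ip g a' a'" "r * r + t * t = ip g b' b'" "p * r + q * t = ip g a' b'"
    by (simp_all add: a' b' ips algebra_simps)
  then have orth: "p * p + q * q = 1" "r * r + t * t = 1" "p * r + q * t = 0"
    using ips' by simp_all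
  have m': "m' = (- ip g m' m / 2) *\<^sub>R n + (1 / l) *\<^sub>R m + ip g m' a *\<^sub>R a + ip g m' b *\<^sub>R b"
  proof -
    have "l * ip g m' n = - 2" using ips'(4) by (simp add: n')
    then have "- ip g m' n / 2 = 1 / l" using l0 by (simp add: field_simps)
    then show ?thesis using null_frame_expansion[OF nf, of m'] by simp
  qed
  have n'': "n' = l *\<^sub>R n + 0 *\<^sub>R m + 0 *\<^sub>R a + 0 *\<^sub>R b" by (simp add: n')
  have "p * t - q * r > 0"
    using null_frame_change_det[OF s \<sigma> n''[unfolded n'_def a_def b_def]
        m'[unfolded m'_def a_def b_def] a'[unfolded a'_def a_def b_def]
        b'[unfolded b'_def a_def b_def] n_def m_def] l0
    by (simp add: det_4)
  from rotation_of_orthonormal[OF orth this]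
  have "b' = - q *\<^sub>R a + p *\<^sub>R b + y *\<^sub>R n" using b' by simp
  with a' orth(1) show ?thesis
    unfolding a'_def b'_def a_def b_def n_def[symmetric]
    by (intro exI[of _ p] exI[of _ q] exI[of _ x] exI[of _ y]) simp
qed

text \<open>The normal plane of an oriented spacelike plane is oriented, and this distinguishes its two null
  lines: exchanging them would be a change of null basis of determinant \<open>-1\<close> on the normal plane.\<close>

lemma same_plane_null_line:
  assumes s: "SO_frame g s" "SO_frame g s'" and \<sigma>: "\<sigma>\<^sup>2 = 1"
    and plane: "s' $ 3 = p *\<^sub>R s $ 3 + q *\<^sub>R s $ 4" "s' $ 4 = r *\<^sub>R s $ 3 + t *\<^sub>R s $ 4" "p * t - q * r > 0"
  shows "\<exists>l. l \<noteq> 0 \<and> s' $ 1 + \<sigma> *\<^sub>R s' $ 2 = l *\<^sub>R (s $ 1 + \<sigma> *\<^sub>R s $ 2)"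
    and "t = p" "r = - q" "p * p + q * q = 1"
proof -
  define n m a b where "n = s $ 1 + \<sigma> *\<^sub>R s $ 2" and "m = s $ 1 - \<sigma> *\<^sub>R s $ 2"
    and "a = s $ 3" and "b = s $ 4"
  define n' m' a' b' where "n' = s' $ 1 + \<sigma> *\<^sub>R s' $ 2" and "m' = s' $ 1 - \<sigma> *\<^sub>R s' $ 2"
    and "a' = s' $ 3" and "b' = s' $ 4"
  have nf: "null_frame g n m a b" and nf': "null_frame g n' m' a' b'"
    unfolding n_def m_def a_def b_def n'_def m'_def a'_def b'_def
    using s \<sigma> by (auto intro: null_frame_of_frame simp: SO_frame_def)
  note ips = null_frame_ip[OF nf] and ips' = null_frame_ip[OF nf']
  have a': "a' = 0 *\<^sub>R n + 0 *\<^sub>R m + p *\<^sub>R a + q *\<^sub>R b"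
    and b': "b' = 0 *\<^sub>R n + 0 *\<^sub>R m + r *\<^sub>R a + t *\<^sub>R b"
    using plane by (simp_all add: a'_def b'_def a_def b_def)
  have "p * p + q * q = ip g a' a'" "r * r + t * t = ip g b' b'" "p * r + q * t = ip g a' b'"
    by (simp_all add: a' b' ips algebra_simps)
  then have orth: "p * p + q * q = 1" "r * r + t * t = 1" "p * r + q * t = 0"
    using ips' by simp_all
  from rotation_of_orthonormal[OF orth plane(3)] orth(1)
  show tp: "t = p" and rq: "r = - q" and pq: "p * p + q * q = 1" by auto
  have na: "ip g v a = 0" and nb: "ip g v b = 0" if "ip g v a' = 0" "ip g v b' = 0" for v
  proof -
    have 1: "p * ip g v a + q * ip g v b = 0" "p * ip g v b - q * ip g v a = 0"
      using that by (simp_all add: a' b' tp rq)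
    have "ip g v a = p * (p * ip g v a + q * ip g v b) - q * (p * ip g v b - q * ip g v a)
        + (1 - (p * p + q * q)) * ip g v a" by (simp add: algebra_simps)
    then show "ip g v a = 0" by (simp only: 1 pq) simp
    have "ip g v b = q * (p * ip g v a + q * ip g v b) + p * (p * ip g v b - q * ip g v a)
        + (1 - (p * p + q * q)) * ip g v b" by (simp add: algebra_simps)
    then show "ip g v b = 0" by (simp only: 1 pq) simp
  qed
  define x z u w where "x = - ip g n' m / 2" and "z = - ip g n' n / 2"
    and "u = - ip g m' m / 2" and "w = - ip g m' n / 2"
  have n': "n' = x *\<^sub>R n + z *\<^sub>R m + 0 *\<^sub>R a + 0 *\<^sub>R b"
    using null_frame_expansion[OF nf, of n'] na[OF ips'(5,6)] nb[OF ips'(5,6)] by (simp add: x_def z_def)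
  have m': "m' = u *\<^sub>R n + w *\<^sub>R m + 0 *\<^sub>R a + 0 *\<^sub>R b"
    using null_frame_expansion[OF nf, of m'] na[OF ips'(7,8)] nb[OF ips'(7,8)] by (simp add: u_def w_def)
  have det: "(x * w - z * u) * (p * t - q * r) > 0"
    using null_frame_change_det[OF s \<sigma> n'[unfolded n'_def a_def b_def]
        m'[unfolded m'_def a_def b_def] a'[unfolded a'_def a_def b_def]
        b'[unfolded b'_def a_def b_def] n_def m_def]
    by (simp add: det_4 algebra_simps)
  then have det: "x * w - z * u > 0" using plane(3) by (simp add: zero_less_mult_iff)
  have "- 4 * (x * z) = ip g n' n'" "- 2 * (x * w + z * u) = ip g n' m'"
    by (simp_all add: n' m' ips algebra_simps)
  then have xz: "x * z = 0" and xw: "x * w + z * u = 1" using ips' by simp_all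
  have "x \<noteq> 0" using xw det by auto
  then have "n' = x *\<^sub>R n" using xz n' by simp
  with \<open>x \<noteq> 0\<close> show "\<exists>l. l \<noteq> 0 \<and> s' $ 1 + \<sigma> *\<^sub>R s' $ 2 = l *\<^sub>R (s $ 1 + \<sigma> *\<^sub>R s $ 2)"
    unfolding n'_def n_def by blast
qed

section \<open>The Levi-Civita connection\<close>

lemma matrix_inv_unique:
  fixes A B :: "real^'n^'n"
  assumes "A ** B = mat 1"
  shows "matrix_inv A = B"
proof -
  have BA: "B ** A = mat 1" using assms by (simp add: matrix_left_right_inverse)
  have "A ** matrix_inv A = mat 1"
    unfolding matrix_inv_def using someI[of "\<lambda>C. A ** C = mat 1 \<and> C ** A = mat 1" B] assms BA by auto
  then show ?thesis
    by (metis BA matrix_mul_assoc matrix_mul_lid matrix_mul_rid)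
qed

lemma matrix_inv_right:
  fixes A :: "real^'n^'n"
  shows "invertible A \<Longrightarrow> A ** matrix_inv A = mat 1"
  unfolding invertible_def using matrix_inv_unique by blast

lemma bounded_bilinear_matrix_vector:
  "bounded_bilinear (\<lambda>(A::real^'n^'m) x. A *v x)"
  unfolding bilinear_conv_bounded_bilinear[symmetric] bilinear_def
  by (auto intro!: linearI simp: matrix_vector_right_distrib matrix_vector_mult_scaleR
      matrix_vector_mult_add_rdistrib scaleR_matrix_vector_assoc)

lemma ip_sums: "ip g u v = (\<Sum>i\<in>UNIV. \<Sum>j\<in>UNIV. g $ i $ j * u $ i * v $ j)"
  by (simp add: ip_def inner_vec_def matrix_vector_mult_def sum_distrib_left mult_ac)

lemma ip_eqI:
  fixes g :: "real^'n^'n"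
  assumes "invertible g" "\<And>w. ip g u w = ip g v w"
  shows "u = v"
proof -
  have "(u - v) \<bullet> z = 0" for z
    using assms(2)[of "matrix_inv g *v z"]
    by (simp add: ip_def matrix_vector_mul_assoc matrix_inv_right[OF assms(1)] inner_diff_left)
  then show ?thesis by (metis inner_eq_zero_iff right_minus_eq)
qed

text \<open>The Koszul formula for vector fields with constant components.\<close>

lemma ip_christoffel:
  fixes G :: "real^'n \<Rightarrow> real^'n^'n"
  assumes sym: "transpose (G x) = G x" and inv: "invertible (G x)" and lin: "linear (differential G x)"
  shows "ip (G x) (christoffel G x u v) w =
    (ip (differential G x u) v w + ip (differential G x v) u w - ip (differential G x w) u v) / 2"
proof -
  define D where "D = (\<lambda>i j l. differential G x (axis i 1) $ j $ l)"
  define c where "c = (\<chi> l. \<Sum>i\<in>UNIV. \<Sum>j\<in>UNIV. 1/2 * (D i j l + D j i l - D l i j) * u $ i * v $ j)"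
  have D: "differential G x z $ j $ l = (\<Sum>i\<in>UNIV. z $ i * D i j l)" for z j l
  proof -
    have "differential G x z = (\<Sum>i\<in>UNIV. z $ i *\<^sub>R differential G x (axis i 1))"
      by (subst (1) basis_expansion[of z, symmetric])
        (simp add: linear_sum[OF lin] linear_cmul[OF lin] scalar_mult_eq_scaleR)
    then show ?thesis by (simp add: D_def)
  qed
  have "christoffel G x u v = matrix_inv (G x) *v c"
  proof -
    have "christoffel G x u v $ k = (matrix_inv (G x) *v c) $ k" for k
    proof -
      have "christoffel G x u v $ k = (\<Sum>i\<in>UNIV. \<Sum>j\<in>UNIV. \<Sum>l\<in>UNIV.
          matrix_inv (G x) $ k $ l * (1/2 * (D i j l + D j i l - D l i j) * u $ i * v $ j))"
        by (simp add: christoffel_def D_def mult_ac)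
      also have "\<dots> = (\<Sum>i\<in>UNIV. \<Sum>l\<in>UNIV. \<Sum>j\<in>UNIV.
          matrix_inv (G x) $ k $ l * (1/2 * (D i j l + D j i l - D l i j) * u $ i * v $ j))"
        by (intro sum.cong refl sum.swap)
      also have "\<dots> = (\<Sum>l\<in>UNIV. \<Sum>i\<in>UNIV. \<Sum>j\<in>UNIV.
          matrix_inv (G x) $ k $ l * (1/2 * (D i j l + D j i l - D l i j) * u $ i * v $ j))"
        by (rule sum.swap)
      finally show ?thesis
        by (simp add: matrix_vector_mult_def c_def sum_distrib_left)
    qed
    then show ?thesis by (simp add: vec_eq_iff)
  qed
  then have "ip (G x) (christoffel G x u v) w = ip (G x) w (matrix_inv (G x) *v c)"
    using ip_sym[OF sym] by metis
  also have "\<dots> = w \<bullet> c"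
    by (simp add: ip_def matrix_vector_mul_assoc matrix_inv_right[OF inv])
  also have "\<dots> = (\<Sum>l\<in>UNIV. \<Sum>i\<in>UNIV. \<Sum>j\<in>UNIV.
      (D i j l * u $ i * v $ j * w $ l + D j i l * u $ i * v $ j * w $ l - D l i j * u $ i * v $ j * w $ l) / 2)"
    by (simp add: inner_vec_def c_def sum_distrib_left algebra_simps add_divide_distrib diff_divide_distrib)
  also have "\<dots> = ((\<Sum>l\<in>UNIV. \<Sum>i\<in>UNIV. \<Sum>j\<in>UNIV. D i j l * u $ i * v $ j * w $ l)
      + (\<Sum>l\<in>UNIV. \<Sum>i\<in>UNIV. \<Sum>j\<in>UNIV. D j i l * u $ i * v $ j * w $ l)
      - (\<Sum>l\<in>UNIV. \<Sum>i\<in>UNIV. \<Sum>j\<in>UNIV. D l i j * u $ i * v $ j * w $ l)) / 2"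
    by (simp add: sum.distrib sum_subtractf sum_divide_distrib[symmetric])
  also have "(\<Sum>l\<in>UNIV. \<Sum>i\<in>UNIV. \<Sum>j\<in>UNIV. D i j l * u $ i * v $ j * w $ l)
      = ip (differential G x u) v w"
  proof -
    have "(\<Sum>l\<in>UNIV. \<Sum>i\<in>UNIV. \<Sum>j\<in>UNIV. D i j l * u $ i * v $ j * w $ l) =
        (\<Sum>l\<in>UNIV. \<Sum>j\<in>UNIV. \<Sum>i\<in>UNIV. D i j l * u $ i * v $ j * w $ l)"
      by (intro sum.cong refl sum.swap)
    also have "\<dots> = (\<Sum>j\<in>UNIV. \<Sum>l\<in>UNIV. \<Sum>i\<in>UNIV. D i j l * u $ i * v $ j * w $ l)"
      by (rule sum.swap)
    finally show ?thesis by (simp add: ip_sums D sum_distrib_left sum_distrib_right mult_ac)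
  qed
  also have "(\<Sum>l\<in>UNIV. \<Sum>i\<in>UNIV. \<Sum>j\<in>UNIV. D j i l * u $ i * v $ j * w $ l)
      = ip (differential G x v) u w"
  proof -
    have "(\<Sum>l\<in>UNIV. \<Sum>i\<in>UNIV. \<Sum>j\<in>UNIV. D j i l * u $ i * v $ j * w $ l) =
        (\<Sum>i\<in>UNIV. \<Sum>l\<in>UNIV. \<Sum>j\<in>UNIV. D j i l * u $ i * v $ j * w $ l)"
      by (rule sum.swap)
    then show ?thesis by (simp add: ip_sums D sum_distrib_left sum_distrib_right mult_ac)
  qed
  also have "(\<Sum>l\<in>UNIV. \<Sum>i\<in>UNIV. \<Sum>j\<in>UNIV. D l i j * u $ i * v $ j * w $ l)
      = ip (differential G x w) u v"
  proof -
    have "(\<Sum>l\<in>UNIV. \<Sum>i\<in>UNIV. \<Sum>j\<in>UNIV. D l i j * u $ i * v $ j * w $ l) =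
        (\<Sum>i\<in>UNIV. \<Sum>l\<in>UNIV. \<Sum>j\<in>UNIV. D l i j * u $ i * v $ j * w $ l)"
      by (rule sum.swap)
    also have "\<dots> = (\<Sum>i\<in>UNIV. \<Sum>j\<in>UNIV. \<Sum>l\<in>UNIV. D l i j * u $ i * v $ j * w $ l)"
      by (intro sum.cong refl sum.swap)
    finally show ?thesis by (simp add: ip_sums D sum_distrib_left sum_distrib_right mult_ac)
  qed
  finally show ?thesis .
qed

lemma linear_christoffel_right: "linear (christoffel G x u)"
  by (rule linearI) (simp_all add: christoffel_def vec_eq_iff sum.distrib[symmetric] sum_distrib_left algebra_simps add_divide_distrib)

lemma linear_christoffel_left: "linear (\<lambda>u. christoffel G x u v)"
  by (rule linearI) (simp_all add: christoffel_def vec_eq_iff sum.distrib[symmetric] sum_distrib_left algebra_simps add_divide_distrib)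

lemma cov_deriv_linear:
  assumes "linear (differential W y)" "linear (differential F y)"
  shows "linear (cov_deriv G F W y)"
  unfolding cov_deriv_def
  using linear_compose_add[OF assms(1) linear_compose[OF assms(2) linear_christoffel_left[of G "F y" "W y"]]]
  by (simp add: o_def)

text \<open>The coordinate expression of a semi-Riemannian metric of arbitrary signature.\<close>

locale metric_patch =
  fixes V :: "(real^'n) set" and G :: "real^'n \<Rightarrow> real^'n^'n"
  assumes open_V: "open V" and smooth_G: "smooth_on V G"
    and sym_G: "\<And>x. x \<in> V \<Longrightarrow> transpose (G x) = G x"
    and inv_G: "\<And>x. x \<in> V \<Longrightarrow> invertible (G x)"
begin

text \<open>Transposition is linear, so it commutes with differentiation.\<close>

lemma derivative_G_sym:
  assumes "x \<in> V"
  shows "transpose (differential G x u) = differential G x u"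
proof -
  have L: "bounded_linear (transpose :: real^'n^'n \<Rightarrow> _)"
    by (intro linear_conv_bounded_linear[THEN iffD1] linearI) (simp_all add: transpose_def vec_eq_iff)
  have "(G has_derivative (\<lambda>u. transpose (differential G x u))) (at x)"
    by (rule has_derivative_transform_within_open[OF
          bounded_linear.has_derivative[OF L smooth_on_has_derivative[OF smooth_G assms]] open_V assms])
      (simp add: sym_G)
  then have "(\<lambda>u. transpose (differential G x u)) = differential G x"
    by (rule frechet_derivative_at)
  then show ?thesis by metis
qed

lemmas koszul = ip_christoffel[OF sym_G inv_G smooth_on_linear_derivative[OF smooth_G]]

lemma christoffel_sym: "x \<in> V \<Longrightarrow> christoffel G x u v = christoffel G x v u"
proof (rule ip_eqI[OF inv_G, of x])
  fix w assume "x \<in> V"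
  then show "ip (G x) (christoffel G x u v) w = ip (G x) (christoffel G x v u) w"
    using koszul[of x u v w] koszul[of x v u w] ip_sym[OF derivative_G_sym, of x w u v] by simp
qed

text \<open>In the sum of the two Koszul formulas all derivatives cancel except the two copies of the one in
  direction \<open>u\<close>.\<close>

lemma christoffel_metric:
  assumes "x \<in> V"
  shows "ip (G x) (christoffel G x u v) w + ip (G x) v (christoffel G x u w) = ip (differential G x u) v w"
proof -
  have "ip (G x) v (christoffel G x u w) =
      (ip (differential G x u) w v + ip (differential G x w) u v - ip (differential G x v) u w) / 2"
    using koszul[of x u w v] ip_sym[OF sym_G, of x v] assms by simp
  then show ?thesis
    using koszul[of x u v w] ip_sym[OF derivative_G_sym, of x u w v] assms by simp
qed

text \<open>Metric compatibility for vector fields along a map: the derivative of the metric along the map is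
  absorbed by the two Christoffel terms.\<close>

lemma has_derivative_ip:
  fixes F W Z :: "real^'k \<Rightarrow> real^'n"
  assumes "F y \<in> V" "F differentiable at y" "W differentiable at y" "Z differentiable at y"
  shows "((\<lambda>y. ip (G (F y)) (W y) (Z y)) has_derivative
    (\<lambda>X. ip (G (F y)) (cov_deriv G F W y X) (Z y) + ip (G (F y)) (W y) (cov_deriv G F Z y X))) (at y)"
proof -
  have D: "(F has_derivative differential F y) (at y)" "(W has_derivative differential W y) (at y)"
    "(Z has_derivative differential Z y) (at y)"
    using assms by (simp_all flip: frechet_derivative_works)
  have DG: "((\<lambda>y. G (F y)) has_derivative (\<lambda>X. differential G (F y) (differential F y X))) (at y)"
    by (rule has_derivative_compose[OF D(1) smooth_on_has_derivative[OF smooth_G assms(1)]])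
  have "((\<lambda>y. W y \<bullet> (G (F y) *v Z y)) has_derivative
      (\<lambda>X. W y \<bullet> (G (F y) *v differential Z y X + differential G (F y) (differential F y X) *v Z y)
        + differential W y X \<bullet> (G (F y) *v Z y))) (at y)"
    by (rule bounded_bilinear.FDERIV[OF bounded_bilinear_inner D(2)
          bounded_bilinear.FDERIV[OF bounded_bilinear_matrix_vector DG D(3)]])
  then show ?thesis
    unfolding ip_def[symmetric]
    by (rule has_derivative_eq_rhs)
      (simp add: fun_eq_iff cov_deriv_def inner_right_distrib christoffel_metric[OF assms(1), symmetric] flip: ip_def)
qed

end

section \<open>Curves of lines and planes\<close>

definition outer :: "real^4 \<Rightarrow> real^4 \<Rightarrow> real^4^4" where
  "outer u v = (\<chi> i j. u $ i * v $ j)"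

lemma bounded_bilinear_outer: "bounded_bilinear outer"
  unfolding bilinear_conv_bounded_bilinear[symmetric] bilinear_def
  by (auto intro!: linearI simp: outer_def vec_eq_iff algebra_simps)

lemmas outer_simps = bounded_bilinear.add_left[OF bounded_bilinear_outer]
  bounded_bilinear.add_right[OF bounded_bilinear_outer]
  bounded_bilinear.scaleR_left[OF bounded_bilinear_outer]
  bounded_bilinear.scaleR_right[OF bounded_bilinear_outer]
  bounded_bilinear.minus_left[OF bounded_bilinear_outer]
  bounded_bilinear.minus_right[OF bounded_bilinear_outer]
  bounded_bilinear.zero_left[OF bounded_bilinear_outer]
  bounded_bilinear.zero_right[OF bounded_bilinear_outer]

lemma outer_mult_vec: "outer u v *v z = (v \<bullet> z) *\<^sub>R u"
  by (simp add: vec_eq_iff outer_def matrix_vector_mult_def inner_vec_def sum_distrib_left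
      sum_distrib_right mult_ac)

lemma scaleR_mult_vec: "(c *\<^sub>R A) *v z = c *\<^sub>R (A *v z :: real^'n)"
  by (simp add: scaleR_matrix_vector_assoc)

subsection \<open>Lines\<close>

lemma line_pt_outer: "line_pt n = inverse (n \<bullet> n) *\<^sub>R outer n n"
  by (simp add: line_pt_def outer_def vec_eq_iff divide_inverse mult_ac)

text \<open>The derivative of the normalized matrix of a line, by the quotient rule.\<close>

definition line_deriv :: "real^4 \<Rightarrow> real^4 \<Rightarrow> real^4^4" where
  "line_deriv n m = inverse (n \<bullet> n) *\<^sub>R (outer m n + outer n m)
     - (2 * (n \<bullet> m) * (inverse (n \<bullet> n))\<^sup>2) *\<^sub>R outer n n"

lemma line_pt_has_derivative:
  assumes "n \<noteq> 0"
  shows "(line_pt has_derivative line_deriv n) (at n)"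
proof -
  have "((\<lambda>n. inverse (n \<bullet> n) *\<^sub>R outer n n) has_derivative
      (\<lambda>m. inverse (n \<bullet> n) *\<^sub>R (outer n m + outer m n) +
        (- (inverse (n \<bullet> n) * (n \<bullet> m + m \<bullet> n) * inverse (n \<bullet> n))) *\<^sub>R outer n n)) (at n)"
    by (rule has_derivative_scaleR[OF Deriv.has_derivative_inverse[OF _ has_derivative_inner]
          bounded_bilinear.FDERIV[OF bounded_bilinear_outer]])
      (use assms in \<open>auto intro: has_derivative_ident\<close>)
  then show ?thesis
    unfolding line_pt_outer[abs_def]
    by (rule has_derivative_eq_rhs)
      (simp add: fun_eq_iff line_deriv_def inner_commute power2_eq_square algebra_simps)
qed

lemma linear_line_deriv: "linear (line_deriv n)"
  by (rule linearI)
    (simp_all add: line_deriv_def outer_simps inner_right_distrib algebra_simps)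

text \<open>A motion of the generator moves the line to first order unless it is a multiple of the generator.
  Applying the derivative to the generator \<open>n\<close> recovers the component of \<open>m\<close> that is Euclidean-orthogonal
  to \<open>n\<close>.\<close>

lemma line_deriv_eq_0_iff:
  assumes "n \<noteq> 0"
  shows "line_deriv n m = 0 \<longleftrightarrow> (\<exists>c. m = c *\<^sub>R n)"
proof
  assume 0: "line_deriv n m = 0"
  have "line_deriv n m *v n = m - ((n \<bullet> m) * inverse (n \<bullet> n)) *\<^sub>R n"
    using assms
    by (simp add: line_deriv_def matrix_vector_mult_diff_rdistrib matrix_vector_mult_add_rdistrib
        scaleR_mult_vec outer_mult_vec inner_commute[of m n] power2_eq_square vec_eq_iff field_simps)
  with 0 show "\<exists>c. m = c *\<^sub>R n" by (auto simp: matrix_vector_mult_0)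
next
  assume "\<exists>c. m = c *\<^sub>R n"
  then obtain c where "m = c *\<^sub>R n" ..
  then show "line_deriv n m = 0"
    using assms by (simp add: line_deriv_def outer_simps power2_eq_square algebra_simps flip: scaleR_add_left)
qed

lemma line_pt_scale: "c \<noteq> 0 \<Longrightarrow> line_pt (c *\<^sub>R n) = line_pt n"
  by (simp add: line_pt_outer outer_simps field_simps)

lemma line_deriv_scale:
  assumes "c \<noteq> 0"
  shows "line_deriv (c *\<^sub>R n) m = line_deriv n (inverse c *\<^sub>R m)"
proof -
  have cancel: "c * (inverse c * x) = x" for x using assms by simp
  show ?thesis
    by (simp add: line_deriv_def outer_simps power2_eq_square algebra_simps) (simp add: cancel)
qed

text \<open>The matrix of a line is the projection onto it, and so fixes every generator.\<close>

lemma line_pt_eq: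
  assumes "n \<noteq> 0" "n' \<noteq> 0" "line_pt n' = line_pt n"
  shows "\<exists>c. c \<noteq> 0 \<and> n' = c *\<^sub>R n"
proof -
  have "line_pt n' *v n' = n'"
    using assms(2) by (simp add: line_pt_outer scaleR_mult_vec outer_mult_vec)
  then have "n' = (inverse (n \<bullet> n) * (n \<bullet> n')) *\<^sub>R n"
    by (simp add: assms(3)) (simp add: line_pt_outer scaleR_mult_vec outer_mult_vec)
  then show ?thesis using assms(2) by (metis scaleR_zero_left)
qed

lemma line_hlift_eq:
  assumes "n \<noteq> 0"
  shows "line_hlift G x n v = (v, line_deriv n (- christoffel G x v n))"
proof -
  have "((\<lambda>t. line_pt (n - t *\<^sub>R christoffel G x v n)) has_derivative
      (\<lambda>t. line_deriv n (- (t *\<^sub>R christoffel G x v n)))) (at 0)"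
    by (rule has_derivative_compose[of "\<lambda>t. n - t *\<^sub>R christoffel G x v n", OF _ ])
      (use line_pt_has_derivative[OF assms] in \<open>auto intro!: derivative_eq_intros\<close>)
  then have "((\<lambda>t. line_pt (n - t *\<^sub>R christoffel G x v n)) has_vector_derivative
      line_deriv n (- christoffel G x v n)) (at 0)"
    unfolding has_vector_derivative_def
    by (rule has_derivative_eq_rhs) (simp add: fun_eq_iff linear_neg[OF linear_line_deriv] linear_cmul[OF linear_line_deriv])
  then show ?thesis by (simp add: line_hlift_def vector_derivative_at)
qed

lemma line_curve_derivative:
  assumes "n \<noteq> 0" "(f has_vector_derivative v) (at t)" "f t = n"
  shows "((\<lambda>t. line_pt (f t)) has_vector_derivative line_deriv n v) (at t)"
proof -
  have "((\<lambda>t. line_pt (f t)) has_derivative (\<lambda>s. line_deriv n (s *\<^sub>R v))) (at t)"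
    by (rule has_derivative_compose[OF assms(2)[unfolded has_vector_derivative_def]])
      (simp add: assms line_pt_has_derivative)
  then show ?thesis
    by (simp add: has_vector_derivative_def linear_cmul[OF linear_line_deriv])
qed

lemma line_vert_eq: "n \<noteq> 0 \<Longrightarrow> line_vert n v = (0, line_deriv n v)"
  unfolding line_vert_def
  by (subst vector_derivative_at[OF line_curve_derivative[where n = n and v = v]])
    (auto intro!: derivative_eq_intros)

lemma line_hlift_scale:
  "n \<noteq> 0 \<Longrightarrow> c \<noteq> 0 \<Longrightarrow> line_hlift G x (c *\<^sub>R n) v = line_hlift G x n v"
  by (simp add: line_hlift_eq line_deriv_scale linear_cmul[OF linear_christoffel_right])

lemma smooth_on_line_pt:
  fixes N :: "'a::euclidean_space \<Rightarrow> real^4"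
  assumes "open S" "smooth_on S N" "\<And>y. y \<in> S \<Longrightarrow> N y \<noteq> 0"
  shows "smooth_on S (\<lambda>y. line_pt (N y))"
proof -
  have "smooth_on S (\<lambda>y. ((N y \<bullet> N y) powr (- 1)) *\<^sub>R outer (N y) (N y))"
    by (intro smooth_on_scaleR smooth_on_powr smooth_on_inner
        smooth_on_bilinear[OF bounded_bilinear_outer] assms(1,2)) (use assms(3) in simp)
  then show ?thesis
    by (rule smooth_on_cong[OF assms(1), rotated]) (use assms(3) in \<open>simp add: line_pt_outer powr_minus\<close>)
qed

subsection \<open>Planes\<close>

definition wedge :: "real^4 \<Rightarrow> real^4 \<Rightarrow> real^4^4" where
  "wedge u v = outer u v - outer v u"

lemma bounded_bilinear_wedge: "bounded_bilinear wedge"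
  unfolding bilinear_conv_bounded_bilinear[symmetric] bilinear_def
  by (auto intro!: linearI simp: wedge_def outer_simps algebra_simps)

lemmas wedge_simps = bounded_bilinear.add_left[OF bounded_bilinear_wedge]
  bounded_bilinear.add_right[OF bounded_bilinear_wedge]
  bounded_bilinear.scaleR_left[OF bounded_bilinear_wedge]
  bounded_bilinear.scaleR_right[OF bounded_bilinear_wedge]
  bounded_bilinear.minus_left[OF bounded_bilinear_wedge]
  bounded_bilinear.minus_right[OF bounded_bilinear_wedge]
  bounded_bilinear.diff_left[OF bounded_bilinear_wedge]
  bounded_bilinear.diff_right[OF bounded_bilinear_wedge]
  bounded_bilinear.zero_left[OF bounded_bilinear_wedge]
  bounded_bilinear.zero_right[OF bounded_bilinear_wedge]

lemma wedge_self [simp]: "wedge u u = 0" and wedge_anti: "wedge v u = - wedge u v"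
  by (simp_all add: wedge_def)

lemma wedge_linear_combination:
  "wedge (p *\<^sub>R u + q *\<^sub>R v) (r *\<^sub>R u + t *\<^sub>R v) = (p * t - q * r) *\<^sub>R wedge u v"
  by (simp add: wedge_simps wedge_anti[of v u] algebra_simps)

text \<open>Contracting a bivector with the covector dual to a vector recovers the vectors that span it; this
  is how planes and their motions are reconstructed from Pluecker coordinates.\<close>

lemma wedge_contract: "wedge a b *v (g *v w) = ip g b w *\<^sub>R a - ip g a w *\<^sub>R b"
  by (simp add: wedge_def matrix_vector_mult_diff_rdistrib outer_mult_vec ip_def)

lemma plane_pt_wedge: "plane_pt u v = wedge u v /\<^sub>R norm (wedge u v)"
proof -
  have "wedge u v = (\<chi> i j. u $ i * v $ j - v $ i * u $ j)"
    by (simp add: wedge_def outer_def vec_eq_iff)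
  then show ?thesis by (simp add: plane_pt_def Let_def)
qed

text \<open>The derivative of the normalization \<open>\<omega> / |\<omega>|\<close> at \<open>\<omega> = u \<and> v\<close>, applied to the velocity
  \<open>\<delta> = u' \<and> v + u \<and> v'\<close>.\<close>

definition plane_deriv :: "real^4 \<Rightarrow> real^4 \<Rightarrow> real^4 \<Rightarrow> real^4 \<Rightarrow> real^4^4" where
  "plane_deriv u v u' v' = (let \<omega> = wedge u v; \<delta> = wedge u' v + wedge u v' in
     inverse (norm \<omega>) *\<^sub>R \<delta> - ((\<delta> \<bullet> sgn \<omega>) * (inverse (norm \<omega>))\<^sup>2) *\<^sub>R \<omega>)"

lemma plane_deriv_add: "plane_deriv u v (a + a') (b + b') = plane_deriv u v a b + plane_deriv u v a' b'"
  and plane_deriv_diff: "plane_deriv u v (a - a') (b - b') = plane_deriv u v a b - plane_deriv u v a' b'"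
  and plane_deriv_scale: "plane_deriv u v (c *\<^sub>R a) (c *\<^sub>R b) = c *\<^sub>R plane_deriv u v a b"
  by (simp_all add: plane_deriv_def Let_def wedge_simps inner_left_distrib inner_diff_left algebra_simps)

lemma plane_pt_has_derivative:
  assumes "(f has_derivative f') (at x)" "(h has_derivative h') (at x)" "wedge (f x) (h x) \<noteq> 0"
  shows "((\<lambda>x. plane_pt (f x) (h x)) has_derivative
    (\<lambda>d. plane_deriv (f x) (h x) (f' d) (h' d))) (at x)"
proof -
  define \<omega> where "\<omega> = wedge (f x) (h x)"
  have w: "((\<lambda>x. wedge (f x) (h x)) has_derivative (\<lambda>d. wedge (f x) (h' d) + wedge (f' d) (h x))) (at x)"
    by (rule bounded_bilinear.FDERIV[OF bounded_bilinear_wedge assms(1,2)])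
  have "(norm has_derivative (\<lambda>d. d \<bullet> sgn \<omega>)) (at \<omega>)"
    using has_derivative_norm assms(3) by (auto simp: \<omega>_def inner_commute)
  then have "((\<lambda>\<omega>. inverse (norm \<omega>) *\<^sub>R \<omega>) has_derivative
      (\<lambda>\<delta>. inverse (norm \<omega>) *\<^sub>R \<delta> + (- (inverse (norm \<omega>) * (\<delta> \<bullet> sgn \<omega>) * inverse (norm \<omega>))) *\<^sub>R \<omega>)) (at \<omega>)"
    by (intro has_derivative_scaleR Deriv.has_derivative_inverse has_derivative_ident)
      (use assms(3) in \<open>simp add: \<omega>_def\<close>)
  from has_derivative_compose[OF w, of "\<lambda>\<omega>. inverse (norm \<omega>) *\<^sub>R \<omega>", OF this[unfolded \<omega>_def]]
  show ?thesis
    unfolding plane_pt_wedge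
    by (rule has_derivative_eq_rhs)
      (simp add: fun_eq_iff plane_deriv_def Let_def power2_eq_square algebra_simps)
qed

text \<open>Normalization forgets exactly the radial part of a velocity.\<close>

lemma plane_deriv_eq_0_iff:
  assumes "wedge u v \<noteq> 0"
  shows "plane_deriv u v u' v' = 0 \<longleftrightarrow> (\<exists>c. wedge u' v + wedge u v' = c *\<^sub>R wedge u v)"
proof
  assume "plane_deriv u v u' v' = 0"
  then have "inverse (norm (wedge u v)) *\<^sub>R (wedge u' v + wedge u v') =
      ((wedge u' v + wedge u v') \<bullet> sgn (wedge u v) * (inverse (norm (wedge u v)))\<^sup>2) *\<^sub>R wedge u v"
    by (simp add: plane_deriv_def Let_def)
  then have "norm (wedge u v) *\<^sub>R inverse (norm (wedge u v)) *\<^sub>R (wedge u' v + wedge u v') =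
      norm (wedge u v) *\<^sub>R ((wedge u' v + wedge u v') \<bullet> sgn (wedge u v) * (inverse (norm (wedge u v)))\<^sup>2) *\<^sub>R wedge u v"
    by simp
  then show "\<exists>c. wedge u' v + wedge u v' = c *\<^sub>R wedge u v"
    using assms by (auto simp del: scaleR_add_right)
next
  assume "\<exists>c. wedge u' v + wedge u v' = c *\<^sub>R wedge u v"
  then obtain c where "wedge u' v + wedge u v' = c *\<^sub>R wedge u v" ..
  then show "plane_deriv u v u' v' = 0"
    using assms
    by (simp add: plane_deriv_def Let_def sgn_div_norm power2_eq_square dot_square_norm field_simps)
qed

lemma plane_pt_rotate:
  "p * p + q * q = 1 \<Longrightarrow> plane_pt (p *\<^sub>R u + q *\<^sub>R v) (- q *\<^sub>R u + p *\<^sub>R v) = plane_pt u v"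
  unfolding plane_pt_wedge wedge_linear_combination by simp

lemma plane_hlift_eq:
  assumes "wedge (s $ 3) (s $ 4) \<noteq> 0"
  shows "plane_hlift G x s v =
    (v, plane_deriv (s $ 3) (s $ 4) (- christoffel G x v (s $ 3)) (- christoffel G x v (s $ 4)))"
proof -
  have "((\<lambda>t. plane_pt (s $ 3 - t *\<^sub>R christoffel G x v (s $ 3)) (s $ 4 - t *\<^sub>R christoffel G x v (s $ 4)))
    has_derivative (\<lambda>t. plane_deriv (s $ 3 - 0 *\<^sub>R christoffel G x v (s $ 3)) (s $ 4 - 0 *\<^sub>R christoffel G x v (s $ 4))
       (t *\<^sub>R (- christoffel G x v (s $ 3))) (t *\<^sub>R (- christoffel G x v (s $ 4))))) (at 0)"
    by (rule plane_pt_has_derivative) (use assms in \<open>auto intro!: derivative_eq_intros\<close>)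
  then show ?thesis
    unfolding plane_hlift_def plane_deriv_scale
    by (simp add: vector_derivative_at has_vector_derivative_def)
qed

lemma plane_curve_derivative:
  assumes "wedge u v \<noteq> 0"
  shows "((\<lambda>t. plane_pt (u + t *\<^sub>R u') (v + t *\<^sub>R v')) has_vector_derivative plane_deriv u v u' v') (at 0)"
proof -
  have "((\<lambda>t. plane_pt (u + t *\<^sub>R u') (v + t *\<^sub>R v')) has_derivative
      (\<lambda>t. plane_deriv (u + 0 *\<^sub>R u') (v + 0 *\<^sub>R v') (t *\<^sub>R u') (t *\<^sub>R v'))) (at 0)"
    by (rule plane_pt_has_derivative) (use assms in \<open>auto intro!: derivative_eq_intros\<close>)
  then show ?thesis
    unfolding plane_deriv_scale by (simp add: has_vector_derivative_def)
qed

lemma plane_vert_eq: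
  "wedge (s $ 3) (s $ 4) \<noteq> 0 \<Longrightarrow> plane_vert s b = (0, plane_deriv (s $ 3) (s $ 4) (b (s $ 3)) (b (s $ 4)))"
  unfolding plane_vert_def by (simp add: vector_derivative_at[OF plane_curve_derivative])

lemma smooth_on_plane_pt:
  fixes N P :: "'a::euclidean_space \<Rightarrow> real^4"
  assumes "open S" "smooth_on S N" "smooth_on S P" "\<And>y. y \<in> S \<Longrightarrow> wedge (N y) (P y) \<noteq> 0"
  shows "smooth_on S (\<lambda>y. plane_pt (N y) (P y))"
proof -
  have w: "smooth_on S (\<lambda>y. wedge (N y) (P y))"
    by (rule smooth_on_bilinear[OF bounded_bilinear_wedge assms(1-3)])
  have "smooth_on S (\<lambda>y. ((wedge (N y) (P y) \<bullet> wedge (N y) (P y)) powr (- 1 / 2)) *\<^sub>R wedge (N y) (P y))"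
    by (intro smooth_on_scaleR smooth_on_powr smooth_on_inner w assms(1)) (use assms(4) in simp)
  then show ?thesis
    by (rule smooth_on_cong[OF assms(1), rotated])
      (use assms(4) in \<open>simp add: plane_pt_wedge powr_minus powr_half_sqrt norm_eq_sqrt_inner\<close>)
qed

section \<open>The second fundamental form in an adapted frame\<close>

lemma lorentz_invertible:
  assumes "pseudo_orthonormal g s" "transpose g = g"
  shows "invertible g"
proof -
  have "w = 0" if "g *v w = 0" for w
  proof -
    have "ip g w v = 0" for v
      using that ip_sym[OF assms(2), of w v] by (simp add: ip_def)
    then show ?thesis using pseudo_orthonormal_expansion[OF assms(1), of w] by simp
  qed
  then show ?thesis
    by (simp add: invertible_left_inverse matrix_left_invertible_ker)
qed

text \<open>Passes from the induced metric, given as a matrix, to inner products of image vectors.\<close>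

lemma ip_pullback:
  fixes F :: "real^'n \<Rightarrow> real^'m"
  assumes "linear (differential F y)"
  shows "ip (pullback G F y) X Y = ip (G (F y)) (differential F y X) (differential F y Y)"
proof -
  have "X \<bullet> (transpose A *v z) = (A *v X) \<bullet> z" for A :: "real^'n^'m" and X z
    by (metis dot_lmul_matrix inner_commute transpose_matrix_vector)
  then show ?thesis
    by (simp add: ip_def pullback_def fun_cong[OF matrix_vector_mul(2)[OF assms]]
        del: transpose_matrix_vector flip: matrix_vector_mul_assoc)
qed

lemma pos_basis_det: "pos_basis X Y \<longleftrightarrow> X $ 1 * Y $ 2 - X $ 2 * Y $ 1 > 0"
  by (simp add: pos_basis_def det_2)

lemma pos_basis_expansion:
  assumes "pos_basis E E'"
  shows "\<exists>a b. X = a *\<^sub>R E + b *\<^sub>R E'"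
proof -
  define d where "d = E $ 1 * E' $ 2 - E $ 2 * E' $ 1"
  have "d \<noteq> 0" using assms by (simp add: pos_basis_det d_def)
  then have "X = ((X $ 1 * E' $ 2 - X $ 2 * E' $ 1) / d) *\<^sub>R E + ((E $ 1 * X $ 2 - E $ 2 * X $ 1) / d) *\<^sub>R E'"
    by (simp add: vec_eq_iff forall_2 field_simps) (simp add: d_def algebra_simps)
  then show ?thesis by blast
qed

lemma pos_basis_change:
  assumes "pos_basis E E'"
  shows "pos_basis (p *\<^sub>R E + q *\<^sub>R E') (r *\<^sub>R E + t *\<^sub>R E') \<longleftrightarrow> p * t - q * r > 0"
proof -
  have "(p *\<^sub>R E + q *\<^sub>R E') $ 1 * (r *\<^sub>R E + t *\<^sub>R E') $ 2 - (p *\<^sub>R E + q *\<^sub>R E') $ 2 * (r *\<^sub>R E + t *\<^sub>R E') $ 1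
    = (p * t - q * r) * (E $ 1 * E' $ 2 - E $ 2 * E' $ 1)"
    by (simp add: algebra_simps)
  then show ?thesis using assms by (simp add: pos_basis_det zero_less_mult_iff)
qed

text \<open>The expression of a conformal immersion in a chart of the surface and a chart of the
  Lorentzian manifold.\<close>

locale surface_patch = metric_patch V G for V :: "(real^4) set" and G +
  fixes U :: "(real^2) set" and F :: "real^2 \<Rightarrow> real^4" and J :: "real^2 \<Rightarrow> real^2^2"
  assumes open_U: "open U" and smooth_F: "smooth_on U F"
    and F_in: "\<And>y. y \<in> U \<Longrightarrow> F y \<in> V"
    and lorentz: "\<And>x. x \<in> V \<Longrightarrow> \<exists>s. pseudo_orthonormal (G x) s"
    and spacelike: "\<And>y X. y \<in> U \<Longrightarrow> X \<noteq> 0 \<Longrightarrow>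
      ip (G (F y)) (differential F y X) (differential F y X) > 0"
    and rotation_J: "\<And>y X. y \<in> U \<Longrightarrow> X \<noteq> 0 \<Longrightarrow>
      ip (G (F y)) (differential F y (J y *v X)) (differential F y (J y *v X)) =
        ip (G (F y)) (differential F y X) (differential F y X) \<and>
      ip (G (F y)) (differential F y X) (differential F y (J y *v X)) = 0 \<and>
      pos_basis X (J y *v X)"
begin

lemmas linear_dF = smooth_on_linear_derivative[OF smooth_F]
lemmas F_deriv = smooth_on_has_derivative[OF smooth_F]

lemma differentiable_F: "y \<in> U \<Longrightarrow> F differentiable at y"
  using F_deriv by (auto simp: differentiable_def)

lemma differentiable_dF: "y \<in> U \<Longrightarrow> (\<lambda>y. differential F y Y) differentiable at y"
  using smooth_on_has_derivative[OF smooth_on_derivative[OF smooth_F]] by (auto simp: differentiable_def)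

text \<open>The Hessian of the map, with \<open>Y\<close> extended to a field with constant components. Another extension
  would change it by a tangential vector only.\<close>

abbreviation hess :: "real^2 \<Rightarrow> real^2 \<Rightarrow> real^2 \<Rightarrow> real^4" where
  "hess y X Y \<equiv> cov_deriv G F (\<lambda>y'. differential F y' Y) y X"

text \<open>Second derivatives commute, and the connection has no torsion.\<close>

lemma hess_sym: "y \<in> U \<Longrightarrow> hess y X Y = hess y Y X"
  using second_derivative_symmetric[OF open_U _ smooth_F, of y Y X] christoffel_sym[OF F_in]
  by (simp add: cov_deriv_def)

lemma linear_hess_left: "y \<in> U \<Longrightarrow> linear (\<lambda>X. hess y X Y)"
  by (rule cov_deriv_linear[OF smooth_on_linear_derivative[OF smooth_on_derivative[OF smooth_F]] linear_dF])

lemma linear_hess_right: "y \<in> U \<Longrightarrow> linear (hess y X)"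
  using linear_hess_left[of y X] by (simp add: hess_sym[of y X])

text \<open>Differentiates a constant inner product. This turns covariant derivatives of a null normal field
  into values of the second fundamental form.\<close>

lemma cov_deriv_ip_zero:
  assumes "y \<in> U" "open W" "y \<in> W" "A differentiable at y" "B differentiable at y"
    and "\<And>y. y \<in> W \<Longrightarrow> ip (G (F y)) (A y) (B y) = c"
  shows "ip (G (F y)) (cov_deriv G F A y X) (B y) + ip (G (F y)) (A y) (cov_deriv G F B y X) = 0"
proof -
  note D = has_derivative_ip[of F y A B, OF F_in[OF assms(1)] differentiable_F[OF assms(1)] assms(4,5)]
  have "((\<lambda>y. c) has_derivative (\<lambda>X. ip (G (F y)) (cov_deriv G F A y X) (B y) +
      ip (G (F y)) (A y) (cov_deriv G F B y X))) (at y)"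
    by (rule has_derivative_transform_within_open[OF D assms(2,3)]) (use assms(6) in simp)
  from fun_cong[OF has_derivative_unique[OF this has_derivative_const], of X] show ?thesis .
qed

end

text \<open>A Darboux frame \<open>e\<close> at a point, together with the tangent vectors \<open>E\<^sub>3\<close> and \<open>E\<^sub>4\<close> of the surface that
  are mapped to its tangential part.\<close>

locale adapted_frame = surface_patch +
  fixes y :: "real^2" and e :: "real^4^4" and E3 E4 :: "real^2"
  assumes y_in: "y \<in> U" and frame: "SO_frame (G (F y)) e" and pos_E: "pos_basis E3 E4"
    and e34: "e $ 3 = differential F y E3" "e $ 4 = differential F y E4"
begin

abbreviation g :: "real^4 \<Rightarrow> real^4 \<Rightarrow> real" where "g \<equiv> ip (G (F y))"
abbreviation dF :: "real^2 \<Rightarrow> real^4" where "dF \<equiv> differential F y"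
definition null :: "real \<Rightarrow> real^4" where "null \<sigma> = e $ 1 + \<sigma> *\<^sub>R e $ 2"

lemma sym_g: "g u v = g v u"
  by (rule ip_sym[OF sym_G[OF F_in[OF y_in]]])

lemma e_ip: "g (e $ i) (e $ j) = (if i = j then (if i = 1 then - 1 else 1) else 0)"
  using frame by (simp add: SO_frame_def pseudo_orthonormal_def)

lemma lin: "linear dF" by (rule linear_dF[OF y_in])

lemma dF_simps: "dF (X + Y) = dF X + dF Y" "dF (c *\<^sub>R X) = c *\<^sub>R dF X" "dF (- X) = - dF X" "dF 0 = 0"
  by (simp_all add: linear_add[OF lin] linear_cmul[OF lin] linear_neg[OF lin] linear_0[OF lin])

lemma hess_simps:
  "hess y (X + X') Y = hess y X Y + hess y X' Y" "hess y (c *\<^sub>R X) Y = c *\<^sub>R hess y X Y"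
  "hess y (- X) Y = - hess y X Y"
  "hess y X (Y + Y') = hess y X Y + hess y X Y'" "hess y X (c *\<^sub>R Y) = c *\<^sub>R hess y X Y"
  by (rule linear_add[OF linear_hess_left[OF y_in]] linear_cmul[OF linear_hess_left[OF y_in]]
      linear_neg[OF linear_hess_left[OF y_in]] linear_add[OF linear_hess_right[OF y_in]]
      linear_cmul[OF linear_hess_right[OF y_in]])+

lemma darboux: "darboux_frame G F y e"
  using frame pos_E e34 by (auto simp: darboux_frame_def)

lemma tangent_expansion: "X = g (dF X) (e $ 3) *\<^sub>R E3 + g (dF X) (e $ 4) *\<^sub>R E4"
proof -
  obtain a b where X: "X = a *\<^sub>R E3 + b *\<^sub>R E4" using pos_basis_expansion[OF pos_E] by blast
  then have "g (dF X) (e $ 3) = a" "g (dF X) (e $ 4) = b"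
    by (simp_all add: dF_simps e_ip flip: e34)
  with X show ?thesis by simp
qed

lemma dF_expansion: "dF X = g (dF X) (e $ 3) *\<^sub>R e $ 3 + g (dF X) (e $ 4) *\<^sub>R e $ 4"
  by (subst (1) tangent_expansion[of X]) (simp only: dF_simps e34)

lemma E_nonzero: "E3 \<noteq> 0" "E4 \<noteq> 0"
  using pos_E by (auto simp: pos_basis_det)

text \<open>Conformality enters here: the rotation by a positive right angle for the conformal structure is the
  one for the induced metric.\<close>

lemma J_E: "J y *v E3 = E4" "J y *v E4 = - E3"
proof -
  note J3 = rotation_J[OF y_in E_nonzero(1)] and J4 = rotation_J[OF y_in E_nonzero(2)]
  obtain a b where 3: "J y *v E3 = a *\<^sub>R E3 + b *\<^sub>R E4" using pos_basis_expansion[OF pos_E] by blast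
  have "a = 0" using J3 by (simp add: 3 dF_simps e_ip flip: e34)
  moreover have "b > 0"
    using J3 pos_basis_change[OF pos_E, of 1 0 a b] by (simp add: 3)
  moreover have "b * b = 1" using J3 \<open>a = 0\<close> by (simp add: 3 dF_simps e_ip flip: e34)
  ultimately show "J y *v E3 = E4" using 3 by (metis abs_of_pos abs_square_eq_1 add_0 power2_eq_square scaleR_one scaleR_zero_left)
  obtain a b where 4: "J y *v E4 = a *\<^sub>R E3 + b *\<^sub>R E4" using pos_basis_expansion[OF pos_E] by blast
  have b0: "b = 0" using J4 by (simp add: 4 dF_simps e_ip flip: e34)
  moreover have "a < 0"
    using J4 pos_basis_change[OF pos_E, of 0 1 a b] by (simp add: 4)
  moreover have "a * a = 1" using J4 b0 by (simp add: 4 dF_simps e_ip flip: e34)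
  ultimately have "a = - 1" by (metis abs_square_eq_1 abs_of_neg minus_minus power2_eq_square)
  then show "J y *v E4 = - E3" using 4 b0 by simp
qed

lemma J_expansion: "J y *v X = g (dF X) (e $ 3) *\<^sub>R E4 - g (dF X) (e $ 4) *\<^sub>R E3"
  by (subst (1) tangent_expansion[of X])
    (simp add: matrix_vector_right_distrib matrix_vector_mult_scaleR J_E)

lemma dF_J: "dF (J y *v X) = rot (G (F y)) e (dF X)"
  by (simp add: J_expansion rot_def e34 linear_diff[OF lin] dF_simps)

subsection \<open>Normal vectors\<close>

lemma normal_space_iff: "v \<in> normal_space G F y \<longleftrightarrow> g v (e $ 3) = 0 \<and> g v (e $ 4) = 0"
proof
  assume "v \<in> normal_space G F y"
  then show "g v (e $ 3) = 0 \<and> g v (e $ 4) = 0" by (simp add: normal_space_def e34)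
next
  assume "g v (e $ 3) = 0 \<and> g v (e $ 4) = 0"
  then have "g v (dF X) = 0" for X by (subst dF_expansion) simp
  then show "v \<in> normal_space G F y" by (simp add: normal_space_def)
qed

lemma normal_part_eq: "normal_part G F y v = v - g v (e $ 3) *\<^sub>R e $ 3 - g v (e $ 4) *\<^sub>R e $ 4"
  (is "_ = ?w")
  unfolding normal_part_def
proof (rule the_equality)
  have "v - ?w = dF (g v (e $ 3) *\<^sub>R E3 + g v (e $ 4) *\<^sub>R E4)" by (simp add: dF_simps e34)
  then have "v - ?w \<in> range dF" by (metis rangeI)
  then show "?w \<in> normal_space G F y \<and> v - ?w \<in> range dF"
    by (simp add: normal_space_iff e_ip)
next
  fix w assume w: "w \<in> normal_space G F y \<and> v - w \<in> range dF"
  then obtain X where X: "v - w = dF X" by blast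
  then have v: "v = w + dF X" by (metis diff_add_cancel add.commute)
  have "g v (e $ 3) = g (dF X) (e $ 3)" "g v (e $ 4) = g (dF X) (e $ 4)"
    using w by (simp_all add: v normal_space_iff)
  then show "w = ?w" using dF_expansion[of X] X by (simp add: algebra_simps)
qed

lemma II_eq: "II G F y X Y = hess y X Y - g (hess y X Y) (e $ 3) *\<^sub>R e $ 3 - g (hess y X Y) (e $ 4) *\<^sub>R e $ 4"
  by (simp add: II_def normal_part_eq)

lemma II_normal: "g (II G F y X Y) (e $ 3) = 0" "g (II G F y X Y) (e $ 4) = 0"
  by (simp_all add: II_eq e_ip)

lemma II_simps:
  "II G F y (X + X') Y = II G F y X Y + II G F y X' Y" "II G F y (c *\<^sub>R X) Y = c *\<^sub>R II G F y X Y"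
  "II G F y (- X) Y = - II G F y X Y"
  "II G F y X (Y + Y') = II G F y X Y + II G F y X Y'" "II G F y X (c *\<^sub>R Y) = c *\<^sub>R II G F y X Y"
  by (simp_all add: II_eq hess_simps algebra_simps)

lemma II_sym: "II G F y X Y = II G F y Y X"
  by (simp add: II_eq hess_sym[OF y_in, of X])

lemma pullback_ip: "ip (pullback G F y) X Y = g (dF X) (dF Y)"
  by (rule ip_pullback[OF lin])

text \<open>The inverse of the induced metric is \<open>E\<^sub>3 E\<^sub>3\<^sup>T + E\<^sub>4 E\<^sub>4\<^sup>T\<close>, so that traces may be computed in
  the frame.\<close>

lemma inverse_pullback:
  "matrix_inv (pullback G F y) $ i $ j = E3 $ i * E3 $ j + E4 $ i * E4 $ j"
proof -
  define B :: "real^2^2" where "B = (\<chi> i j. E3 $ i * E3 $ j + E4 $ i * E4 $ j)"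
  define h where "h = pullback G F y"
  have Bv: "B *v Z = (E3 \<bullet> Z) *\<^sub>R E3 + (E4 \<bullet> Z) *\<^sub>R E4" for Z
    by (simp add: B_def vec_eq_iff matrix_vector_mult_def inner_vec_def sum_2 algebra_simps)
  have "(B ** h) *v X = X" for X
  proof -
    have "(B ** h) *v X = ip h E3 X *\<^sub>R E3 + ip h E4 X *\<^sub>R E4"
      by (simp add: ip_def Bv flip: matrix_vector_mul_assoc)
    also have "\<dots> = X"
      using tangent_expansion[of X] by (simp add: h_def pullback_ip sym_g[of "dF X"] e34)
    finally show ?thesis .
  qed
  then have "B ** h = mat 1" by (simp add: matrix_eq)
  then have "h ** B = mat 1" by (simp add: matrix_left_right_inverse)
  then have "matrix_inv h = B" by (rule matrix_inv_unique)
  then show ?thesis by (simp add: h_def B_def)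
qed

lemma trace_in_frame:
  fixes B :: "real^2 \<Rightarrow> real^2 \<Rightarrow> real^4"
  assumes "\<And>Y. linear (\<lambda>X. B X Y)" "\<And>X. linear (B X)"
  shows "(\<Sum>i\<in>UNIV. \<Sum>j\<in>UNIV. matrix_inv (pullback G F y) $ i $ j *\<^sub>R B (axis i 1) (axis j 1)) =
    B E3 E3 + B E4 E4"
proof -
  have ax: "Z = Z $ 1 *\<^sub>R axis 1 1 + Z $ 2 *\<^sub>R axis 2 1" for Z :: "real^2"
    by (simp add: vec_eq_iff forall_2 axis_def)
  have "B Z Z = (Z $ 1 * Z $ 1) *\<^sub>R B (axis 1 1) (axis 1 1) + (Z $ 1 * Z $ 2) *\<^sub>R B (axis 1 1) (axis 2 1)
      + (Z $ 2 * Z $ 1) *\<^sub>R B (axis 2 1) (axis 1 1) + (Z $ 2 * Z $ 2) *\<^sub>R B (axis 2 1) (axis 2 1)" for Z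
  proof -
    have "B Z Z = B (Z $ 1 *\<^sub>R axis 1 1 + Z $ 2 *\<^sub>R axis 2 1) (Z $ 1 *\<^sub>R axis 1 1 + Z $ 2 *\<^sub>R axis 2 1)"
      using ax[of Z] by simp
    then show ?thesis
      by (simp add: linear_add[OF assms(1)] linear_add[OF assms(2)] linear_cmul[OF assms(1)]
          linear_cmul[OF assms(2)] algebra_simps)
  qed
  from this[of E3] this[of E4] show ?thesis
    by (simp add: sum_2 inverse_pullback algebra_simps)
qed

lemma mean_curv_eq: "mean_curv G F y = (1/2) *\<^sub>R (II G F y E3 E3 + II G F y E4 E4)"
proof -
  have "linear (\<lambda>X. II G F y X Y)" "linear (II G F y Y)" for Y
    by (auto intro!: linearI simp: II_simps)
  then show ?thesis unfolding mean_curv_def by (simp add: trace_in_frame)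
qed

text \<open>By the Koszul formula for the induced metric, whose derivatives are computed from metric
  compatibility in the ambient space, the tangential part of the Hessian is the Levi-Civita connection
  of the induced metric. The tension subtracts this part, leaving the trace of \<open>II\<close>.\<close>

lemma tension_eq: "tension G F y = 2 *\<^sub>R mean_curv G F y"
proof -
  define h where "h = pullback G F"
  have h_ip: "ip (h y') X Y = ip (G (F y')) (differential F y' X) (differential F y' Y)" if "y' \<in> U" for y' X Y
    unfolding h_def by (rule ip_pullback[OF linear_dF[OF that]])
  have Dh: "((\<lambda>y'. ip (h y') X Y) has_derivative (\<lambda>Z. g (hess y Z X) (dF Y) + g (dF X) (hess y Z Y))) (at y)" for X Y
    by (rule has_derivative_transform_within_open[OF has_derivative_ip[OF F_in[OF y_in]
          differentiable_F[OF y_in] differentiable_dF[OF y_in] differentiable_dF[OF y_in]] open_U y_in])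
      (simp add: h_ip)
  have comp: "ip A (axis i 1) (axis j 1) = A $ i $ j" for A :: "real^2^2" and i j
    by (simp add: ip_def matrix_vector_mult_basis inner_axis' column_def)
  have "(\<lambda>y'. h y' \<bullet> b) differentiable at y" if Basis: "b \<in> Basis" for b
  proof -
    obtain i j where b: "b = axis i (axis j 1)"
      using Basis by (auto simp: Basis_vec_def)
    have "h y' \<bullet> b = ip (h y') (axis i 1) (axis j 1)" for y'
      by (simp add: comp b inner_axis)
    then show ?thesis using Dh[of "axis i 1" "axis j 1"] by (auto simp: differentiable_def)
  qed
  then have "h differentiable at y" using differentiable_componentwise_within[of h y UNIV] by simp
  then have dh: "(h has_derivative differential h y) (at y)" by (simp flip: frechet_derivative_works)
  have Dh': "ip (differential h y Z) X Y = g (hess y Z X) (dF Y) + g (dF X) (hess y Z Y)" for X Y Z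
  proof -
    have "((\<lambda>y'. X \<bullet> (h y' *v Y)) has_derivative (\<lambda>Z. X \<bullet> (differential h y Z *v Y))) (at y)"
      by (intro bounded_linear.has_derivative[OF bounded_linear_inner_right]
          bounded_linear.has_derivative[OF bounded_bilinear.bounded_linear_left[OF bounded_bilinear_matrix_vector]] dh)
    from fun_cong[OF has_derivative_unique[OF this[folded ip_def] Dh[of X Y]], of Z] show ?thesis .
  qed
  have sym_h: "transpose (h y) = h y"
  proof -
    have "h y $ i $ j = h y $ j $ i" for i j
      unfolding comp[symmetric] using y_in by (simp add: h_ip sym_g)
    then show ?thesis by (simp add: transpose_def vec_eq_iff)
  qed
  have inv_h: "invertible (h y)"
  proof -
    have "X = 0" if "h y *v X = 0" for X
      using spacelike[OF y_in, of X] h_ip[OF y_in, of X X] that by (auto simp: ip_def)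
    then show ?thesis by (simp add: invertible_left_inverse matrix_left_invertible_ker)
  qed
  \<comment> \<open>of the six terms in the Koszul formula four cancel by the symmetry of the Hessian\<close>
  have chr: "g (dF (christoffel h y X Y)) (dF Z) = g (hess y X Y) (dF Z)" for X Y Z
  proof -
    have "g (dF (christoffel h y X Y)) (dF Z) = ip (h y) (christoffel h y X Y) Z"
      by (simp add: h_ip y_in)
    also have "\<dots> = g (hess y X Y) (dF Z)"
      unfolding ip_christoffel[OF sym_h inv_h has_derivative_linear[OF dh]] Dh'
      using hess_sym[OF y_in, of X Y] hess_sym[OF y_in, of Y Z] hess_sym[OF y_in, of X Z]
        sym_g[of "dF Y" "hess y X Z"] sym_g[of "dF X" "hess y Y Z"] by (simp add: sym_g)
    finally show ?thesis .
  qed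
  have "hess y X Y - dF (christoffel h y X Y) = II G F y X Y" for X Y
    unfolding II_eq using dF_expansion[of "christoffel h y X Y"] chr[of X Y E3] chr[of X Y E4]
    by (simp add: e34)
  moreover have "linear (\<lambda>X. II G F y X Y)" "linear (II G F y Y)" for Y
    by (auto intro!: linearI simp: II_simps)
  ultimately show ?thesis
    unfolding tension_def h_def[symmetric] by (simp add: trace_in_frame[folded h_def] mean_curv_eq)
qed

subsection \<open>Null components\<close>

lemma null_frame_e: "\<sigma>\<^sup>2 = 1 \<Longrightarrow> null_frame (G (F y)) (null \<sigma>) (null (- \<sigma>)) (e $ 3) (e $ 4)"
  using null_frame_of_frame[of "G (F y)" e \<sigma>] frame by (simp add: SO_frame_def null_def)

text \<open>The union over all Darboux frames in the definition contributes one line only, since frames of the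
  same oriented plane have the same null lines.\<close>

lemma null_normal_eq:
  assumes "\<sigma>\<^sup>2 = 1"
  shows "null_normal G F \<sigma> y = span {null \<sigma>}"
proof -
  have "\<exists>c. r *\<^sub>R (e' $ 1 + \<sigma> *\<^sub>R e' $ 2) = c *\<^sub>R null \<sigma>" if e': "darboux_frame G F y e'" for r e'
  proof -
    obtain X Y where XY: "pos_basis X Y" "e' $ 3 = dF X" "e' $ 4 = dF Y"
      using e' by (auto simp: darboux_frame_def)
    obtain p q where X: "X = p *\<^sub>R E3 + q *\<^sub>R E4" using pos_basis_expansion[OF pos_E] by blast
    obtain r t where Y: "Y = r *\<^sub>R E3 + t *\<^sub>R E4" using pos_basis_expansion[OF pos_E] by blast
    have "p * t - q * r > 0" using XY(1) pos_basis_change[OF pos_E] X Y by simp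
    moreover have "SO_frame (G (F y)) e'" "e' $ 3 = p *\<^sub>R e $ 3 + q *\<^sub>R e $ 4"
      "e' $ 4 = r *\<^sub>R e $ 3 + t *\<^sub>R e $ 4"
      using e' XY(2,3) by (simp_all add: darboux_frame_def X Y dF_simps e34)
    ultimately obtain l where "e' $ 1 + \<sigma> *\<^sub>R e' $ 2 = l *\<^sub>R null \<sigma>"
      using same_plane_null_line(1)[OF frame _ assms, of e' p q r t] unfolding null_def by blast
    then have "r' *\<^sub>R (e' $ 1 + \<sigma> *\<^sub>R e' $ 2) = (r' * l) *\<^sub>R null \<sigma>" for r' by simp
    then show ?thesis by blast
  qed
  then show ?thesis
    unfolding null_normal_def span_singleton using darboux unfolding null_def by blast
qed

text \<open>The two null lines are isotropic, so the component of a normal vector in one of them is detected by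
  the inner product with a generator of the other. This is why the line with sign \<open>\<sigma>\<close> carries
  information about \<open>H\<close> and \<open>L\<close> with sign \<open>- \<sigma>\<close>.\<close>

lemma null_comp_eq:
  assumes "\<sigma>\<^sup>2 = 1" "g v (e $ 3) = 0" "g v (e $ 4) = 0"
  shows "null_comp G F (- \<sigma>) y v = (- g v (null \<sigma>) / 2) *\<^sub>R null (- \<sigma>)"
proof -
  note nf = null_frame_e[OF assms(1)]
  have m\<sigma>: "(- \<sigma>)\<^sup>2 = 1" using assms(1) by simp
  have v: "v = (- g v (null (- \<sigma>)) / 2) *\<^sub>R null \<sigma> + (- g v (null \<sigma>) / 2) *\<^sub>R null (- \<sigma>)"
    using null_frame_expansion[OF nf, of v] assms(2,3) by simp
  show ?thesis
    unfolding null_comp_def minus_minus null_normal_eq[OF assms(1)] null_normal_eq[OF m\<sigma>] span_singleton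
  proof (rule the_equality)
    have "v - (- g v (null \<sigma>) / 2) *\<^sub>R null (- \<sigma>) = (- g v (null (- \<sigma>)) / 2) *\<^sub>R null \<sigma>"
      using v by (simp only: diff_eq_eq)
    then show "(- g v (null \<sigma>) / 2) *\<^sub>R null (- \<sigma>) \<in> range (\<lambda>k. k *\<^sub>R null (- \<sigma>)) \<and>
        v - (- g v (null \<sigma>) / 2) *\<^sub>R null (- \<sigma>) \<in> range (\<lambda>k. k *\<^sub>R null \<sigma>)" by blast
  next
    fix a assume "a \<in> range (\<lambda>k. k *\<^sub>R null (- \<sigma>)) \<and> v - a \<in> range (\<lambda>k. k *\<^sub>R null \<sigma>)"
    then obtain c d where a: "a = c *\<^sub>R null (- \<sigma>)" and d: "v - a = d *\<^sub>R null \<sigma>" by blast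
    have "v = c *\<^sub>R null (- \<sigma>) + d *\<^sub>R null \<sigma>" using a d by (metis add.commute diff_add_cancel)
    then have "g v (null \<sigma>) = - 2 * c" using null_frame_ip[OF nf] by simp
    then show "a = (- g v (null \<sigma>) / 2) *\<^sub>R null (- \<sigma>)" by (simp add: a)
  qed
qed

lemma null_comp_eq_0_iff:
  assumes "\<sigma>\<^sup>2 = 1" "g v (e $ 3) = 0" "g v (e $ 4) = 0"
  shows "null_comp G F (- \<sigma>) y v = 0 \<longleftrightarrow> g (null \<sigma>) v = 0"
  using null_frame_nonzero(2)[OF null_frame_e[OF assms(1)]]
  by (simp add: null_comp_eq[OF assms] sym_g[of v])

lemma null_II: "\<sigma>\<^sup>2 = 1 \<Longrightarrow> g (null \<sigma>) (II G F y X Y) = g (null \<sigma>) (hess y X Y)"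
  using null_frame_ip[OF null_frame_e] by (simp add: II_eq)

lemma H_pm_eq_0_iff:
  assumes "\<sigma>\<^sup>2 = 1"
  shows "H_pm G F (- \<sigma>) y = 0 \<longleftrightarrow> g (null \<sigma>) (hess y E3 E3) + g (null \<sigma>) (hess y E4 E4) = 0"
  unfolding H_pm_def mean_curv_eq
  by (subst null_comp_eq_0_iff[OF assms]) (simp_all add: II_normal null_II[OF assms])

lemma L_pm_eq_0_iff:
  assumes "\<sigma>\<^sup>2 = 1"
  shows "(\<forall>X Y. L_pm G F (- \<sigma>) y X Y = 0) \<longleftrightarrow>
    g (null \<sigma>) (hess y E3 E4) = 0 \<and> g (null \<sigma>) (hess y E3 E3) = g (null \<sigma>) (hess y E4 E4)"
proof -
  define a where "a = (\<lambda>X Y. g (null \<sigma>) (hess y X Y))"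
  have lin_a: "a (X + X') Y = a X Y + a X' Y" "a (c *\<^sub>R X) Y = c * a X Y"
    "a X (Y + Y') = a X Y + a X Y'" "a X (c *\<^sub>R Y) = c * a X Y" for X X' Y Y' c
    unfolding a_def hess_simps by simp_all
  have sym_a: "a X Y = a Y X" for X Y by (simp add: a_def hess_sym[OF y_in, of X])
  have L: "L_pm G F (- \<sigma>) y X Y = 0 \<longleftrightarrow> a X Y = g (dF X) (dF Y) * (a E3 E3 + a E4 E4) / 2" for X Y
    unfolding L_pm_def trace_free_part_def mean_curv_eq pullback_ip
    by (subst null_comp_eq_0_iff[OF assms]) (simp_all add: II_normal null_II[OF assms] a_def)
  have tr: "a X Y = g (dF X) (dF Y) * (a E3 E3 + a E4 E4) / 2" if "a E3 E4 = 0" "a E3 E3 = a E4 E4" for X Y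
  proof -
    obtain p q where X: "X = p *\<^sub>R E3 + q *\<^sub>R E4" using pos_basis_expansion[OF pos_E] by blast
    obtain r t where Y: "Y = r *\<^sub>R E3 + t *\<^sub>R E4" using pos_basis_expansion[OF pos_E] by blast
    show ?thesis
      using that by (simp add: X Y lin_a sym_a[of E4 E3] dF_simps e_ip algebra_simps flip: e34)
  qed
  show ?thesis
  proof
    assume "\<forall>X Y. L_pm G F (- \<sigma>) y X Y = 0"
    then have "a X Y = g (dF X) (dF Y) * (a E3 E3 + a E4 E4) / 2" for X Y unfolding L by blast
    from this[of E3 E4] this[of E3 E3] have "a E3 E4 = 0" "a E3 E3 = (a E3 E3 + a E4 E4) / 2"
      by (simp_all add: e_ip flip: e34)
    then show "g (null \<sigma>) (hess y E3 E4) = 0 \<and> g (null \<sigma>) (hess y E3 E3) = g (null \<sigma>) (hess y E4 E4)"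
      by (simp add: a_def)
  next
    assume "g (null \<sigma>) (hess y E3 E4) = 0 \<and> g (null \<sigma>) (hess y E3 E3) = g (null \<sigma>) (hess y E4 E4)"
    then have "a E3 E4 = 0" "a E3 E3 = a E4 E4" by (simp_all add: a_def)
    then show "\<forall>X Y. L_pm G F (- \<sigma>) y X Y = 0"
      unfolding L using tr by blast
  qed
qed

text \<open>A symmetric bilinear form on the plane is a multiple of the metric precisely if its matrix in an
  orthonormal basis is a multiple of the identity.\<close>

lemma umbilic_iff:
  "(\<forall>X Y. II G F y X Y = ip (pullback G F y) X Y *\<^sub>R mean_curv G F y) \<longleftrightarrow>
    II G F y E3 E4 = 0 \<and> II G F y E3 E3 = II G F y E4 E4" (is "?L \<longleftrightarrow> ?R")
proof
  assume L: ?L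
  have "II G F y E3 E4 = 0" using L[rule_format, of E3 E4] by (simp add: pullback_ip e_ip flip: e34)
  moreover have "II G F y E3 E3 = mean_curv G F y" "II G F y E4 E4 = mean_curv G F y"
    using L[rule_format, of E3 E3] L[rule_format, of E4 E4] by (simp_all add: pullback_ip e_ip flip: e34)
  ultimately show ?R by simp
next
  assume R: ?R
  then have m: "mean_curv G F y = II G F y E4 E4" by (simp add: mean_curv_eq flip: scaleR_2)
  show ?L
  proof (intro allI)
    fix X Y
    obtain p q where X: "X = p *\<^sub>R E3 + q *\<^sub>R E4" using pos_basis_expansion[OF pos_E] by blast
    obtain r t where Y: "Y = r *\<^sub>R E3 + t *\<^sub>R E4" using pos_basis_expansion[OF pos_E] by blast
    show "II G F y X Y = ip (pullback G F y) X Y *\<^sub>R mean_curv G F y"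
      using R II_sym[of E4 E3]
      by (simp add: X Y m pullback_ip II_simps dF_simps e_ip algebra_simps flip: e34)
  qed
qed

end

text \<open>Any unit tangent vector and its image under \<open>J\<close> form an oriented orthonormal basis of the tangent
  plane.\<close>

lemma (in surface_patch) adapted_frame_exists:
  assumes "y \<in> U"
  shows "\<exists>e E3 E4. adapted_frame V G U F J y e E3 E4"
proof -
  have ax: "axis 1 1 \<noteq> (0::real^2)" by (simp add: axis_eq_0_iff)
  define l where "l = ip (G (F y)) (differential F y (axis 1 1)) (differential F y (axis 1 1))"
  have l: "l > 0" unfolding l_def by (rule spacelike[OF assms ax])
  define E where "E = (1 / sqrt l) *\<^sub>R (axis 1 1 :: real^2)"
  have E0: "E \<noteq> 0" using ax l by (simp add: E_def)
  have 1: "ip (G (F y)) (differential F y E) (differential F y E) = 1"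
    using l by (simp add: E_def linear_cmul[OF linear_dF[OF assms]] flip: l_def)
  note r = rotation_J[OF assms E0]
  obtain s where s: "pseudo_orthonormal (G (F y)) s" using lorentz[OF F_in[OF assms]] by blast
  obtain e where "SO_frame (G (F y)) e" "e $ 3 = differential F y E" "e $ 4 = differential F y (J y *v E)"
    using spacelike_plane_frame[OF s sym_G[OF F_in[OF assms]], of "differential F y E" "differential F y (J y *v E)"] 1 r by auto
  then have "adapted_frame V G U F J y e E (J y *v E)"
    by unfold_locales (use assms r in auto)
  then show ?thesis by blast
qed

section \<open>Smooth null normal fields\<close>

context surface_patch
begin

lemma darboux_adapted:
  assumes "y \<in> U" "darboux_frame G F y e"
  shows "\<exists>E3 E4. adapted_frame V G U F J y e E3 E4"
proof -
  obtain X Y where "SO_frame (G (F y)) e" "pos_basis X Y" "e $ 3 = differential F y X" "e $ 4 = differential F y Y"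
    using assms(2) unfolding darboux_frame_def by blast
  then have "adapted_frame V G U F J y e X Y"
    using assms(1) by unfold_locales
  then show ?thesis by blast
qed

lemma smooth_on_ip:
  assumes "open W" "W \<subseteq> U" "smooth_on W A" "smooth_on W B"
  shows "smooth_on W (\<lambda>y. ip (G (F y)) (A y) (B y))"
proof -
  have "smooth_on W (\<lambda>y. G (F y))"
    by (rule smooth_on_compose[OF assms(1) open_V _ smooth_G smooth_on_subset[OF smooth_F assms(2)]])
      (use assms(2) F_in in auto)
  then show ?thesis
    unfolding ip_def
    by (intro smooth_on_inner smooth_on_bilinear[OF bounded_bilinear_matrix_vector] assms)
qed

text \<open>For a field that is timelike (\<open>\<tau> = -1\<close>) or spacelike (\<open>\<tau> = 1\<close>).\<close>

definition normalize :: "real \<Rightarrow> (real^2 \<Rightarrow> real^4) \<Rightarrow> real^2 \<Rightarrow> real^4" where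
  "normalize \<tau> A = (\<lambda>y. ((\<tau> * ip (G (F y)) (A y) (A y)) powr (- 1 / 2)) *\<^sub>R A y)"

lemma smooth_on_normalize:
  assumes "open W" "W \<subseteq> U" "smooth_on W A" "\<And>y. y \<in> W \<Longrightarrow> \<tau> * ip (G (F y)) (A y) (A y) > 0"
  shows "smooth_on W (normalize \<tau> A)"
  unfolding normalize_def
  by (intro smooth_on_scaleR smooth_on_powr smooth_on_mult smooth_on_const smooth_on_ip assms)

lemma normalize_ip:
  assumes "\<tau> = 1 \<or> \<tau> = - 1" "\<tau> * ip (G (F y)) (A y) (A y) > 0"
  shows "ip (G (F y)) (normalize \<tau> A y) (normalize \<tau> A y) = \<tau>"
proof -
  define q where "q = \<tau> * ip (G (F y)) (A y) (A y)"
  have "(q powr (- 1 / 2)) * (q powr (- 1 / 2)) = q powr (- 1)"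
    by (simp flip: powr_add)
  then have "(q powr (- 1 / 2)) * (q powr (- 1 / 2)) * q = 1"
    using assms(2)[folded q_def] by (simp add: powr_minus)
  moreover have "ip (G (F y)) (A y) (A y) = \<tau> * q" using assms(1) by (auto simp: q_def)
  moreover have "ip (G (F y)) (normalize \<tau> A y) (normalize \<tau> A y) =
      (q powr (- 1 / 2)) * (q powr (- 1 / 2)) * ip (G (F y)) (A y) (A y)"
    by (simp add: normalize_def q_def)
  ultimately show ?thesis by (simp add: mult_ac)
qed

lemma normalize_orthogonal:
  "ip (G (F y)) (A y) b = 0 \<Longrightarrow> ip (G (F y)) (normalize \<tau> A y) b = 0"
  by (simp add: normalize_def)

lemma normalize_id: "\<tau> * ip (G (F y)) (A y) (A y) = 1 \<Longrightarrow> normalize \<tau> A y = A y"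
  by (simp add: normalize_def)

end

context adapted_frame
begin

text \<open>The Lorentzian Gram--Schmidt process, applied to \<open>dF(E\<^sub>3)\<close>, \<open>dF(E\<^sub>4)\<close> and to the first two
  vectors of the given frame, kept constant in the chart. Near the base point the first of these
  stays timelike after projection and the second spacelike.\<close>

lemma local_darboux_field:
  "\<exists>W d. open W \<and> y \<in> W \<and> W \<subseteq> U \<and> (\<forall>i. smooth_on W (\<lambda>x. d x $ i)) \<and>
    (\<forall>x\<in>W. darboux_frame G F x (d x)) \<and> d y = e"
proof -
  define q where "q = (\<lambda>A B x. ip (G (F x)) (A x) (B x))"
  have q_sym: "q A B x = q B A x" if "x \<in> U" for A B x
    unfolding q_def by (rule ip_sym[OF sym_G[OF F_in[OF that]]])
  define f3 f4 where "f3 = (\<lambda>x. differential F x E3)" and "f4 = (\<lambda>x. differential F x E4)"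
  define d3 where "d3 = normalize 1 f3"
  define p4 where "p4 = (\<lambda>x. f4 x - q f4 d3 x *\<^sub>R d3 x)"
  define d4 where "d4 = normalize 1 p4"
  define p1 where "p1 = (\<lambda>x. e $ 1 - q (\<lambda>x. e $ 1) d3 x *\<^sub>R d3 x - q (\<lambda>x. e $ 1) d4 x *\<^sub>R d4 x)"
  define d1 where "d1 = normalize (- 1) p1"
  define p2 where "p2 = (\<lambda>x. e $ 2 + q (\<lambda>x. e $ 2) d1 x *\<^sub>R d1 x - q (\<lambda>x. e $ 2) d3 x *\<^sub>R d3 x
    - q (\<lambda>x. e $ 2) d4 x *\<^sub>R d4 x)"
  define d2 where "d2 = normalize 1 p2"
  have open_pos: "open {x \<in> S. f x > (0::real)}" if "open S" "smooth_on S f" for S :: "(real^2) set" and f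
    using continuous_open_preimage[OF smooth_on_continuous[OF that(2)] that(1) open_greaterThan[of 0]]
    by (simp add: vimage_def Int_def)
  \<comment> \<open>tangential steps: the induced metric is positive definite, so the denominators vanish nowhere on U\<close>
  have c3: "1 * q f3 f3 x > 0" if "x \<in> U" for x
    using spacelike[OF that E_nonzero(1)] by (simp add: q_def f3_def)
  have s3: "smooth_on U f3" "smooth_on U f4" "smooth_on U d3"
    unfolding d3_def f3_def f4_def
    by (intro smooth_on_derivative smooth_F smooth_on_normalize open_U order_refl;
        use c3 in \<open>simp add: q_def f3_def\<close>)+
  have d33: "q d3 d3 x = 1" if "x \<in> U" for x
    unfolding q_def d3_def using c3[OF that] by (intro normalize_ip) (auto simp: q_def)
  have s4: "smooth_on U p4"
    unfolding p4_def q_def by (intro smooth_on_diff smooth_on_scaleR smooth_on_ip s3 open_U order_refl)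
  have p43: "q p4 d3 x = 0" if "x \<in> U" for x
    using d33[OF that] by (simp add: q_def p4_def)
  \<comment> \<open>the projected field is dF applied to E4 - k E3, which never vanishes\<close>
  define k where "k = (\<lambda>x. q f4 d3 x * (q f3 f3 x powr (- 1 / 2)))"
  have p4_eq: "p4 x = differential F x (E4 - k x *\<^sub>R E3)" if "x \<in> U" for x
    using linear_dF[OF that]
    by (simp add: p4_def k_def d3_def normalize_def f3_def f4_def q_def linear_diff linear_cmul)
  have "E4 - k x *\<^sub>R E3 \<noteq> 0" for x
    using pos_basis_change[OF pos_E, of 1 0 "- k x" 1] by (auto simp: pos_basis_det)
  then have c4: "1 * q p4 p4 x > 0" if "x \<in> U" for x
    using spacelike[OF that, of "E4 - k x *\<^sub>R E3"] that by (simp add: q_def p4_eq)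
  have s4': "smooth_on U d4"
    unfolding d4_def using c4 by (intro smooth_on_normalize open_U order_refl s4) (simp add: q_def)
  have d44: "q d4 d4 x = 1" and d43: "q d4 d3 x = 0" if "x \<in> U" for x
    using c4[OF that] p43[OF that] unfolding q_def d4_def
    by (auto intro!: normalize_ip normalize_orthogonal)
  \<comment> \<open>normal steps: here the denominators are known to be nonzero only at the base point, so the
    neighbourhood shrinks\<close>
  define W1 where "W1 = {x \<in> U. - q p1 p1 x > 0}"
  have s1: "smooth_on U p1"
    unfolding p1_def q_def
    by (intro smooth_on_diff smooth_on_scaleR smooth_on_ip smooth_on_const s3 s4' open_U order_refl)
  have W1: "open W1" "W1 \<subseteq> U"
    unfolding W1_def q_def
    by (intro open_pos smooth_on_minus smooth_on_ip open_U s1 order_refl) auto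
  have p13: "q p1 d3 x = 0" and p14: "q p1 d4 x = 0" if "x \<in> U" for x
    using d33[OF that] d44[OF that] d43[OF that] q_sym[OF that, of d3 d4] by (simp_all add: q_def p1_def)
  have s1': "smooth_on W1 d1"
    unfolding d1_def
    by (intro smooth_on_normalize W1 smooth_on_subset[OF s1]) (auto simp: W1_def q_def)
  have d11: "q d1 d1 x = - 1" and d13: "q d1 d3 x = 0" and d14: "q d1 d4 x = 0" if "x \<in> W1" for x
    using that p13[of x] p14[of x] unfolding q_def d1_def W1_def
    by (auto intro!: normalize_ip normalize_orthogonal)
  define W2 where "W2 = {x \<in> W1. q p2 p2 x > 0}"
  have s2: "smooth_on W1 p2"
    unfolding p2_def q_def
    by (intro smooth_on_diff smooth_on_add smooth_on_scaleR smooth_on_ip smooth_on_const s1' W1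
        smooth_on_subset[OF s3(3) W1(2)] smooth_on_subset[OF s4' W1(2)])
  have W2: "open W2" "W2 \<subseteq> W1"
    unfolding W2_def q_def by (intro open_pos smooth_on_ip W1 s2) auto
  have p21: "q p2 d1 x = 0" and p23: "q p2 d3 x = 0" and p24: "q p2 d4 x = 0" if "x \<in> W1" for x
  proof -
    have x: "x \<in> U" using that W1 by blast
    show "q p2 d1 x = 0" "q p2 d3 x = 0" "q p2 d4 x = 0"
      using d33[OF x] d44[OF x] d43[OF x] q_sym[OF x, of d3 d4] d11[OF that] d13[OF that] d14[OF that]
        q_sym[OF x, of d3 d1] q_sym[OF x, of d4 d1] by (simp_all add: q_def p2_def)
  qed
  have s2': "smooth_on W2 d2"
    unfolding d2_def using W1 W2
    by (intro smooth_on_normalize smooth_on_subset[OF s2]) (auto simp: W2_def q_def)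
  have d22: "q d2 d2 x = 1" and d21: "q d2 d1 x = 0" and d23: "q d2 d3 x = 0" and d24: "q d2 d4 x = 0"
    if "x \<in> W2" for x
    using that p21[of x] p23[of x] p24[of x] unfolding q_def d2_def W2_def
    by (auto intro!: normalize_ip normalize_orthogonal)
  define d where "d = (\<lambda>x. vector [d1 x, d2 x, d3 x, d4 x] :: real^4^4)"
  define W3 where "W3 = {x \<in> W2. det (d x) > 0}"
  have sd: "smooth_on W2 (\<lambda>x. d x $ i)" for i
  proof -
    have "smooth_on W2 d1" "smooth_on W2 d2" "smooth_on W2 d3" "smooth_on W2 d4"
      using smooth_on_subset[OF s1' W2(2)] s2' smooth_on_subset[OF s3(3), of W2]
        smooth_on_subset[OF s4', of W2] W1 W2 by auto
    then show ?thesis using exhaust_4[of i] by (auto simp: d_def)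
  qed
  have comp: "continuous_on W2 (\<lambda>x. d x $ i $ j)" for i j
    by (intro continuous_on_component smooth_on_continuous sd)
  have "continuous_on W2 (\<lambda>x. det (d x))"
    unfolding det_4 by (intro continuous_on_add continuous_on_diff continuous_on_mult comp)
  from continuous_open_preimage[OF this W2(1) open_greaterThan[of 0]]
  have W3: "open W3" "W3 \<subseteq> W2"
    by (auto simp: W3_def vimage_def Int_def)
  have W3U: "W3 \<subseteq> U" using W3 W2 W1 by blast
  have darb: "darboux_frame G F x (d x)" if "x \<in> W3" for x
  proof -
    have x2: "x \<in> W2" and x1: "x \<in> W1" and xU: "x \<in> U" using that W3 W2 W1 by auto
    have "q d1 d2 x = 0" "q d3 d1 x = 0" "q d4 d1 x = 0" "q d3 d2 x = 0" "q d4 d2 x = 0" "q d3 d4 x = 0"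
      using d21[OF x2] d13[OF x1] d14[OF x1] d23[OF x2] d24[OF x2] d43[OF xU]
        q_sym[OF xU, of d1 d2] q_sym[OF xU, of d3 d1] q_sym[OF xU, of d4 d1] q_sym[OF xU, of d3 d2]
        q_sym[OF xU, of d4 d2] q_sym[OF xU, of d3 d4] by simp_all
    then have "pseudo_orthonormal (G (F x)) (d x)"
      using d11[OF x1] d13[OF x1] d14[OF x1] d21[OF x2] d22[OF x2] d23[OF x2] d24[OF x2] d33[OF xU]
        d43[OF xU] d44[OF xU]
      unfolding pseudo_orthonormal_def q_def d_def forall_4 by simp
    moreover have "det (d x) > 0" using that by (simp add: W3_def)
    moreover define a b where "a = q f3 f3 x powr (- 1 / 2)" and "b = q p4 p4 x powr (- 1 / 2)"
    have ab: "a > 0" "b > 0" using c3[OF xU] c4[OF xU] by (simp_all add: a_def b_def)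
    have "d x $ 3 = differential F x (a *\<^sub>R E3 + 0 *\<^sub>R E4)"
      using linear_dF[OF xU] by (simp add: d_def d3_def normalize_def f3_def q_def a_def linear_cmul)
    moreover have "d x $ 4 = differential F x ((- b * k x) *\<^sub>R E3 + b *\<^sub>R E4)"
    proof -
      have "d x $ 4 = b *\<^sub>R differential F x (E4 - k x *\<^sub>R E3)"
        by (simp add: d_def d4_def normalize_def b_def q_def flip: p4_eq[OF xU])
      also have "\<dots> = differential F x (b *\<^sub>R (E4 - k x *\<^sub>R E3))"
        using linear_dF[OF xU] by (simp add: linear_cmul)
      finally show ?thesis by (simp add: algebra_simps)
    qed
    moreover have "pos_basis (a *\<^sub>R E3 + 0 *\<^sub>R E4) ((- b * k x) *\<^sub>R E3 + b *\<^sub>R E4)"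
      unfolding pos_basis_change[OF pos_E] using ab by simp
    ultimately show ?thesis unfolding darboux_frame_def SO_frame_def by blast
  qed
  \<comment> \<open>an orthonormal frame is fixed by the process; hence the base point lies in the neighbourhood\<close>
  have y3: "f3 y = e $ 3" "f4 y = e $ 4" by (simp_all add: f3_def f4_def e34)
  have y3': "d3 y = e $ 3"
    unfolding d3_def by (subst normalize_id) (simp_all add: y3 e_ip)
  have y4: "p4 y = e $ 4" by (simp add: p4_def q_def y3 y3' e_ip)
  have y4': "d4 y = e $ 4" unfolding d4_def by (subst normalize_id) (simp_all add: y4 e_ip)
  have y1: "p1 y = e $ 1" by (simp add: p1_def q_def y3' y4' e_ip)
  have y1': "d1 y = e $ 1" unfolding d1_def by (subst normalize_id) (simp_all add: y1 e_ip)
  have y2: "p2 y = e $ 2" by (simp add: p2_def q_def y3' y4' y1' e_ip)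
  have y2': "d2 y = e $ 2" unfolding d2_def by (subst normalize_id) (simp_all add: y2 e_ip)
  have dy: "d y = e" by (simp add: d_def y1' y2' y3' y4' vector_rows_4)
  have "det e > 0" using frame by (simp add: SO_frame_def)
  then have "y \<in> W3"
    unfolding W3_def W2_def W1_def by (simp add: y_in dy) (simp add: q_def y1 y2 e_ip)
  then show ?thesis
    using W3 W3U darb dy smooth_on_subset[OF sd W3(2)] by blast
qed

text \<open>Along a smooth Darboux field the sum \<open>e\<^sub>1 + \<sigma> e\<^sub>2\<close> is a smooth generator of the null normal
  line.\<close>

lemma local_null_field:
  assumes "\<sigma>\<^sup>2 = 1"
  shows "\<exists>W n. open W \<and> y \<in> W \<and> W \<subseteq> U \<and> smooth_on W n \<and> n y = null \<sigma> \<and>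
    (\<forall>x\<in>W. n x \<noteq> 0 \<and> null_normal G F \<sigma> x = span {n x} \<and> ip (G (F x)) (n x) (n x) = 0 \<and>
      (\<forall>X. ip (G (F x)) (n x) (differential F x X) = 0))"
proof -
  obtain W d where W: "open W" "y \<in> W" "W \<subseteq> U" and d: "\<And>i. smooth_on W (\<lambda>x. d x $ i)"
    "\<And>x. x \<in> W \<Longrightarrow> darboux_frame G F x (d x)" "d y = e"
    using local_darboux_field by blast
  define n where "n = (\<lambda>x. d x $ 1 + \<sigma> *\<^sub>R d x $ 2)"
  have "smooth_on W n"
    unfolding n_def by (intro smooth_on_add smooth_on_scaleR smooth_on_const W d(1))
  moreover have "n y = null \<sigma>" by (simp add: n_def d(3) null_def)
  moreover have "n x \<noteq> 0 \<and> null_normal G F \<sigma> x = span {n x} \<and> ip (G (F x)) (n x) (n x) = 0 \<and>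
      (\<forall>X. ip (G (F x)) (n x) (differential F x X) = 0)" if x: "x \<in> W" for x
  proof -
    obtain E E' where "adapted_frame V G U F J x (d x) E E'"
      using darboux_adapted[OF _ d(2)[OF x]] W x by blast
    then interpret x: adapted_frame V G U F J x "d x" E E' .
    have n: "n x = x.null \<sigma>" by (simp add: n_def x.null_def)
    note nf = x.null_frame_e[OF assms]
    have "ip (G (F x)) (x.null \<sigma>) (differential F x X) = 0" for X
      by (subst x.dF_expansion) (simp add: null_frame_ip[OF nf])
    then show ?thesis
      using null_frame_ip(1)[OF nf] null_frame_nonzero(1)[OF nf] x.null_normal_eq[OF assms]
      by (simp add: n)
  qed
  ultimately show ?thesis using W by blast
qed

end

section \<open>Holomorphicity of the twistor lifts\<close>

lemma coset_span_eq_iff: "coset (span A) \<xi> = coset (span A) \<eta> \<longleftrightarrow> \<xi> - \<eta> \<in> span A"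
proof
  assume "coset (span A) \<xi> = coset (span A) \<eta>"
  moreover have "\<xi> \<in> coset (span A) \<xi>" unfolding coset_def using span_zero[of A] by force
  ultimately obtain k where "k \<in> span A" "\<xi> = \<eta> + k" unfolding coset_def by blast
  then show "\<xi> - \<eta> \<in> span A" by simp
next
  assume *: "\<xi> - \<eta> \<in> span A"
  have "\<exists>k'\<in>span A. \<xi> + k = \<eta> + k'" if "k \<in> span A" for k
    using span_add[OF * that] by (intro bexI[of _ "\<xi> - \<eta> + k"]) auto
  moreover have "\<exists>k'\<in>span A. \<eta> + k = \<xi> + k'" if "k \<in> span A" for k
    using span_diff[OF that *] by (intro bexI[of _ "k - (\<xi> - \<eta>)"]) auto
  ultimately show "coset (span A) \<xi> = coset (span A) \<eta>" unfolding coset_def by blast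
qed

lemma mem_coset_span: "\<xi> \<in> coset (span A) \<eta> \<longleftrightarrow> \<xi> - \<eta> \<in> span A"
proof
  assume "\<xi> \<in> coset (span A) \<eta>"
  then show "\<xi> - \<eta> \<in> span A" unfolding coset_def by auto
next
  assume "\<xi> - \<eta> \<in> span A"
  then have "\<xi> = \<eta> + (\<xi> - \<eta>) \<and> \<xi> - \<eta> \<in> span A" by simp
  then show "\<xi> \<in> coset (span A) \<eta>" unfolding coset_def by blast
qed

lemma span_pair: "v \<in> span {a, b} \<longleftrightarrow> (\<exists>s t. v = s *\<^sub>R a + t *\<^sub>R b)"
proof -
  have "v - s *\<^sub>R a = t *\<^sub>R b \<longleftrightarrow> v = s *\<^sub>R a + t *\<^sub>R b" for s t
    by (auto simp: diff_eq_eq add.commute)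
  then show ?thesis by (auto simp: span_insert span_singleton)
qed

context adapted_frame
begin

abbreviation rotate :: "real^4 \<Rightarrow> real^4" where "rotate \<equiv> rot (G (F y)) e"

lemma rotate_combination: "rotate (s *\<^sub>R e $ 3 + t *\<^sub>R e $ 4) = s *\<^sub>R e $ 4 - t *\<^sub>R e $ 3"
  by (simp add: rot_def e_ip)

lemma g_zero_if_screen:
  assumes "v \<in> span {e $ 3, e $ 4}" "g v (e $ 3) = 0" "g v (e $ 4) = 0"
  shows "v = 0"
  using assms by (auto simp: span_pair e_ip)

end

text \<open>A point of the twistor lift. The Darboux frame supplies the generator \<open>e\<^sub>1 + \<sigma> e\<^sub>2\<close> of the line
  and represents the screen space, the quotient of its orthogonal complement by the line, by the
  tangent plane of the surface.\<close>

locale twistor_point = adapted_frame +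
  fixes \<sigma> :: real
  assumes \<sigma>: "\<sigma>\<^sup>2 = 1"
begin

abbreviation n :: "real^4" where "n \<equiv> null \<sigma>"
abbreviation z :: "(real^4) \<times> (real^4^4)" where "z \<equiv> (F y, line_pt n)"
abbreviation lift :: "real^4 \<Rightarrow> (real^4) \<times> (real^4^4)" where "lift \<equiv> line_hlift G (F y) n"

lemmas nf = null_frame_e[OF \<sigma>]

lemma n_nonzero: "n \<noteq> 0" by (rule null_frame_nonzero(1)[OF nf])

lemma lift_eq: "lift v = (v, line_deriv n (- christoffel G (F y) v n))"
  by (rule line_hlift_eq[OF n_nonzero])

lemma vert_eq: "line_vert n v = (0, line_deriv n v)"
  by (rule line_vert_eq[OF n_nonzero])

lemma linear_lift: "linear lift"
  unfolding lift_eq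
  by (rule linearI) (simp_all add: linear_add[OF linear_christoffel_left] linear_cmul[OF linear_christoffel_left]
      linear_add[OF linear_line_deriv] linear_diff[OF linear_line_deriv]
      linear_cmul[OF linear_line_deriv] linear_neg[OF linear_line_deriv])

lemma linear_vert: "linear (line_vert n)"
  unfolding vert_eq
  by (rule linearI) (simp_all add: linear_add[OF linear_line_deriv] linear_cmul[OF linear_line_deriv])

text \<open>Horizontal lifts do not see the generator, as the Christoffel symbols are linear in it.\<close>

lemma lift_generator:
  assumes "m \<noteq> 0" "line_pt n = line_pt m"
  shows "line_hlift G (F y) m = lift" and "\<exists>c. c \<noteq> 0 \<and> m = c *\<^sub>R n"
proof -
  show "\<exists>c. c \<noteq> 0 \<and> m = c *\<^sub>R n" using line_pt_eq[OF n_nonzero assms(1)] assms(2) by simp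
  then show "line_hlift G (F y) m = lift" using line_hlift_scale[OF n_nonzero] by (auto simp: fun_eq_iff)
qed

lemma twistor_K_eq: "twistor_K G z = span {lift n}"
proof -
  have "(\<exists>m v. \<xi> = line_hlift G (F y) m v \<and> m \<noteq> 0 \<and> line_pt n = line_pt m \<and> v \<in> span {m}) \<longleftrightarrow>
      (\<exists>k. \<xi> = lift (k *\<^sub>R n))" for \<xi>
  proof
    assume "\<exists>m v. \<xi> = line_hlift G (F y) m v \<and> m \<noteq> 0 \<and> line_pt n = line_pt m \<and> v \<in> span {m}"
    then obtain m v where m: "\<xi> = line_hlift G (F y) m v" "m \<noteq> 0" "line_pt n = line_pt m" "v \<in> span {m}"
      by blast
    obtain c where "m = c *\<^sub>R n" using lift_generator(2)[OF m(2,3)] by blast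
    with m(4) obtain k where "v = k *\<^sub>R n" by (auto simp: span_singleton)
    with m(1) show "\<exists>k. \<xi> = lift (k *\<^sub>R n)" using lift_generator(1)[OF m(2,3)] by auto
  next
    assume "\<exists>k. \<xi> = lift (k *\<^sub>R n)"
    then show "\<exists>m v. \<xi> = line_hlift G (F y) m v \<and> m \<noteq> 0 \<and> line_pt n = line_pt m \<and> v \<in> span {m}"
      using n_nonzero by (auto simp: span_singleton)
  qed
  then show ?thesis
    by (auto simp: twistor_K_def span_singleton linear_cmul[OF linear_lift] image_iff)
qed

text \<open>The vectors \<open>n + t v + (t\<^sup>2/4) g(v,v) m\<close>, where \<open>m\<close> is the opposite null vector, are null for
  all \<open>t\<close>: the last term compensates the square of \<open>t v\<close> because \<open>g(n,m) = -2\<close>. They realize \<open>V\<^sub>v\<close> as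
  a velocity inside the twistor space.\<close>

lemma vert_tangent:
  assumes "v \<in> span {e $ 3, e $ 4}"
  shows "line_vert n v \<in> vertical_vectors (twistor_space V G) z"
proof -
  define m where "m = null (- \<sigma>)"
  note nf' = nf[folded m_def]
  define c where "c = (\<lambda>t. n + t *\<^sub>R v + (t\<^sup>2 * g v v / 4) *\<^sub>R m)"
  have nv: "g n v = 0" "g m v = 0" "g v n = 0" "g v m = 0"
    using assms null_frame_ip[OF nf'] by (auto simp: span_pair)
  have "g (c t) (c t) = 0" for t
    by (simp add: c_def nv null_frame_ip[OF nf'] power2_eq_square algebra_simps)
  moreover have "g (c t) m = - 2" for t
    by (simp add: c_def nv null_frame_ip[OF nf'])
  then have "c t \<noteq> 0" for t by (metis ip_left(5) zero_neq_neg_numeral)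
  ultimately have "(F y, line_pt (c t)) \<in> twistor_space V G" for t
    unfolding twistor_space_def using F_in[OF y_in] by auto
  moreover have "(c has_vector_derivative v) (at 0)"
    unfolding c_def by (auto intro!: derivative_eq_intros)
  then have "((\<lambda>t. line_pt (c t)) has_vector_derivative line_deriv n v) (at 0)"
    by (intro line_curve_derivative n_nonzero) (simp_all add: c_def)
  then have "((\<lambda>t. (F y, line_pt (c t))) has_vector_derivative line_vert n v) (at 0)"
    unfolding vert_eq by (intro has_vector_derivative_Pair has_vector_derivative_const)
  ultimately show ?thesis
    unfolding vertical_vectors_def tangent_vectors_def
    by (auto simp: vert_eq c_def intro!: exI[of _ "\<lambda>t. (F y, line_pt (c t))"])
qed

text \<open>The factor \<open>k\<close> allows for the generator of the other frame being a multiple of \<open>n\<close>, which rescales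
  vertical vectors.\<close>

lemma rotate_modulo:
  assumes s: "SO_frame (G (F y)) s" "s $ 1 + \<sigma> *\<^sub>R s $ 2 = l *\<^sub>R n"
    and u: "u \<in> span {s $ 3, s $ 4}" "v \<in> span {e $ 3, e $ 4}" "u = k *\<^sub>R v + a *\<^sub>R n"
  shows "\<exists>b. rot (G (F y)) s u = k *\<^sub>R rotate v + b *\<^sub>R n"
proof -
  obtain p q x x' where pq: "s $ 3 = p *\<^sub>R e $ 3 + q *\<^sub>R e $ 4 + x *\<^sub>R n"
    "s $ 4 = - q *\<^sub>R e $ 3 + p *\<^sub>R e $ 4 + x' *\<^sub>R n"
    using same_null_line_rotation[OF frame s(1) \<sigma>] s(2) unfolding null_def by blast
  obtain c d where uc: "u = c *\<^sub>R s $ 3 + d *\<^sub>R s $ 4" using u(1) by (auto simp: span_pair)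
  obtain c' d' where vc: "v = c' *\<^sub>R e $ 3 + d' *\<^sub>R e $ 4" using u(2) by (auto simp: span_pair)
  have "g u (e $ 3) = k * c'" "g u (e $ 4) = k * d'"
    by (simp_all add: u(3) vc null_frame_ip[OF nf] e_ip)
  then have cd: "c * p - d * q = k * c'" "c * q + d * p = k * d'"
    by (simp_all add: uc pq null_frame_ip[OF nf] e_ip)
  have "g (s $ i) (s $ j) = (if i = j then (if i = 1 then - 1 else 1) else 0)" for i j
    using s(1) by (simp add: SO_frame_def pseudo_orthonormal_def)
  then have "rot (G (F y)) s u = c *\<^sub>R s $ 4 - d *\<^sub>R s $ 3"
    by (simp add: uc rot_def)
  also have "\<dots> = (c * p - d * q) *\<^sub>R e $ 4 - (c * q + d * p) *\<^sub>R e $ 3 + (c * x' - d * x) *\<^sub>R n"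
    by (simp add: pq algebra_simps)
  also have "\<dots> = k *\<^sub>R rotate v + (c * x' - d * x) *\<^sub>R n"
    unfolding cd vc rotate_combination by (simp add: algebra_simps)
  finally show ?thesis by blast
qed

text \<open>The definition takes a union over all frames and representatives, and is meaningful because they
  all lead to one coset. Comparing base components, another representative has the same horizontal
  vector up to a multiple of \<open>n\<close>; then the vertical parts agree, that is, their vectors agree modulo
  \<open>n\<close> after rescaling. The rotation respects both ambiguities.\<close>

lemma twistor_J_eq:
  assumes v: "v \<in> span {e $ 3, e $ 4}" and w: "w \<in> span {e $ 3, e $ 4}"
  shows "twistor_J \<sigma> \<epsilon> G z (coset (twistor_K G z) (line_vert n v + lift w)) =
    coset (twistor_K G z) (\<epsilon> *\<^sub>R line_vert n (rotate v) + lift (rotate w))" (is "_ = ?C")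
proof -
  define K where "K = span {lift n}"
  have "coset K (\<epsilon> *\<^sub>R line_vert m (rot (G (F y)) s v') + line_hlift G (F y) m (rot (G (F y)) s w')) = ?C"
    if s: "twistor_frame \<sigma> G z s" and m: "m = s $ 1 + \<sigma> *\<^sub>R s $ 2"
      and v': "v' \<in> span {s $ 3, s $ 4}" and w': "w' \<in> span {s $ 3, s $ 4}"
      and rep: "line_vert m v' + line_hlift G (F y) m w' \<in> coset K (line_vert n v + lift w)" for s m v' w'
  proof -
    have SO: "SO_frame (G (F y)) s" and line: "line_pt n = line_pt m"
      using s m by (simp_all add: twistor_frame_def)
    have m0: "m \<noteq> 0"
      using null_frame_nonzero(1)[OF null_frame_of_frame[OF _ \<sigma>]] SO m by (auto simp: SO_frame_def)
    have hl: "line_hlift G (F y) m = lift" by (rule lift_generator(1)[OF m0 line])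
    obtain l where l: "l \<noteq> 0" "m = l *\<^sub>R n" using lift_generator(2)[OF m0 line] by blast
    have vert: "line_vert m u = line_vert n (inverse l *\<^sub>R u)" for u
      using line_vert_eq[OF m0, of u] by (simp add: vert_eq l line_deriv_scale)
    obtain r where r: "line_vert m v' + lift w' - (line_vert n v + lift w) = lift (r *\<^sub>R n)"
      using rep unfolding hl K_def mem_coset_span
      by (auto simp: span_singleton linear_cmul[OF linear_lift])
    have "lift (w' - w) = lift (r *\<^sub>R n) + line_vert n (v - inverse l *\<^sub>R v')"
      using r by (simp add: vert linear_diff[OF linear_lift] linear_diff[OF linear_vert] algebra_simps)
    then have w'_eq: "w' - w = r *\<^sub>R n" by (simp add: lift_eq vert_eq)
    with r have "line_vert m v' - line_vert n v = 0"
      using linear_diff[OF linear_lift, of w' w] by (simp add: algebra_simps)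
    then have "line_vert n (inverse l *\<^sub>R v' - v) = 0"
      by (simp add: vert linear_diff[OF linear_vert])
    then obtain c where "inverse l *\<^sub>R v' - v = c *\<^sub>R n"
      using line_deriv_eq_0_iff[OF n_nonzero] by (auto simp: vert_eq zero_prod_def)
    then have "l *\<^sub>R (inverse l *\<^sub>R v') = l *\<^sub>R (v + c *\<^sub>R n)" by (simp add: algebra_simps)
    then have v'_eq: "v' = l *\<^sub>R v + (l * c) *\<^sub>R n" using l by (simp add: algebra_simps)
    obtain b where b: "rot (G (F y)) s v' = l *\<^sub>R rotate v + b *\<^sub>R n"
      using rotate_modulo[OF SO _ v' v v'_eq] l m by metis
    have w'_eq': "w' = 1 *\<^sub>R w + r *\<^sub>R n" using w'_eq by (simp add: algebra_simps)
    obtain b' where b': "rot (G (F y)) s w' = 1 *\<^sub>R rotate w + b' *\<^sub>R n"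
      using rotate_modulo[OF SO _ w' w w'_eq'] l m by metis
    have "line_vert m (rot (G (F y)) s v') = line_vert n (rotate v) + line_vert n ((inverse l * b) *\<^sub>R n)"
      unfolding vert b using l by (simp add: linear_add[OF linear_vert] algebra_simps)
    moreover have "line_vert n (k *\<^sub>R n) = 0" for k
      using line_deriv_eq_0_iff[OF n_nonzero] by (auto simp: vert_eq zero_prod_def)
    moreover have "lift (rot (G (F y)) s w') = lift (rotate w) + b' *\<^sub>R lift n"
      unfolding b' by (simp add: linear_add[OF linear_lift] linear_cmul[OF linear_lift])
    ultimately show ?thesis
      unfolding twistor_K_eq K_def coset_span_eq_iff hl by (simp add: span_base span_scale)
  qed
  note unique = this
  define S where "S = {coset K (\<epsilon> *\<^sub>R line_vert m (rot (G (F y)) s v') + line_hlift G (F y) m (rot (G (F y)) s w')) | s m v' w'.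
    twistor_frame \<sigma> G z s \<and> m = s $ 1 + \<sigma> *\<^sub>R s $ 2 \<and> v' \<in> span {s $ 3, s $ 4} \<and>
    w' \<in> span {s $ 3, s $ 4} \<and> line_vert m v' + line_hlift G (F y) m w' \<in> coset K (line_vert n v + lift w)}"
  have "twistor_frame \<sigma> G z e" using frame by (simp add: twistor_frame_def null_def)
  moreover have "line_vert n v + lift w \<in> coset K (line_vert n v + lift w)"
    unfolding K_def mem_coset_span by (simp add: span_zero)
  ultimately have "coset K (\<epsilon> *\<^sub>R line_vert n (rotate v) + lift (rotate w)) \<in> S"
    unfolding S_def using v w null_def[of \<sigma>] by blast
  then have "?C \<in> S" by (simp add: K_def twistor_K_eq)
  moreover have "x = ?C" if "x \<in> S" for x
    using that unique unfolding S_def by blast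
  ultimately have "S = {?C}" by blast
  moreover have "twistor_J \<sigma> \<epsilon> G z (coset (twistor_K G z) (line_vert n v + lift w)) = \<Union> S"
    unfolding twistor_J_def S_def K_def twistor_K_eq fst_conv ..
  ultimately show ?thesis by simp
qed

text \<open>The tangential part of the covariant derivative of a null normal field through \<open>n\<close>, that is,
  minus the shape operator in direction \<open>n\<close>.\<close>

definition shape :: "real^2 \<Rightarrow> real^4" where
  "shape X = - g n (hess y X E3) *\<^sub>R e $ 3 - g n (hess y X E4) *\<^sub>R e $ 4"

lemma shape_screen: "shape X \<in> span {e $ 3, e $ 4}"
  unfolding shape_def span_pair by (intro exI[of _ "- g n (hess y X E3)"] exI[of _ "- g n (hess y X E4)"]) simp

lemma screen_dF: "dF X \<in> span {e $ 3, e $ 4}"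
  unfolding span_pair using dF_expansion[of X] by blast

lemma twistor_lift_eq:
  assumes "m \<noteq> 0" "null_normal G F \<sigma> x = span {m}"
  shows "twistor_lift \<sigma> G F x = (F x, line_pt m)"
proof -
  have "(THE P. \<exists>n. n \<noteq> 0 \<and> span {m} = span {n} \<and> P = line_pt n) = line_pt m"
  proof (rule the_equality)
    fix P assume "\<exists>n. n \<noteq> 0 \<and> span {m} = span {n} \<and> P = line_pt n"
    then obtain n where n: "n \<noteq> 0" "span {m} = span {n}" "P = line_pt n" by blast
    then have "n \<in> span {m}" by (simp add: span_base)
    then obtain c where "n = c *\<^sub>R m" by (auto simp: span_singleton)
    then show "P = line_pt m" using n line_pt_scale by force
  qed (use assms in blast)
  then show ?thesis by (simp add: twistor_lift_def assms(2))
qed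

text \<open>Let \<open>N\<close> be a smooth null normal field through \<open>n\<close> and \<open>c\<close> its covariant derivative. Since \<open>N\<close> stays
  null and normal, \<open>c\<close> is orthogonal to \<open>n\<close> and its inner products with tangent vectors are given by
  the Hessian; so \<open>c\<close> is \<open>shape X\<close> modulo \<open>n\<close>. The horizontal lift is the velocity for \<open>c = 0\<close>.\<close>

lemma twistor_lift_derivative:
  shows "\<exists>W. open W \<and> y \<in> W \<and> smooth_on W (twistor_lift \<sigma> G F)"
    and "twistor_lift \<sigma> G F y = z"
    and "differential (twistor_lift \<sigma> G F) y X = line_vert n (shape X) + lift (dF X)"
proof -
  obtain W N where W: "open W" "y \<in> W" "W \<subseteq> U" and N: "smooth_on W N" "N y = n"
    and N': "\<And>x. x \<in> W \<Longrightarrow> N x \<noteq> 0" "\<And>x. x \<in> W \<Longrightarrow> null_normal G F \<sigma> x = span {N x}"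
      "\<And>x. x \<in> W \<Longrightarrow> ip (G (F x)) (N x) (N x) = 0"
      "\<And>x X. x \<in> W \<Longrightarrow> ip (G (F x)) (N x) (differential F x X) = 0"
    using local_null_field[OF \<sigma>] by (metis (no_types, lifting))
  have eq: "twistor_lift \<sigma> G F x = (F x, line_pt (N x))" if "x \<in> W" for x
    using that by (intro twistor_lift_eq N')
  have "smooth_on W (\<lambda>x. (F x, line_pt (N x)))"
    by (intro smooth_on_Pair smooth_on_line_pt W N N' smooth_on_subset[OF smooth_F])
  then have "smooth_on W (twistor_lift \<sigma> G F)"
    by (rule smooth_on_cong[OF W(1), rotated]) (simp add: eq)
  then show "\<exists>W. open W \<and> y \<in> W \<and> smooth_on W (twistor_lift \<sigma> G F)" using W by blast
  show "twistor_lift \<sigma> G F y = z" using eq[OF W(2)] N(2) by simp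
  have DN: "(N has_derivative differential N y) (at y)" by (rule smooth_on_has_derivative[OF N(1) W(2)])
  then have dN: "N differentiable at y" by (auto simp: differentiable_def)
  have "((\<lambda>x. (F x, line_pt (N x))) has_derivative (\<lambda>X. (dF X, line_deriv n (differential N y X)))) (at y)"
    by (intro has_derivative_Pair F_deriv y_in has_derivative_compose[OF DN])
      (simp add: N(2) line_pt_has_derivative n_nonzero)
  then have "(twistor_lift \<sigma> G F has_derivative (\<lambda>X. (dF X, line_deriv n (differential N y X)))) (at y)"
    by (rule has_derivative_transform_within_open[OF _ W(1,2)]) (simp add: eq)
  from fun_cong[OF frechet_derivative_at[OF this], of X]
  have D: "differential (twistor_lift \<sigma> G F) y X = (dF X, line_deriv n (differential N y X))" by simp
  define c where "c = cov_deriv G F N y X"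
  have "g c n = 0"
    using cov_deriv_ip_zero[OF y_in W(1,2) dN dN N'(3), of X] by (simp add: c_def N(2) sym_g)
  moreover have "g c (dF Y) = - g n (hess y X Y)" for Y
    using cov_deriv_ip_zero[OF y_in W(1,2) dN differentiable_dF[OF y_in] N'(4), of X Y]
    by (simp add: c_def N(2))
  ultimately have gc: "g c n = 0" "g c (e $ 3) = - g n (hess y X E3)" "g c (e $ 4) = - g n (hess y X E4)"
    by (simp_all add: e34)
  note null_frame_expansion[OF nf, of c]
  also have "(- g c (null (- \<sigma>)) / 2) *\<^sub>R n + (- g c n / 2) *\<^sub>R null (- \<sigma>) + g c (e $ 3) *\<^sub>R e $ 3
      + g c (e $ 4) *\<^sub>R e $ 4 = (- g c (null (- \<sigma>)) / 2) *\<^sub>R n + shape X"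
    by (simp add: gc shape_def)
  finally have "line_deriv n c = line_deriv n (shape X)"
    using line_deriv_eq_0_iff[OF n_nonzero, of "(- g c (null (- \<sigma>)) / 2) *\<^sub>R n"]
    by (metis add_0 linear_add[OF linear_line_deriv])
  moreover have "c = differential N y X + christoffel G (F y) (dF X) n"
    by (simp add: c_def cov_deriv_def N(2))
  ultimately have "line_deriv n (differential N y X) = line_deriv n (shape X) + line_deriv n (- christoffel G (F y) (dF X) n)"
    by (simp add: linear_add[OF linear_line_deriv] linear_neg[OF linear_line_deriv] eq_diff_eq)
  then show "differential (twistor_lift \<sigma> G F) y X = line_vert n (shape X) + lift (dF X)"
    by (simp add: D vert_eq lift_eq)
qed

lemma vert_eq_0_iff: "v \<in> span {e $ 3, e $ 4} \<Longrightarrow> line_vert n v = 0 \<longleftrightarrow> v = 0"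
  using line_deriv_eq_0_iff[OF n_nonzero] null_frame_ip[OF nf]
  by (auto simp: vert_eq zero_prod_def linear_0[OF linear_line_deriv] intro!: g_zero_if_screen)

lemma shape_simps: "shape (X + X') = shape X + shape X'" "shape (c *\<^sub>R X) = c *\<^sub>R shape X" "shape (- X) = - shape X"
  by (simp_all add: shape_def hess_simps algebra_simps)

lemma rotate_screen: "v \<in> span {e $ 3, e $ 4} \<Longrightarrow> rotate v \<in> span {e $ 3, e $ 4}"
  unfolding rot_def span_pair
  by (intro exI[of _ "- g v (e $ 4)"] exI[of _ "g v (e $ 3)"]) simp

text \<open>The first two conditions hold for every immersion: tangent vectors are orthogonal to \<open>n\<close>, and a
  spacelike vector is no multiple of a null vector. The horizontal part of the third one holds by
  conformality, which leaves its vertical part.\<close>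

lemma holomorphic_at_twistor_iff:
  "holomorphic_at (twistor_K G z) (twistor_L V G z) (twistor_J \<sigma> \<epsilon> G z) ((*v) (J y))
    (differential (twistor_lift \<sigma> G F) y) \<longleftrightarrow> (\<forall>X. shape (J y *v X) = \<epsilon> *\<^sub>R rotate (shape X))"
proof -
  define d where "d = differential (twistor_lift \<sigma> G F) y"
  have d: "d X = line_vert n (shape X) + lift (dF X)" for X
    unfolding d_def by (rule twistor_lift_derivative(3))
  have "d X \<in> twistor_L V G z" for X
  proof -
    have "g n (dF X) = 0" by (subst dF_expansion) (simp add: null_frame_ip[OF nf])
    then show ?thesis
      unfolding d twistor_L_def using vert_tangent[OF shape_screen] n_nonzero by fastforce
  qed
  then have L: "range d \<subseteq> twistor_L V G z" by blast
  have K: "range d \<inter> twistor_K G z = {0}"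
  proof -
    have "d X = 0" if "d X \<in> span {lift n}" for X
    proof -
      obtain k where "d X = lift (k *\<^sub>R n)"
        using \<open>d X \<in> span {lift n}\<close> by (auto simp: span_singleton linear_cmul[OF linear_lift])
      then have "dF X = k *\<^sub>R n" by (simp add: d vert_eq lift_eq)
      then have "g (dF X) (dF X) = 0" by (simp add: null_frame_ip[OF nf])
      then have "X = 0" using spacelike[OF y_in, of X] by (metis less_irrefl)
      then show "d X = 0"
        by (simp add: d dF_simps linear_0[OF linear_lift] shape_def linear_0[OF linear_hess_left[OF y_in]]
            linear_0[OF linear_vert])
    qed
    moreover have "d 0 = 0"
      by (simp add: d dF_simps linear_0[OF linear_lift] shape_def linear_0[OF linear_hess_left[OF y_in]]
          linear_0[OF linear_vert])
    then have "0 \<in> range d" by (metis rangeI)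
    ultimately show ?thesis unfolding twistor_K_eq using span_zero[of "{lift n}"] by blast
  qed
  have J: "coset (twistor_K G z) (d (J y *v X)) = twistor_J \<sigma> \<epsilon> G z (coset (twistor_K G z) (d X)) \<longleftrightarrow>
      shape (J y *v X) = \<epsilon> *\<^sub>R rotate (shape X)" for X
  proof -
    define u where "u = shape (J y *v X) - \<epsilon> *\<^sub>R rotate (shape X)"
    have u: "u \<in> span {e $ 3, e $ 4}"
      unfolding u_def by (intro span_diff span_scale rotate_screen shape_screen)
    have "coset (twistor_K G z) (d (J y *v X)) = twistor_J \<sigma> \<epsilon> G z (coset (twistor_K G z) (d X)) \<longleftrightarrow>
        line_vert n u \<in> span {lift n}"
      unfolding d[of X] twistor_J_eq[OF shape_screen screen_dF] unfolding twistor_K_eq coset_span_eq_iff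
      by (simp add: d dF_J u_def linear_diff[OF linear_vert] linear_cmul[OF linear_vert])
    also have "\<dots> \<longleftrightarrow> line_vert n u = 0"
    proof
      assume "line_vert n u \<in> span {lift n}"
      then obtain k where "line_vert n u = lift (k *\<^sub>R n)" by (auto simp: span_singleton linear_cmul[OF linear_lift])
      then show "line_vert n u = 0"
        using n_nonzero by (auto simp: vert_eq lift_eq linear_0[OF linear_christoffel_left] linear_0[OF linear_line_deriv] zero_prod_def)
    qed (simp add: span_zero)
    also have "\<dots> \<longleftrightarrow> u = 0" by (rule vert_eq_0_iff[OF u])
    finally show ?thesis by (simp add: u_def)
  qed
  show ?thesis
    unfolding holomorphic_at_def d_def[symmetric] using L K J by simp
qed

lemma horizontal_iff:
  "range (differential (twistor_lift \<sigma> G F) y) \<subseteq> twistor_horizontal G z \<longleftrightarrow> (\<forall>X. shape X = 0)"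
proof -
  have "twistor_horizontal G z = range lift"
  proof (intro equalityI subsetI)
    fix \<xi> assume "\<xi> \<in> twistor_horizontal G z"
    then obtain m v where "\<xi> = line_hlift G (F y) m v" "m \<noteq> 0" "line_pt n = line_pt m"
      by (auto simp: twistor_horizontal_def)
    then show "\<xi> \<in> range lift" using lift_generator(1) by auto
  next
    fix \<xi> assume "\<xi> \<in> range lift"
    then show "\<xi> \<in> twistor_horizontal G z" using n_nonzero by (auto simp: twistor_horizontal_def)
  qed
  moreover have "line_vert n (shape X) + lift (dF X) \<in> range lift \<longleftrightarrow> shape X = 0" for X
  proof
    assume "line_vert n (shape X) + lift (dF X) \<in> range lift"
    then obtain v where v: "line_vert n (shape X) + lift (dF X) = lift v" by blast
    then have "dF X = v" by (simp add: vert_eq lift_eq)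
    with v have "line_vert n (shape X) = 0" by simp
    then show "shape X = 0" using vert_eq_0_iff[OF shape_screen] by simp
  qed (simp add: linear_0[OF linear_vert])
  ultimately show ?thesis by (simp add: twistor_lift_derivative(3) image_subset_iff)
qed

lemma screen_eq_iff:
  assumes "u \<in> span {e $ 3, e $ 4}" "v \<in> span {e $ 3, e $ 4}"
  shows "u = v \<longleftrightarrow> g u (e $ 3) = g v (e $ 3) \<and> g u (e $ 4) = g v (e $ 4)"
  using g_zero_if_screen[OF span_diff[OF assms]] by auto

lemma shape_rotation_iff:
  "(\<forall>X. shape (J y *v X) = \<epsilon> *\<^sub>R rotate (shape X)) \<longleftrightarrow>
    shape E4 = \<epsilon> *\<^sub>R rotate (shape E3) \<and> - shape E3 = \<epsilon> *\<^sub>R rotate (shape E4)" (is "_ \<longleftrightarrow> ?R")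
proof
  assume "\<forall>X. shape (J y *v X) = \<epsilon> *\<^sub>R rotate (shape X)"
  from this[rule_format, of E3] this[rule_format, of E4] show ?R by (simp add: J_E shape_simps)
next
  assume R: ?R
  show "\<forall>X. shape (J y *v X) = \<epsilon> *\<^sub>R rotate (shape X)"
  proof
    fix X
    obtain p q where X: "X = p *\<^sub>R E3 + q *\<^sub>R E4" using pos_basis_expansion[OF pos_E] by blast
    have "shape (J y *v X) = p *\<^sub>R shape E4 + q *\<^sub>R (- shape E3)"
      by (simp add: X matrix_vector_right_distrib matrix_vector_mult_scaleR J_E shape_simps flip: scaleR_minus_right)
    also have "\<dots> = \<epsilon> *\<^sub>R (p *\<^sub>R rotate (shape E3) + q *\<^sub>R rotate (shape E4))"
      using R by (simp add: algebra_simps)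
    also have "p *\<^sub>R rotate (shape E3) + q *\<^sub>R rotate (shape E4) = rotate (shape X)"
      by (simp add: X shape_simps rot_def algebra_simps)
    finally show "shape (J y *v X) = \<epsilon> *\<^sub>R rotate (shape X)" .
  qed
qed

lemma shape_components:
  "g (shape X) (e $ 3) = - g n (hess y X E3)" "g (shape X) (e $ 4) = - g n (hess y X E4)"
  "g (rotate v) (e $ 3) = - g v (e $ 4)" "g (rotate v) (e $ 4) = g v (e $ 3)"
  by (simp_all add: shape_def rot_def e_ip)

text \<open>For the symmetric matrix \<open>a\<close> of the Hessian paired with \<open>n\<close>, commuting with the rotation
  (\<open>\<epsilon> = 1\<close>) means to be a multiple of the identity, and anticommuting (\<open>\<epsilon> = -1\<close>) means to be free of
  trace.\<close>

lemma shape_rotation_iff':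
  "(\<forall>X. shape (J y *v X) = \<epsilon> *\<^sub>R rotate (shape X)) \<longleftrightarrow>
    g n (hess y E3 E4) = - \<epsilon> * g n (hess y E3 E4) \<and> g n (hess y E4 E4) = \<epsilon> * g n (hess y E3 E3) \<and>
    g n (hess y E3 E3) = \<epsilon> * g n (hess y E4 E4)"
  unfolding shape_rotation_iff
  by (auto simp: screen_eq_iff shape_screen rotate_screen span_scale span_neg shape_components
      hess_sym[OF y_in, of E4 E3])

lemma holomorphic_minus_iff:
  "(\<forall>X. shape (J y *v X) = (- 1) *\<^sub>R rotate (shape X)) \<longleftrightarrow> H_pm G F (- \<sigma>) y = 0"
  unfolding shape_rotation_iff' H_pm_eq_0_iff[OF \<sigma>] by auto

lemma holomorphic_plus_iff:
  "(\<forall>X. shape (J y *v X) = 1 *\<^sub>R rotate (shape X)) \<longleftrightarrow> (\<forall>X Y. L_pm G F (- \<sigma>) y X Y = 0)"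
  unfolding shape_rotation_iff' L_pm_eq_0_iff[OF \<sigma>] by auto

lemma shape_zero_iff:
  "(\<forall>X. shape X = 0) \<longleftrightarrow> H_pm G F (- \<sigma>) y = 0 \<and> (\<forall>X Y. L_pm G F (- \<sigma>) y X Y = 0)"
proof -
  have "(\<forall>X. shape X = 0) \<longleftrightarrow> shape E3 = 0 \<and> shape E4 = 0"
  proof
    assume R: "shape E3 = 0 \<and> shape E4 = 0"
    have "shape X = 0" for X
    proof -
      obtain p q where X: "X = p *\<^sub>R E3 + q *\<^sub>R E4" using pos_basis_expansion[OF pos_E] by blast
      show ?thesis using R by (simp add: X shape_simps)
    qed
    then show "\<forall>X. shape X = 0" ..
  qed simp
  also have "\<dots> \<longleftrightarrow> g n (hess y E3 E3) = 0 \<and> g n (hess y E3 E4) = 0 \<and> g n (hess y E4 E4) = 0"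
    by (auto simp: screen_eq_iff[OF shape_screen span_zero] shape_components hess_sym[OF y_in, of E4 E3])
  finally show ?thesis
    unfolding H_pm_eq_0_iff[OF \<sigma>] L_pm_eq_0_iff[OF \<sigma>] by auto
qed

end

section \<open>Holomorphicity of the Grassmannian lift\<close>

lemma plane_pt_combination:
  assumes "p * t - q * r > 0"
  shows "plane_pt (p *\<^sub>R u + q *\<^sub>R v) (r *\<^sub>R u + t *\<^sub>R v) = plane_pt u v"
  using assms unfolding plane_pt_wedge wedge_linear_combination by simp

context adapted_frame
begin

abbreviation plane :: "(real^4) \<times> (real^4^4)" where "plane \<equiv> (F y, plane_pt (e $ 3) (e $ 4))"
abbreviation plane_lift :: "real^4 \<Rightarrow> (real^4) \<times> (real^4^4)" where "plane_lift \<equiv> plane_hlift G (F y) e"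

lemma wedge_e_nonzero: "wedge (e $ 3) (e $ 4) \<noteq> 0"
proof
  assume "wedge (e $ 3) (e $ 4) = 0"
  with wedge_contract[of "e $ 3" "e $ 4" "G (F y)" "e $ 4"] have "e $ 3 = 0" by (simp add: e_ip)
  then show False using e_ip[of 3 3] by simp
qed

lemmas plane_lift_eq = plane_hlift_eq[where s = e, OF wedge_e_nonzero]
lemmas plane_vert_e_eq = plane_vert_eq[where s = e, OF wedge_e_nonzero]

lemma linear_plane_lift: "linear plane_lift"
proof (rule linearI)
  note L = linear_add[OF linear_christoffel_left] linear_cmul[OF linear_christoffel_left]
  show "plane_lift (v + w) = plane_lift v + plane_lift w" for v w
    by (simp add: plane_lift_eq L flip: plane_deriv_add)
  show "plane_lift (c *\<^sub>R v) = c *\<^sub>R plane_lift v" for c v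
    by (simp add: plane_lift_eq L flip: plane_deriv_scale)
qed

text \<open>Moving the spanning vectors within the plane only rescales the bivector.\<close>

lemma plane_deriv_tangential:
  "plane_deriv (e $ 3) (e $ 4) (a *\<^sub>R e $ 3 + b *\<^sub>R e $ 4) (c *\<^sub>R e $ 3 + d *\<^sub>R e $ 4) = 0"
  unfolding plane_deriv_eq_0_iff[OF wedge_e_nonzero]
  by (intro exI[of _ "a + d"]) (simp add: wedge_simps scaleR_add_left)

text \<open>Together with the previous lemma, this identifies vertical vectors with homomorphisms from the plane
  to its orthogonal complement. Contraction with \<open>e\<^sub>4\<close> shows that \<open>a\<close> is a multiple of \<open>e\<^sub>3\<close>, and \<open>a\<close>
  is normal; likewise for \<open>b\<close>.\<close>

lemma plane_deriv_normal_eq_0: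
  assumes "plane_deriv (e $ 3) (e $ 4) a b = 0"
    and "g a (e $ 3) = 0" "g a (e $ 4) = 0" "g b (e $ 3) = 0" "g b (e $ 4) = 0"
  shows "a = 0" "b = 0"
proof -
  obtain c where c: "wedge a (e $ 4) + wedge (e $ 3) b = c *\<^sub>R wedge (e $ 3) (e $ 4)"
    using assms(1) plane_deriv_eq_0_iff[OF wedge_e_nonzero] by blast
  have "(wedge a (e $ 4) + wedge (e $ 3) b) *v (G (F y) *v w) = (c *\<^sub>R wedge (e $ 3) (e $ 4)) *v (G (F y) *v w)" for w
    by (simp add: c)
  then have *: "g (e $ 4) w *\<^sub>R a - g a w *\<^sub>R e $ 4 + (g b w *\<^sub>R e $ 3 - g (e $ 3) w *\<^sub>R b) =
      c *\<^sub>R (g (e $ 4) w *\<^sub>R e $ 3 - g (e $ 3) w *\<^sub>R e $ 4)" for w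
    by (simp add: matrix_vector_mult_add_rdistrib scaleR_mult_vec wedge_contract)
  have a: "a = c *\<^sub>R e $ 3" using *[of "e $ 4"] assms by (simp add: e_ip)
  then have "c = 0" using assms(2) by (simp add: e_ip)
  then show "a = 0" using a by simp
  show "b = 0" using *[of "e $ 3"] assms \<open>c = 0\<close> by (simp add: e_ip)
qed

text \<open>The bivectors of both frames are positive multiples of each other. Contracting them with \<open>s\<^sub>4\<close> and
  \<open>s\<^sub>3\<close> expresses these vectors in terms of \<open>e\<^sub>3\<close> and \<open>e\<^sub>4\<close>, and the factor is the determinant of the
  change of basis.\<close>

lemma grass_frame_rotation:
  assumes "grass_frame G plane s"
  shows "\<exists>p q l. s $ 3 = p *\<^sub>R e $ 3 + q *\<^sub>R e $ 4 \<and> s $ 4 = - q *\<^sub>R e $ 3 + p *\<^sub>R e $ 4 \<and>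
    p * p + q * q = 1 \<and> l \<noteq> 0 \<and> s $ 1 + s $ 2 = l *\<^sub>R null 1"
proof -
  have SO: "SO_frame (G (F y)) s" and pt: "plane_pt (e $ 3) (e $ 4) = plane_pt (s $ 3) (s $ 4)"
    using assms by (simp_all add: grass_frame_def)
  have s_ip: "g (s $ i) (s $ j) = (if i = j then (if i = 1 then - 1 else 1) else 0)" for i j
    using SO by (simp add: SO_frame_def pseudo_orthonormal_def)
  have nz: "wedge (s $ 3) (s $ 4) \<noteq> 0"
  proof
    assume "wedge (s $ 3) (s $ 4) = 0"
    with wedge_contract[of "s $ 3" "s $ 4" "G (F y)" "s $ 4"] have "s $ 3 = 0" by (simp add: s_ip)
    then show False using s_ip[of 3 3] by simp
  qed
  define k where "k = norm (wedge (s $ 3) (s $ 4)) / norm (wedge (e $ 3) (e $ 4))"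
  have k: "k > 0" using nz wedge_e_nonzero by (simp add: k_def)
  have "wedge (s $ 3) (s $ 4) = norm (wedge (s $ 3) (s $ 4)) *\<^sub>R plane_pt (s $ 3) (s $ 4)"
    using nz by (simp add: plane_pt_wedge)
  then have w: "wedge (s $ 3) (s $ 4) = k *\<^sub>R wedge (e $ 3) (e $ 4)"
    unfolding pt[symmetric] by (simp add: plane_pt_wedge k_def divide_inverse)
  have *: "g (s $ 4) u *\<^sub>R s $ 3 - g (s $ 3) u *\<^sub>R s $ 4 = k *\<^sub>R (g (e $ 4) u *\<^sub>R e $ 3 - g (e $ 3) u *\<^sub>R e $ 4)" for u
    using arg_cong[OF w, of "\<lambda>A. A *v (G (F y) *v u)"] by (simp add: wedge_contract scaleR_mult_vec)
  define p q r t where "p = k * g (e $ 4) (s $ 4)" and "q = - k * g (e $ 3) (s $ 4)"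
    and "r = - k * g (e $ 4) (s $ 3)" and "t = k * g (e $ 3) (s $ 3)"
  have 3: "s $ 3 = p *\<^sub>R e $ 3 + q *\<^sub>R e $ 4"
    using *[of "s $ 4"] by (simp add: s_ip p_def q_def algebra_simps)
  have "- s $ 4 = - (r *\<^sub>R e $ 3 + t *\<^sub>R e $ 4)"
    using *[of "s $ 3"] by (simp add: s_ip r_def t_def algebra_simps)
  then have 4: "s $ 4 = r *\<^sub>R e $ 3 + t *\<^sub>R e $ 4" by (simp only: neg_equal_iff_equal)
  have "(p * t - q * r) *\<^sub>R wedge (e $ 3) (e $ 4) = k *\<^sub>R wedge (e $ 3) (e $ 4)"
    using w by (simp add: 3 4 wedge_linear_combination)
  then have pos: "p * t - q * r > 0" using wedge_e_nonzero k by simp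
  note R = same_plane_null_line[OF frame SO _ 3 4 pos]
  have "t = p" "r = - q" "p * p + q * q = 1" using R(2-4)[of 1] by simp_all
  moreover obtain l where "l \<noteq> 0" "s $ 1 + s $ 2 = l *\<^sub>R null 1"
    using R(1)[of 1] by (auto simp: null_def)
  ultimately show ?thesis using 3 4 by auto
qed

text \<open>Rotating the two spanning vectors leaves the bivector unchanged, also after a linear motion of the
  plane, and commutes with the rotation of the plane. The null vector is only rescaled.\<close>

lemma grass_frame_invariance:
  assumes s: "grass_frame G plane s"
  shows "plane_hlift G (F y) s = plane_lift"
    and "linear b \<Longrightarrow> plane_vert s b = plane_vert e b"
    and "rot (G (F y)) s = rotate"
    and "span {s $ 3, s $ 4} = span {e $ 3, e $ 4}"
    and "span {s $ 1 + s $ 2} = span {null 1}"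
proof -
  obtain p q l where 3: "s $ 3 = p *\<^sub>R e $ 3 + q *\<^sub>R e $ 4" and 4: "s $ 4 = - q *\<^sub>R e $ 3 + p *\<^sub>R e $ 4"
    and pq: "p * p + q * q = 1" and l: "l \<noteq> 0" "s $ 1 + s $ 2 = l *\<^sub>R null 1"
    using grass_frame_rotation[OF s] by blast
  have i3: "e $ 3 = p *\<^sub>R s $ 3 + (- q) *\<^sub>R s $ 4" and i4: "e $ 4 = q *\<^sub>R s $ 3 + p *\<^sub>R s $ 4"
  proof -
    have "p *\<^sub>R s $ 3 + (- q) *\<^sub>R s $ 4 = (p * p + q * q) *\<^sub>R e $ 3"
      "q *\<^sub>R s $ 3 + p *\<^sub>R s $ 4 = (p * p + q * q) *\<^sub>R e $ 4"
      by (simp_all add: 3 4 algebra_simps)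
    then show "e $ 3 = p *\<^sub>R s $ 3 + (- q) *\<^sub>R s $ 4" "e $ 4 = q *\<^sub>R s $ 3 + p *\<^sub>R s $ 4"
      by (simp_all add: pq)
  qed
  have "plane_pt (s $ 3 - t *\<^sub>R christoffel G (F y) v (s $ 3)) (s $ 4 - t *\<^sub>R christoffel G (F y) v (s $ 4)) =
      plane_pt (e $ 3 - t *\<^sub>R christoffel G (F y) v (e $ 3)) (e $ 4 - t *\<^sub>R christoffel G (F y) v (e $ 4))" for t v
  proof -
    note L = linear_add[OF linear_christoffel_right] linear_diff[OF linear_christoffel_right]
      linear_cmul[OF linear_christoffel_right]
    have "s $ 3 - t *\<^sub>R christoffel G (F y) v (s $ 3) =
        p *\<^sub>R (e $ 3 - t *\<^sub>R christoffel G (F y) v (e $ 3)) + q *\<^sub>R (e $ 4 - t *\<^sub>R christoffel G (F y) v (e $ 4))"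
      "s $ 4 - t *\<^sub>R christoffel G (F y) v (s $ 4) =
        - q *\<^sub>R (e $ 3 - t *\<^sub>R christoffel G (F y) v (e $ 3)) + p *\<^sub>R (e $ 4 - t *\<^sub>R christoffel G (F y) v (e $ 4))"
      by (simp_all add: 3 4 L algebra_simps)
    then show ?thesis by (simp only: plane_pt_rotate[OF pq])
  qed
  then show "plane_hlift G (F y) s = plane_lift" by (simp add: plane_hlift_def fun_eq_iff)
  show "plane_vert s b = plane_vert e b" if "linear b"
  proof -
    have "plane_pt (s $ 3 + t *\<^sub>R b (s $ 3)) (s $ 4 + t *\<^sub>R b (s $ 4)) =
      plane_pt (e $ 3 + t *\<^sub>R b (e $ 3)) (e $ 4 + t *\<^sub>R b (e $ 4))" for t
    proof -
      have "s $ 3 + t *\<^sub>R b (s $ 3) = p *\<^sub>R (e $ 3 + t *\<^sub>R b (e $ 3)) + q *\<^sub>R (e $ 4 + t *\<^sub>R b (e $ 4))"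
        "s $ 4 + t *\<^sub>R b (s $ 4) = - q *\<^sub>R (e $ 3 + t *\<^sub>R b (e $ 3)) + p *\<^sub>R (e $ 4 + t *\<^sub>R b (e $ 4))"
        by (simp_all add: 3 4 linear_add[OF that] linear_diff[OF that] linear_cmul[OF that] algebra_simps)
      then show ?thesis by (simp only: plane_pt_rotate[OF pq])
    qed
    then show ?thesis by (simp add: plane_vert_def)
  qed
  have "rot (G (F y)) s u = rotate u" for u
  proof -
    have "rot (G (F y)) s u = ((p * p + q * q) * g u (e $ 3)) *\<^sub>R e $ 4 - ((p * p + q * q) * g u (e $ 4)) *\<^sub>R e $ 3"
      by (simp add: rot_def 3 4 algebra_simps)
    then show ?thesis by (simp add: pq rot_def)
  qed
  then show "rot (G (F y)) s = rotate" by blast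
  have in1: "s $ 3 \<in> span {e $ 3, e $ 4}" "s $ 4 \<in> span {e $ 3, e $ 4}"
    unfolding 3 4 by (intro span_add span_scale span_base; simp)+
  have in2: "e $ 3 \<in> span {s $ 3, s $ 4}" "e $ 4 \<in> span {s $ 3, s $ 4}"
    by (subst i3 i4, intro span_add span_scale span_base; simp)+
  show "span {s $ 3, s $ 4} = span {e $ 3, e $ 4}"
    using in1 in2 by (intro equalityI span_minimal subspace_span) auto
  have "null 1 = (1 / l) *\<^sub>R (s $ 1 + s $ 2)" using l by simp
  then have "null 1 \<in> span {s $ 1 + s $ 2}" by (metis span_base span_scale singletonI)
  moreover have "s $ 1 + s $ 2 \<in> span {null 1}" using l by (metis span_base span_scale singletonI)
  ultimately show "span {s $ 1 + s $ 2} = span {null 1}"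
    by (intro equalityI span_minimal subspace_span) auto
qed

lemma grass_frame_e: "grass_frame G plane e"
  using frame by (simp add: grass_frame_def)

lemma grass_K_eq: "grass_K G plane = span {plane_lift (null 1)}"
proof (intro equalityI subsetI)
  fix \<xi> assume "\<xi> \<in> grass_K G plane"
  then obtain s v where "\<xi> = plane_hlift G (F y) s v" "grass_frame G plane s" "v \<in> span {s $ 1 + s $ 2}"
    by (auto simp: grass_K_def)
  then have "\<xi> = plane_lift v" "v \<in> span {null 1}"
    by (simp_all add: grass_frame_invariance(1,5))
  then show "\<xi> \<in> span {plane_lift (null 1)}"
    by (auto simp: span_singleton linear_cmul[OF linear_plane_lift])
next
  fix \<xi> assume "\<xi> \<in> span {plane_lift (null 1)}"
  then obtain k where "\<xi> = plane_lift (k *\<^sub>R null 1)"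
    by (auto simp: span_singleton linear_cmul[OF linear_plane_lift])
  moreover have "k *\<^sub>R null 1 \<in> span {e $ 1 + e $ 2}" by (simp add: null_def span_base span_scale)
  ultimately show "\<xi> \<in> grass_K G plane" using grass_frame_e by (auto simp: grass_K_def)
qed

text \<open>The planes spanned by \<open>e\<^sub>3 + t b(e\<^sub>3)\<close> and \<open>e\<^sub>4 + t b(e\<^sub>4)\<close> stay spacelike only for small
  \<open>t\<close>, so the curve is replaced by a constant one outside a neighbourhood of \<open>0\<close>.\<close>

lemma plane_vert_tangent:
  assumes "g (b (e $ 3)) (e $ 3) = 0" "g (b (e $ 3)) (e $ 4) = 0"
    "g (b (e $ 4)) (e $ 3) = 0" "g (b (e $ 4)) (e $ 4) = 0"
  shows "plane_vert e b \<in> vertical_vectors (grassmannian V G) plane"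
proof -
  define b3 b4 where "b3 = b (e $ 3)" and "b4 = b (e $ 4)"
  define M where "M = \<bar>g b3 b3\<bar> + \<bar>g b3 b4\<bar> + \<bar>g b4 b4\<bar>"
  have M: "M \<ge> 0" by (simp add: M_def)
  \<comment> \<open>M bounds the quadratic form of b on unit vectors, so the planes are spacelike while M times the square of t is below 1\<close>
  define \<delta> where "\<delta> = 1 / (1 + M)"
  have \<delta>: "\<delta> > 0" using M by (simp add: \<delta>_def)
  define c where "c = (\<lambda>t. if \<bar>t\<bar> < \<delta> then (F y, plane_pt (e $ 3 + t *\<^sub>R b3) (e $ 4 + t *\<^sub>R b4)) else plane)"
  have ort: "g b3 (e $ 3) = 0" "g b3 (e $ 4) = 0" "g b4 (e $ 3) = 0" "g b4 (e $ 4) = 0"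
    "g (e $ 3) b3 = 0" "g (e $ 4) b3 = 0" "g (e $ 3) b4 = 0" "g (e $ 4) b4 = 0"
    using assms sym_g by (simp_all add: b3_def b4_def)
  have mem: "(F y, plane_pt (e $ 3 + t *\<^sub>R b3) (e $ 4 + t *\<^sub>R b4)) \<in> grassmannian V G" if t: "\<bar>t\<bar> < \<delta>" for t
  proof -
    have "g (\<alpha> *\<^sub>R (e $ 3 + t *\<^sub>R b3) + \<beta> *\<^sub>R (e $ 4 + t *\<^sub>R b4)) (\<alpha> *\<^sub>R (e $ 3 + t *\<^sub>R b3) + \<beta> *\<^sub>R (e $ 4 + t *\<^sub>R b4)) > 0"
      if "(\<alpha>, \<beta>) \<noteq> (0, 0)" for \<alpha> \<beta>
    proof -
      define N where "N = \<alpha>\<^sup>2 + \<beta>\<^sup>2"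
      have N: "N > 0" using that by (auto simp: N_def sum_power2_gt_zero_iff)
      define Q where "Q = \<alpha>\<^sup>2 * g b3 b3 + 2 * \<alpha> * \<beta> * g b3 b4 + \<beta>\<^sup>2 * g b4 b4"
      have eq: "g (\<alpha> *\<^sub>R (e $ 3 + t *\<^sub>R b3) + \<beta> *\<^sub>R (e $ 4 + t *\<^sub>R b4)) (\<alpha> *\<^sub>R (e $ 3 + t *\<^sub>R b3) + \<beta> *\<^sub>R (e $ 4 + t *\<^sub>R b4))
          = N + t\<^sup>2 * Q"
        by (simp add: N_def Q_def ort e_ip sym_g[of b4 b3] power2_eq_square algebra_simps)
      have "\<bar>Q\<bar> \<le> N * M"
      proof -
        have "\<bar>2 * \<alpha> * \<beta>\<bar> \<le> N"
        proof -
          have "0 \<le> (\<bar>\<alpha>\<bar> - \<bar>\<beta>\<bar>)\<^sup>2" by simp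
          then show ?thesis by (simp add: N_def power2_diff abs_mult)
        qed
        then have "\<bar>2 * \<alpha> * \<beta> * g b3 b4\<bar> \<le> N * \<bar>g b3 b4\<bar>"
          unfolding abs_mult[of "2 * \<alpha> * \<beta>"] by (rule mult_right_mono) simp
        moreover have "\<bar>\<alpha>\<^sup>2 * g b3 b3\<bar> \<le> N * \<bar>g b3 b3\<bar>" "\<bar>\<beta>\<^sup>2 * g b4 b4\<bar> \<le> N * \<bar>g b4 b4\<bar>"
          by (simp_all add: abs_mult N_def mult_right_mono)
        ultimately show ?thesis unfolding Q_def M_def distrib_left by linarith
      qed
      moreover have "t\<^sup>2 * M < 1"
      proof -
        have "\<delta> \<le> 1" using M by (simp add: \<delta>_def)
        then have "\<bar>t\<bar> * \<bar>t\<bar> \<le> \<bar>t\<bar> * 1" using t by (intro mult_left_mono) auto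
        then have "t\<^sup>2 \<le> \<delta>" using t by (simp add: power2_eq_square)
        then have "t\<^sup>2 * M \<le> \<delta> * M" using M by (rule mult_right_mono)
        also have "\<dots> < 1" using M by (simp add: \<delta>_def)
        finally show ?thesis .
      qed
      ultimately have "t\<^sup>2 * \<bar>Q\<bar> < N"
      proof -
        have "t\<^sup>2 * \<bar>Q\<bar> \<le> t\<^sup>2 * (N * M)" using \<open>\<bar>Q\<bar> \<le> N * M\<close> by (rule mult_left_mono) simp
        also have "\<dots> = N * (t\<^sup>2 * M)" by simp
        also have "\<dots> < N * 1" using \<open>t\<^sup>2 * M < 1\<close> N by (rule mult_strict_left_mono)
        finally show ?thesis by simp
      qed
      moreover have "- (t\<^sup>2 * \<bar>Q\<bar>) \<le> t\<^sup>2 * Q"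
        by (metis abs_ge_minus_self abs_mult abs_power2 minus_le_iff)
      ultimately show ?thesis unfolding eq by linarith
    qed
    then show ?thesis unfolding grassmannian_def using F_in[OF y_in] by blast
  qed
  have "plane \<in> grassmannian V G" using mem[of 0] \<delta> by simp
  then have "c t \<in> grassmannian V G" for t using mem by (simp add: c_def)
  moreover have "c 0 = plane" by (simp add: c_def)
  moreover have "(c has_vector_derivative plane_vert e b) (at 0)"
  proof (rule has_vector_derivative_transform_within_open)
    show "((\<lambda>t. (F y, plane_pt (e $ 3 + t *\<^sub>R b3) (e $ 4 + t *\<^sub>R b4))) has_vector_derivative plane_vert e b) (at 0)"
      unfolding plane_vert_e_eq b3_def b4_def
      by (intro has_vector_derivative_Pair has_vector_derivative_const plane_curve_derivative wedge_e_nonzero)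
    show "open {t. \<bar>t\<bar> < \<delta>}" by (intro open_Collect_less continuous_intros)
  qed (use \<delta> in \<open>auto simp: c_def\<close>)
  ultimately show ?thesis
    unfolding vertical_vectors_def tangent_vectors_def by (auto simp: plane_vert_e_eq)
qed

text \<open>Linear maps on the whole space serve as representatives of homomorphisms from the plane to its
  orthogonal complement.\<close>

definition normal_map :: "(real^4 \<Rightarrow> real^4) \<Rightarrow> bool" where
  "normal_map b \<longleftrightarrow> linear b \<and> (\<forall>u\<in>span {e $ 3, e $ 4}. \<forall>v\<in>span {e $ 3, e $ 4}. g (b u) v = 0)"

lemma e_in_span: "e $ 3 \<in> span {e $ 3, e $ 4}" "e $ 4 \<in> span {e $ 3, e $ 4}"
  by (simp_all add: span_base)

lemma normal_mapD:
  assumes "normal_map b"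
  shows "g (b (e $ 3)) (e $ 3) = 0" "g (b (e $ 3)) (e $ 4) = 0"
    "g (b (e $ 4)) (e $ 3) = 0" "g (b (e $ 4)) (e $ 4) = 0"
  using assms e_in_span unfolding normal_map_def by blast+

lemma plane_vert_eq_iff:
  assumes "g (b (e $ 3)) (e $ 3) = 0" "g (b (e $ 3)) (e $ 4) = 0"
    "g (b (e $ 4)) (e $ 3) = 0" "g (b (e $ 4)) (e $ 4) = 0"
    "g (b' (e $ 3)) (e $ 3) = 0" "g (b' (e $ 3)) (e $ 4) = 0"
    "g (b' (e $ 4)) (e $ 3) = 0" "g (b' (e $ 4)) (e $ 4) = 0"
  shows "plane_vert e b = plane_vert e b' \<longleftrightarrow> b (e $ 3) = b' (e $ 3) \<and> b (e $ 4) = b' (e $ 4)"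
proof
  assume "plane_vert e b = plane_vert e b'"
  then have "plane_deriv (e $ 3) (e $ 4) (b (e $ 3) - b' (e $ 3)) (b (e $ 4) - b' (e $ 4)) = 0"
    by (simp add: plane_vert_e_eq plane_deriv_diff)
  from plane_deriv_normal_eq_0[OF this] assms
  show "b (e $ 3) = b' (e $ 3) \<and> b (e $ 4) = b' (e $ 4)" by simp
qed (simp add: plane_vert_e_eq)

lemma J1_e:
  assumes "linear b"
  shows "J1 (G (F y)) e b (e $ 3) = - b (e $ 4)" "J1 (G (F y)) e b (e $ 4) = b (e $ 3)"
  using linear_neg[OF assms] by (simp_all add: J1_def rot_def e_ip)

text \<open>As on the twistor spaces, but here two representatives of a coset agree exactly: their horizontal
  vectors lie in the plane and differ by a multiple of \<open>n\<close>, hence coincide.\<close>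

lemma grass_J_eq:
  assumes b: "normal_map b" and w: "w \<in> span {e $ 3, e $ 4}"
  shows "grass_J \<epsilon> G plane (coset (grass_K G plane) (plane_vert e b + plane_lift w)) =
    coset (grass_K G plane) (\<epsilon> *\<^sub>R plane_vert e (J1 (G (F y)) e b) + plane_lift (rotate w))" (is "_ = ?C")
proof -
  define K where "K = span {plane_lift (null 1)}"
  define S where "S = {coset K (\<epsilon> *\<^sub>R plane_vert s (J1 (G (F y)) s b') + plane_hlift G (F y) s (rot (G (F y)) s w')) | s b' w'.
    grass_frame G plane s \<and> linear b' \<and>
         (\<forall>u\<in>span {s $ 3, s $ 4}. \<forall>v\<in>span {s $ 3, s $ 4}. g (b' u) v = 0) \<and>
         w' \<in> span {s $ 3, s $ 4} \<and>
         plane_vert s b' + plane_hlift G (F y) s w' \<in> coset K (plane_vert e b + plane_lift w)}"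
  have "x = ?C" if x: "x \<in> S" for x
  proof -
    obtain s b' w' where x: "x = coset K (\<epsilon> *\<^sub>R plane_vert s (J1 (G (F y)) s b') + plane_hlift G (F y) s (rot (G (F y)) s w'))"
      and s: "grass_frame G plane s" and lin: "linear b'"
      and b'0: "\<forall>u\<in>span {s $ 3, s $ 4}. \<forall>v\<in>span {s $ 3, s $ 4}. g (b' u) v = 0"
      and w'0: "w' \<in> span {s $ 3, s $ 4}"
      and rep0: "plane_vert s b' + plane_hlift G (F y) s w' \<in> coset K (plane_vert e b + plane_lift w)"
      using x unfolding S_def by blast
    note inv = grass_frame_invariance[OF s]
    have b': "normal_map b'" using lin b'0 by (simp add: normal_map_def inv(4))
    have w': "w' \<in> span {e $ 3, e $ 4}" using w'0 by (simp add: inv(4))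
    have rep: "plane_vert e b' + plane_lift w' \<in> coset K (plane_vert e b + plane_lift w)"
      using rep0 by (simp only: inv(1) inv(2)[OF lin])
    have "linear (J1 (G (F y)) e b')"
    proof -
      have "linear rotate" by (rule linearI) (simp_all add: rot_def algebra_simps)
      then show ?thesis
        unfolding J1_def using linear_compose_neg[OF linear_compose[OF _ lin]] by (simp add: o_def)
    qed
    then have x': "x = coset K (\<epsilon> *\<^sub>R plane_vert e (J1 (G (F y)) e b') + plane_lift (rotate w'))"
      unfolding x inv(1) inv(2)[OF \<open>linear (J1 (G (F y)) e b')\<close>, symmetric] by (simp add: J1_def inv(3))
    obtain k where k: "plane_vert e b' + plane_lift w' - (plane_vert e b + plane_lift w) = plane_lift (k *\<^sub>R null 1)"
      using rep unfolding K_def mem_coset_span by (auto simp: span_singleton linear_cmul[OF linear_plane_lift])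
    then have wk: "w' - w = k *\<^sub>R null 1"
      by (simp add: plane_vert_e_eq plane_lift_eq prod_eq_iff)
    have "k = 0"
    proof -
      have "g (w' - w) (null (- 1)) = 0"
        using w w' null_frame_ip[OF null_frame_e[of 1]] by (auto simp: span_pair)
      then show ?thesis using wk null_frame_ip[OF null_frame_e[of 1]] by simp
    qed
    then have "w' = w" using wk by simp
    then have "plane_vert e b' = plane_vert e b"
      using k \<open>k = 0\<close> by (simp add: linear_0[OF linear_plane_lift])
    then have "b' (e $ 3) = b (e $ 3)" "b' (e $ 4) = b (e $ 4)"
      using plane_vert_eq_iff[OF normal_mapD[OF b'] normal_mapD[OF b]] by simp_all
    then have "plane_vert e (J1 (G (F y)) e b') = plane_vert e (J1 (G (F y)) e b)"
      using lin b by (simp add: plane_vert_e_eq J1_e normal_map_def)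
    then show ?thesis by (simp add: x' \<open>w' = w\<close> K_def grass_K_eq)
  qed
  moreover have "?C \<in> S"
  proof -
    have "plane_vert e b + plane_lift w \<in> coset K (plane_vert e b + plane_lift w)"
      unfolding K_def mem_coset_span by (simp add: span_zero)
    then have "coset K (\<epsilon> *\<^sub>R plane_vert e (J1 (G (F y)) e b) + plane_lift (rotate w)) \<in> S"
      unfolding S_def using b w grass_frame_e unfolding normal_map_def by blast
    then show ?thesis by (simp add: K_def grass_K_eq)
  qed
  ultimately have "S = {?C}" by blast
  moreover have "grass_J \<epsilon> G plane (coset (grass_K G plane) (plane_vert e b + plane_lift w)) = \<Union> S"
    unfolding grass_J_def S_def K_def grass_K_eq fst_conv ..
  ultimately show ?thesis by simp
qed

text \<open>For fixed \<open>X\<close>, the second fundamental form as a homomorphism from the tangent plane to the normal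
  plane, extended by \<open>0\<close> to normal vectors.\<close>

definition second :: "real^2 \<Rightarrow> real^4 \<Rightarrow> real^4" where
  "second X u = g u (e $ 3) *\<^sub>R II G F y X E3 + g u (e $ 4) *\<^sub>R II G F y X E4"

lemma second_e: "second X (e $ 3) = II G F y X E3" "second X (e $ 4) = II G F y X E4"
  by (simp_all add: second_def e_ip)

lemma second_normal: "normal_map (second X)"
  unfolding normal_map_def
  by (auto intro!: linearI simp: second_def algebra_simps span_pair II_normal)

lemma linear_second: "linear (second X)"
  using second_normal by (simp add: normal_map_def)

text \<open>The lift is computed with the vectors \<open>E\<^sub>3\<close> and \<open>E\<^sub>4\<close>, which are adapted to one point only but
  kept constant: they span the same oriented plane as the coordinate vectors, and
  constancy lets their images be differentiated directly.\<close>

lemma grass_lift_eq: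
  "grass_lift F x = (F x, plane_pt (differential F x E3) (differential F x E4))" if "x \<in> U" for x
proof -
  obtain p q where 1: "axis 1 1 = p *\<^sub>R E3 + q *\<^sub>R E4" using pos_basis_expansion[OF pos_E] by blast
  obtain r t where 2: "axis 2 1 = r *\<^sub>R E3 + t *\<^sub>R E4" using pos_basis_expansion[OF pos_E] by blast
  have "pos_basis (axis 1 1) (axis 2 1)" by (simp add: pos_basis_det axis_def)
  then have "p * t - q * r > 0" unfolding 1 2 pos_basis_change[OF pos_E] .
  from plane_pt_combination[OF this] show ?thesis
    using linear_dF[OF that] by (simp add: grass_lift_def 1 2 linear_add linear_cmul)
qed

lemma grass_lift_at: "grass_lift F y = plane"
  by (simp add: grass_lift_eq[OF y_in] e34)

text \<open>The spanning vectors move by the Hessian minus the Christoffel terms. The latter make up the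
  horizontal lift, and the tangential part of the Hessian does not move the plane.\<close>

lemma grass_lift_derivative:
  "differential (grass_lift F) y X = plane_vert e (second X) + plane_lift (dF X)"
proof -
  define D3 D4 where "D3 = differential (\<lambda>x. differential F x E3) y"
    and "D4 = differential (\<lambda>x. differential F x E4) y"
  have D: "((\<lambda>x. differential F x E3) has_derivative D3) (at y)" "((\<lambda>x. differential F x E4) has_derivative D4) (at y)"
    unfolding D3_def D4_def by (rule smooth_on_has_derivative[OF smooth_on_derivative[OF smooth_F] y_in])+
  have "((\<lambda>x. plane_pt (differential F x E3) (differential F x E4)) has_derivative
      (\<lambda>X. plane_deriv (e $ 3) (e $ 4) (D3 X) (D4 X))) (at y)"
    using plane_pt_has_derivative[OF D] wedge_e_nonzero by (simp add: e34)
  then have "((\<lambda>x. (F x, plane_pt (differential F x E3) (differential F x E4))) has_derivative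
      (\<lambda>X. (dF X, plane_deriv (e $ 3) (e $ 4) (D3 X) (D4 X)))) (at y)"
    by (intro has_derivative_Pair F_deriv y_in)
  then have "(grass_lift F has_derivative (\<lambda>X. (dF X, plane_deriv (e $ 3) (e $ 4) (D3 X) (D4 X)))) (at y)"
    by (rule has_derivative_transform_within_open[OF _ open_U y_in]) (simp add: grass_lift_eq)
  from fun_cong[OF frechet_derivative_at[OF this], of X]
  have 1: "differential (grass_lift F) y X = (dF X, plane_deriv (e $ 3) (e $ 4) (D3 X) (D4 X))" by simp
  define h3 h4 where "h3 = hess y X E3" and "h4 = hess y X E4"
  have D34: "D3 X = h3 + - christoffel G (F y) (dF X) (e $ 3)" "D4 X = h4 + - christoffel G (F y) (dF X) (e $ 4)"
    by (simp_all add: h3_def h4_def D3_def D4_def cov_deriv_def e34)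
  have h: "h3 = II G F y X E3 + (g h3 (e $ 3) *\<^sub>R e $ 3 + g h3 (e $ 4) *\<^sub>R e $ 4)"
    "h4 = II G F y X E4 + (g h4 (e $ 3) *\<^sub>R e $ 3 + g h4 (e $ 4) *\<^sub>R e $ 4)"
    by (simp_all add: h3_def h4_def II_eq)
  have "plane_deriv (e $ 3) (e $ 4) h3 h4 = plane_deriv (e $ 3) (e $ 4) (II G F y X E3) (II G F y X E4)"
    using plane_deriv_add[of "e $ 3" "e $ 4" "II G F y X E3" "g h3 (e $ 3) *\<^sub>R e $ 3 + g h3 (e $ 4) *\<^sub>R e $ 4"
        "II G F y X E4" "g h4 (e $ 3) *\<^sub>R e $ 3 + g h4 (e $ 4) *\<^sub>R e $ 4"]
    by (simp only: plane_deriv_tangential add_0_right h[symmetric])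
  then have "plane_deriv (e $ 3) (e $ 4) (D3 X) (D4 X) =
      plane_deriv (e $ 3) (e $ 4) (II G F y X E3) (II G F y X E4) +
      plane_deriv (e $ 3) (e $ 4) (- christoffel G (F y) (dF X) (e $ 3)) (- christoffel G (F y) (dF X) (e $ 4))"
    unfolding D34 plane_deriv_add by simp
  then show ?thesis by (simp add: 1 plane_vert_e_eq plane_lift_eq second_e)
qed

text \<open>As for the twistor lifts, all conditions except the vertical part of the last one are automatic.
  That part says \<open>II(J X, Y) = - \<epsilon> II(X, J Y)\<close>, written out on the frame.\<close>

lemma holomorphic_at_grass_iff:
  "holomorphic_at (grass_K G plane) (grass_L V G plane) (grass_J \<epsilon> G plane) ((*v) (J y))
    (differential (grass_lift F) y) \<longleftrightarrow>
    (\<forall>X. II G F y (J y *v X) E3 = - \<epsilon> *\<^sub>R II G F y X E4 \<and> II G F y (J y *v X) E4 = \<epsilon> *\<^sub>R II G F y X E3)"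
proof -
  define d where "d = differential (grass_lift F) y"
  have d: "d X = plane_vert e (second X) + plane_lift (dF X)" for X
    unfolding d_def by (rule grass_lift_derivative)
  have fst_d: "fst (d X) = dF X" for X by (simp add: d plane_vert_e_eq plane_lift_eq)
  note nf = null_frame_ip[OF null_frame_e[of 1]]
  have "d X \<in> grass_L V G plane" for X
  proof -
    have "g (null 1) (dF X) = 0" by (subst dF_expansion) (simp add: nf)
    then have "g (e $ 1 + e $ 2) (dF X) = 0" by (simp add: null_def)
    then show ?thesis
      unfolding d grass_L_def
      using plane_vert_tangent[OF normal_mapD[OF second_normal]] grass_frame_e by fastforce
  qed
  then have L: "range d \<subseteq> grass_L V G plane" by blast
  have d0: "d 0 = 0"
    by (simp add: d dF_simps linear_0[OF linear_plane_lift] plane_vert_e_eq second_e II_eq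
        linear_0[OF linear_hess_left[OF y_in]] zero_prod_def plane_deriv_eq_0_iff[OF wedge_e_nonzero] wedge_simps)
  have K: "range d \<inter> grass_K G plane = {0}"
  proof -
    have "d X = 0" if "d X \<in> span {plane_lift (null 1)}" for X
    proof -
      obtain k where "d X = plane_lift (k *\<^sub>R null 1)"
        using \<open>d X \<in> span _\<close> by (auto simp: span_singleton linear_cmul[OF linear_plane_lift])
      then have "dF X = k *\<^sub>R null 1" using fst_d[of X] by (simp add: plane_lift_eq)
      then have "g (dF X) (dF X) = 0" by (simp add: nf)
      then have "X = 0" using spacelike[OF y_in, of X] by (metis less_irrefl)
      then show "d X = 0" by (simp add: d0)
    qed
    moreover have "0 \<in> range d" using d0 by (metis rangeI)
    ultimately show ?thesis unfolding grass_K_eq using span_zero[of "{plane_lift (null 1)}"] by blast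
  qed
  have J: "coset (grass_K G plane) (d (J y *v X)) = grass_J \<epsilon> G plane (coset (grass_K G plane) (d X)) \<longleftrightarrow>
      II G F y (J y *v X) E3 = - \<epsilon> *\<^sub>R II G F y X E4 \<and> II G F y (J y *v X) E4 = \<epsilon> *\<^sub>R II G F y X E3" for X
  proof -
    define b where "b = (\<lambda>u. \<epsilon> *\<^sub>R J1 (G (F y)) e (second X) u)"
    have b: "b (e $ 3) = - \<epsilon> *\<^sub>R II G F y X E4" "b (e $ 4) = \<epsilon> *\<^sub>R II G F y X E3"
      by (simp_all add: b_def J1_e[OF linear_second] second_e)
    have bv: "plane_vert e b = \<epsilon> *\<^sub>R plane_vert e (J1 (G (F y)) e (second X))"
      by (simp add: plane_vert_e_eq b_def plane_deriv_scale)
    have "coset (grass_K G plane) (d (J y *v X)) = grass_J \<epsilon> G plane (coset (grass_K G plane) (d X)) \<longleftrightarrow>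
        plane_vert e (second (J y *v X)) - plane_vert e b \<in> span {plane_lift (null 1)}"
    proof -
      have "dF X \<in> span {e $ 3, e $ 4}" using dF_expansion[of X] span_pair by blast
      then show ?thesis
        unfolding d[of X] grass_J_eq[OF second_normal \<open>dF X \<in> _\<close>] unfolding grass_K_eq coset_span_eq_iff
        by (simp add: d dF_J bv)
    qed
    also have "\<dots> \<longleftrightarrow> plane_vert e (second (J y *v X)) = plane_vert e b"
    proof
      assume "plane_vert e (second (J y *v X)) - plane_vert e b \<in> span {plane_lift (null 1)}"
      then obtain k where k: "plane_vert e (second (J y *v X)) - plane_vert e b = plane_lift (k *\<^sub>R null 1)"
        by (auto simp: span_singleton linear_cmul[OF linear_plane_lift])
      then have "k *\<^sub>R null 1 = 0" by (simp add: plane_vert_e_eq plane_lift_eq prod_eq_iff)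
      with k show "plane_vert e (second (J y *v X)) = plane_vert e b"
        by (simp add: linear_0[OF linear_plane_lift])
    qed (simp add: span_zero)
    also have "\<dots> \<longleftrightarrow> second (J y *v X) (e $ 3) = b (e $ 3) \<and> second (J y *v X) (e $ 4) = b (e $ 4)"
      by (rule plane_vert_eq_iff[OF normal_mapD[OF second_normal]]) (simp_all add: b II_normal)
    finally show ?thesis by (simp add: second_e b)
  qed
  show ?thesis
    unfolding holomorphic_at_def d_def[symmetric] using L K J by simp
qed

text \<open>Since \<open>J E\<^sub>3 = E\<^sub>4\<close> and \<open>J E\<^sub>4 = - E\<^sub>3\<close>, evaluation on the frame gives four equations, two of which
  coincide by symmetry.\<close>

lemma II_rotation_iff:
  "(\<forall>X. II G F y (J y *v X) E3 = - \<epsilon> *\<^sub>R II G F y X E4 \<and> II G F y (J y *v X) E4 = \<epsilon> *\<^sub>R II G F y X E3) \<longleftrightarrow>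
    II G F y E3 E4 = - \<epsilon> *\<^sub>R II G F y E3 E4 \<and> II G F y E4 E4 = \<epsilon> *\<^sub>R II G F y E3 E3 \<and>
    II G F y E3 E3 = \<epsilon> *\<^sub>R II G F y E4 E4" (is "?L \<longleftrightarrow> ?R")
proof
  assume L: ?L
  have "II G F y E3 E4 = - \<epsilon> *\<^sub>R II G F y E3 E4" "II G F y E4 E4 = \<epsilon> *\<^sub>R II G F y E3 E3"
    using L[rule_format, of E3, unfolded J_E II_sym[of E4 E3]] by blast+
  moreover have "II G F y E3 E3 = \<epsilon> *\<^sub>R II G F y E4 E4"
    using L[rule_format, of E4, unfolded J_E II_simps scaleR_minus_left neg_equal_iff_equal] by blast
  ultimately show ?R by blast
next
  assume ?R
  then have R1: "II G F y E3 E4 = - \<epsilon> *\<^sub>R II G F y E3 E4" and R2: "II G F y E4 E4 = \<epsilon> *\<^sub>R II G F y E3 E3"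
    and R3: "II G F y E3 E3 = \<epsilon> *\<^sub>R II G F y E4 E4" by blast+
  show ?L
  proof
    fix X
    obtain p q where X: "X = p *\<^sub>R E3 + q *\<^sub>R E4" using pos_basis_expansion[OF pos_E] by blast
    have JX: "J y *v X = p *\<^sub>R E4 + q *\<^sub>R (- E3)"
      by (simp add: X matrix_vector_right_distrib matrix_vector_mult_scaleR J_E)
    have 1: "II G F y (J y *v X) E3 = p *\<^sub>R II G F y E3 E4 + q *\<^sub>R (- II G F y E3 E3)"
      "II G F y (J y *v X) E4 = p *\<^sub>R II G F y E4 E4 + q *\<^sub>R (- II G F y E3 E4)"
      unfolding JX II_simps by (simp_all add: II_sym[of E4 E3])
    have 2: "II G F y X E3 = p *\<^sub>R II G F y E3 E3 + q *\<^sub>R II G F y E3 E4"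
      "II G F y X E4 = p *\<^sub>R II G F y E3 E4 + q *\<^sub>R II G F y E4 E4"
      unfolding X II_simps by (simp_all add: II_sym[of E4 E3])
    have "p *\<^sub>R II G F y E3 E4 + q *\<^sub>R (- II G F y E3 E3) =
        p *\<^sub>R (- \<epsilon> *\<^sub>R II G F y E3 E4) + q *\<^sub>R (- (\<epsilon> *\<^sub>R II G F y E4 E4))"
      "p *\<^sub>R II G F y E4 E4 + q *\<^sub>R (- II G F y E3 E4) =
        p *\<^sub>R (\<epsilon> *\<^sub>R II G F y E3 E3) + q *\<^sub>R (- (- \<epsilon> *\<^sub>R II G F y E3 E4))"
      by (simp_all only: R1[symmetric] R2[symmetric] R3[symmetric])
    then show "II G F y (J y *v X) E3 = - \<epsilon> *\<^sub>R II G F y X E4 \<and> II G F y (J y *v X) E4 = \<epsilon> *\<^sub>R II G F y X E3"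
      unfolding 1 2 by (simp add: algebra_simps)
  qed
qed

lemma grass_plus_iff:
  "holomorphic_at (grass_K G plane) (grass_L V G plane) (grass_J 1 G plane) ((*v) (J y))
    (differential (grass_lift F) y) \<longleftrightarrow>
    (\<forall>X Y. II G F y X Y = ip (pullback G F y) X Y *\<^sub>R mean_curv G F y)"
  unfolding holomorphic_at_grass_iff II_rotation_iff umbilic_iff by (auto simp: eq_neg_iff_add_eq_0 simp flip: scaleR_2)

lemma grass_minus_iff:
  "holomorphic_at (grass_K G plane) (grass_L V G plane) (grass_J (- 1) G plane) ((*v) (J y))
    (differential (grass_lift F) y) \<longleftrightarrow> mean_curv G F y = 0"
  unfolding holomorphic_at_grass_iff II_rotation_iff mean_curv_eq
  by (auto simp: eq_neg_iff_add_eq_0 add.commute)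

end

lemma (in surface_patch) smooth_grass_lift: "smooth_on U (grass_lift F)"
proof -
  have "wedge (differential F y (axis 1 1)) (differential F y (axis 2 1)) \<noteq> 0" if y: "y \<in> U" for y
  proof -
    obtain e E3 E4 where "adapted_frame V G U F J y e E3 E4" using adapted_frame_exists[OF y] by blast
    then interpret adapted_frame V G U F J y e E3 E4 .
    have "plane_pt (differential F y (axis 1 1)) (differential F y (axis 2 1)) = plane_pt (e $ 3) (e $ 4)"
      using grass_lift_at by (simp add: grass_lift_def)
    then show ?thesis using wedge_e_nonzero by (auto simp: plane_pt_wedge)
  qed
  then show ?thesis
    unfolding grass_lift_def[abs_def]
    by (intro smooth_on_Pair smooth_on_plane_pt smooth_on_derivative smooth_F open_U)
qed

section \<open>The correspondence for conformal immersions\<close>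

context surface_patch
begin

lemma twistor_point_exists:
  assumes "y \<in> U" "\<sigma>\<^sup>2 = 1"
  shows "\<exists>e E3 E4. twistor_point V G U F J y e E3 E4 \<sigma>"
  using adapted_frame_exists[OF assms(1)] assms(2)
  by (auto simp: twistor_point_def twistor_point_axioms_def)

lemma smooth_twistor_lift:
  assumes "\<sigma>\<^sup>2 = 1"
  shows "smooth_on U (twistor_lift \<sigma> G F)"
proof (rule smooth_on_local)
  fix y assume "y \<in> U"
  then obtain e E3 E4 where "twistor_point V G U F J y e E3 E4 \<sigma>"
    using twistor_point_exists[OF _ assms] by blast
  then show "\<exists>W. open W \<and> y \<in> W \<and> smooth_on W (twistor_lift \<sigma> G F)"
    by (rule twistor_point.twistor_lift_derivative(1))
qed

lemma twistor_holomorphic_at_iff: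
  fixes \<sigma> :: real
  defines "\<gamma> \<equiv> twistor_lift \<sigma> G F"
  assumes y: "y \<in> U" and \<sigma>: "\<sigma>\<^sup>2 = 1"
  shows "holomorphic_at (twistor_K G (\<gamma> y)) (twistor_L V G (\<gamma> y)) (twistor_J \<sigma> (- 1) G (\<gamma> y))
      ((*v) (J y)) (differential \<gamma> y) \<longleftrightarrow> H_pm G F (- \<sigma>) y = 0" (is ?minus)
    and "holomorphic_at (twistor_K G (\<gamma> y)) (twistor_L V G (\<gamma> y)) (twistor_J \<sigma> 1 G (\<gamma> y))
      ((*v) (J y)) (differential \<gamma> y) \<longleftrightarrow> (\<forall>X Y. L_pm G F (- \<sigma>) y X Y = 0)" (is ?plus)
    and "range (differential \<gamma> y) \<subseteq> twistor_horizontal G (\<gamma> y) \<longleftrightarrow>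
      H_pm G F (- \<sigma>) y = 0 \<and> (\<forall>X Y. L_pm G F (- \<sigma>) y X Y = 0)" (is ?horizontal)
proof -
  obtain e E3 E4 where "twistor_point V G U F J y e E3 E4 \<sigma>"
    using twistor_point_exists[OF y \<sigma>] by blast
  then interpret twistor_point V G U F J y e E3 E4 \<sigma> .
  note eqs = \<gamma>_def twistor_lift_derivative(2)
  show ?minus unfolding eqs holomorphic_at_twistor_iff by (rule holomorphic_minus_iff)
  show ?plus unfolding eqs holomorphic_at_twistor_iff by (rule holomorphic_plus_iff)
  show ?horizontal unfolding eqs horizontal_iff by (rule shape_zero_iff)
qed

lemma grass_holomorphic_at_iff:
  fixes \<gamma>
  defines "\<gamma> \<equiv> grass_lift F"
  assumes y: "y \<in> U"
  shows "holomorphic_at (grass_K G (\<gamma> y)) (grass_L V G (\<gamma> y)) (grass_J 1 G (\<gamma> y))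
      ((*v) (J y)) (differential \<gamma> y) \<longleftrightarrow>
      (\<forall>X Y. II G F y X Y = ip (pullback G F y) X Y *\<^sub>R mean_curv G F y)" (is ?plus)
    and "holomorphic_at (grass_K G (\<gamma> y)) (grass_L V G (\<gamma> y)) (grass_J (- 1) G (\<gamma> y))
      ((*v) (J y)) (differential \<gamma> y) \<longleftrightarrow> mean_curv G F y = 0" (is ?minus)
    and "tension G F y = 2 *\<^sub>R mean_curv G F y" (is ?tension)
proof -
  obtain e E3 E4 where "adapted_frame V G U F J y e E3 E4"
    using adapted_frame_exists[OF y] by blast
  then interpret adapted_frame V G U F J y e E3 E4 .
  show ?plus unfolding \<gamma>_def grass_lift_at by (rule grass_plus_iff)
  show ?minus unfolding \<gamma>_def grass_lift_at by (rule grass_minus_iff)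
  show ?tension by (rule tension_eq)
qed

end

lemma open_local_dom:
  assumes "is_chart d" "is_chart c" "continuous_on UNIV f"
  shows "open (local_dom d c f)"
proof -
  have hom: "homeomorphism (fst d) (chart_ran d) (snd d) (chart_inv d)"
    and op: "open (fst d)" "open (chart_ran d)" "open (fst c)"
    using assms by (simp_all add: is_chart_def)
  have "open (fst d \<inter> f -` fst c)"
    using op assms(3) by (intro open_Int open_vimage)
  then have "openin (top_of_set (fst d)) (fst d \<inter> f -` fst c)"
    using op by (simp add: openin_open_eq)
  from homeomorphism_imp_open_map[OF hom this] show ?thesis
    using op by (simp add: openin_open_eq local_dom_def)
qed

text \<open>The metric in the conformal class that equals the pulled-back metric provides both the positivity of
  the induced metric and the description of \<open>J\<close> as its rotation.\<close>

lemma surface_patch_in_charts: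
  fixes AN :: "('n::{t2_space,second_countable_topology}, 2) chart set"
    and AM :: "('m::{t2_space,second_countable_topology}, 4) chart set"
  assumes N: "riemannian_surface AN C J" and M: "oriented_atlas AM" "lorentzian_metric AM g"
    and f: "conformal_immersion AN C AM g f"
    and d: "d \<in> AN" and c: "c \<in> AM"
  shows "surface_patch (chart_ran c) (g c) (local_dom d c f) (local_rep d c f) (J d)"
proof -
  let ?U = "local_dom d c f" and ?F = "local_rep d c f"
  have chd: "is_chart d" and chc: "is_chart c"
    using N M d c by (simp_all add: riemannian_surface_def oriented_atlas_def)
  have smooth_f: "smooth_map AN AM f" using f by (simp add: conformal_immersion_def)
  have inj_d: "inj_on (snd d) (fst d)"
    using chd unfolding is_chart_def homeomorphism_def by (metis inj_on_inverseI)
  have open_V: "open (chart_ran c)" using chc by (simp add: is_chart_def)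
  have sym: "transpose (g c x) = g c x" and lor: "\<exists>s. pseudo_orthonormal (g c x) s"
    if "x \<in> chart_ran c" for x
    using M(2) c that by (auto simp: lorentzian_metric_def metric_tensor_def)
  have smooth_F: "smooth_on ?U ?F"
    using smooth_f d c by (simp add: smooth_map_def)
  have F_in: "?F y \<in> chart_ran c" if "y \<in> ?U" for y
    using that inj_d by (auto simp: local_dom_def local_rep_def chart_ran_def chart_inv_def)
  obtain h where h: "h \<in> C" and
    pull: "\<And>y. y \<in> ?U \<Longrightarrow> h d y = pullback (g c) ?F y"
    using f d c unfolding conformal_immersion_def in_charts_def by blast
  have ran: "y \<in> chart_ran d" if "y \<in> ?U" for y
    using that by (auto simp: local_dom_def chart_ran_def)
  have "riemannian_metric AN h"
    using N h by (auto simp: riemannian_surface_def conformal_structure_def)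
  then have pos: "ip (h d y) X X > 0" if "y \<in> ?U" "X \<noteq> 0" for y X
    using ran that d by (simp add: riemannian_metric_def)
  have J: "ip (h d y) (J d y *v X) (J d y *v X) = ip (h d y) X X \<and> ip (h d y) X (J d y *v X) = 0 \<and>
      pos_basis X (J d y *v X)" if "y \<in> ?U" "X \<noteq> 0" for y X
    using N h d ran that by (simp add: riemannian_surface_def)
  have h_ip: "ip (h d y) X Y = ip (g c (?F y)) (differential ?F y X)
      (differential ?F y Y)" if "y \<in> ?U" for y X Y
    unfolding pull[OF that] by (rule ip_pullback[OF smooth_on_linear_derivative[OF smooth_F that]])
  show ?thesis
  proof unfold_locales
    show "open ?U"
      using smooth_f by (intro open_local_dom chd chc) (simp add: smooth_map_def)
    show "smooth_on (chart_ran c) (g c)"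
      using M(2) c by (simp add: lorentzian_metric_def metric_tensor_def)
    show "invertible (g c x)" if "x \<in> chart_ran c" for x
      using lor[OF that] lorentz_invertible sym[OF that] by blast
    show "ip (g c (?F y)) (differential ?F y X) (differential ?F y X) > 0"
      if "y \<in> ?U" "X \<noteq> 0" for y X
      using pos[OF that] by (simp add: h_ip[OF that(1)])
    show "ip (g c (?F y)) (differential ?F y (J d y *v X))
         (differential ?F y (J d y *v X)) =
        ip (g c (?F y)) (differential ?F y X) (differential ?F y X) \<and>
        ip (g c (?F y)) (differential ?F y X)
         (differential ?F y (J d y *v X)) = 0 \<and>
        pos_basis X (J d y *v X)" if "y \<in> ?U" "X \<noteq> 0" for y X
      using J[OF that] unfolding h_ip[OF that(1)] .
  qed (use open_V sym lor smooth_F F_in in auto)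
qed

lemma in_charts_cong:
  assumes "\<And>d c y. d \<in> A \<Longrightarrow> c \<in> B \<Longrightarrow> y \<in> local_dom d c f \<Longrightarrow> P d c y \<longleftrightarrow> Q d c y"
  shows "in_charts A B f P \<longleftrightarrow> in_charts A B f Q"
  using assms by (simp add: in_charts_def)

context
  fixes AN :: "('n::{t2_space,second_countable_topology}, 2) chart set"
    and C :: "('n, 2) tensor2 set" and J :: "('n, 2) tensor2"
    and AM :: "('m::{t2_space,second_countable_topology}, 4) chart set"
    and g :: "('m, 4) tensor2" and f :: "'n \<Rightarrow> 'm"
  assumes N: "riemannian_surface AN C J" and M: "oriented_atlas AM" "lorentzian_metric AM g"
    and f: "conformal_immersion AN C AM g f"
begin

lemmas patch = surface_patch_in_charts[OF N M f]

lemma twistor_holomorphic_iff: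
  assumes "\<sigma>\<^sup>2 = 1"
  shows "O_holomorphic AN J AM g f \<sigma> (- 1) \<longleftrightarrow> H_vanishes AN AM g f (- \<sigma>)"
    and "O_holomorphic AN J AM g f \<sigma> 1 \<longleftrightarrow> L_vanishes AN AM g f (- \<sigma>)"
    and "horizontal AN AM g f \<sigma> \<longleftrightarrow> H_vanishes AN AM g f (- \<sigma>) \<and> L_vanishes AN AM g f (- \<sigma>)"
proof -
  note smooth = surface_patch.smooth_twistor_lift[OF patch assms]
  note iffs = surface_patch.twistor_holomorphic_at_iff[OF patch _ assms]
  show "O_holomorphic AN J AM g f \<sigma> (- 1) \<longleftrightarrow> H_vanishes AN AM g f (- \<sigma>)"
    unfolding O_holomorphic_def H_vanishes_def Let_def
    using smooth in_charts_cong[OF iffs(1), of AN AM f] by simp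
  show "O_holomorphic AN J AM g f \<sigma> 1 \<longleftrightarrow> L_vanishes AN AM g f (- \<sigma>)"
    unfolding O_holomorphic_def L_vanishes_def Let_def
    using smooth in_charts_cong[OF iffs(2), of AN AM f] by simp
  have "horizontal AN AM g f \<sigma> \<longleftrightarrow> in_charts AN AM f (\<lambda>d c y. H_pm (g c) (local_rep d c f) (- \<sigma>) y = 0 \<and>
      (\<forall>X Y. L_pm (g c) (local_rep d c f) (- \<sigma>) y X Y = 0))"
    unfolding horizontal_def Let_def by (rule in_charts_cong[OF iffs(3)])
  then show "horizontal AN AM g f \<sigma> \<longleftrightarrow> H_vanishes AN AM g f (- \<sigma>) \<and> L_vanishes AN AM g f (- \<sigma>)"
    unfolding H_vanishes_def L_vanishes_def in_charts_def by blast
qed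

lemma grass_holomorphic_iff:
  shows "O_G_holomorphic AN J AM g f 1 \<longleftrightarrow> totally_umbilic AN AM g f"
    and "O_G_holomorphic AN J AM g f (- 1) \<longleftrightarrow> stationary AN AM g f"
    and "stationary AN AM g f \<longleftrightarrow> harmonic AN AM g f"
proof -
  note smooth = surface_patch.smooth_grass_lift[OF patch]
  note iffs = surface_patch.grass_holomorphic_at_iff[OF patch]
  show "O_G_holomorphic AN J AM g f 1 \<longleftrightarrow> totally_umbilic AN AM g f"
    unfolding O_G_holomorphic_def totally_umbilic_def Let_def
    using smooth in_charts_cong[OF iffs(1), of AN AM f] by simp
  show "O_G_holomorphic AN J AM g f (- 1) \<longleftrightarrow> stationary AN AM g f"
    unfolding O_G_holomorphic_def stationary_def Let_def
    using smooth in_charts_cong[OF iffs(2), of AN AM f] by simp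
  show "stationary AN AM g f \<longleftrightarrow> harmonic AN AM g f"
    unfolding stationary_def harmonic_def by (rule in_charts_cong) (simp add: iffs(3))
qed

end

theorem proposition3p1:
  fixes AN :: "('n::{t2_space,second_countable_topology}, 2) chart set"
    and C :: "('n, 2) tensor2 set"
    and J :: "('n, 2) tensor2"
    and AM :: "('m::{t2_space,second_countable_topology}, 4) chart set"
    and g :: "('m, 4) tensor2"
    and f :: "'n \<Rightarrow> 'm"
  assumes "riemannian_surface AN C J"
    and "oriented_atlas AM"
    and "lorentzian_metric AM g"
    and "conformal_immersion AN C AM g f"
  shows
    "((O_holomorphic AN J AM g f 1 (- 1) \<longleftrightarrow> H_vanishes AN AM g f (- 1)) \<and>
      (H_vanishes AN AM g f (- 1) \<longleftrightarrow> positive_semi_stationary AN AM g f) \<and>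
      (O_holomorphic AN J AM g f (- 1) (- 1) \<longleftrightarrow> H_vanishes AN AM g f 1) \<and>
      (H_vanishes AN AM g f 1 \<longleftrightarrow> negative_semi_stationary AN AM g f)) \<and>
     ((O_holomorphic AN J AM g f 1 1 \<longleftrightarrow> L_vanishes AN AM g f (- 1)) \<and>
      (O_holomorphic AN J AM g f (- 1) 1 \<longleftrightarrow> L_vanishes AN AM g f 1)) \<and>
     ((O_G_holomorphic AN J AM g f 1 \<longleftrightarrow> totally_umbilic AN AM g f) \<and>
      (O_G_holomorphic AN J AM g f (- 1) \<longleftrightarrow> stationary AN AM g f) \<and>
      (stationary AN AM g f \<longleftrightarrow> harmonic AN AM g f)) \<and>
     ((horizontal AN AM g f 1 \<longleftrightarrow> H_vanishes AN AM g f (- 1) \<and> L_vanishes AN AM g f (- 1)) \<and>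
      (H_vanishes AN AM g f (- 1) \<and> L_vanishes AN AM g f (- 1) \<longleftrightarrow> plus_isotropic AN AM g f) \<and>
      (horizontal AN AM g f (- 1) \<longleftrightarrow> H_vanishes AN AM g f 1 \<and> L_vanishes AN AM g f 1) \<and>
      (H_vanishes AN AM g f 1 \<and> L_vanishes AN AM g f 1 \<longleftrightarrow> minus_isotropic AN AM g f))"
  using twistor_holomorphic_iff[OF assms, of 1] twistor_holomorphic_iff[OF assms, of "- 1"]
    grass_holomorphic_iff[OF assms]
  by (simp add: positive_semi_stationary_def negative_semi_stationary_def plus_isotropic_def
      minus_isotropic_def)

end
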